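(* Let $d \ge 4$ and let $f \in L^1(\mathbb{R}^d)$. Suppose that the periodizations $g_\rho$ of $f$ belong to $L^2([0,1]^d)$ for almost every $\rho \in SO(d)$ and that $$G^2 := \int_{SO(d)} \|g_\rho\|_{L^2([0,1]^d)}^2 \, d\rho < \infty .$$ Then $f \in L^2(\mathbb{R}^d)$ and $$\|f\|_2 \le C\,(G + \|f\|_1),$$ where $C$ depends only on $d$.
   Context: For $f \in L^1(\mathbb{R}^d)$ and a rotation $\rho \in SO(d)$, the periodization of $f$ with respect to the rotated integer lattice is the $\mathbb{Z}^d$-periodic function $$g_\rho(x) = \sum_{\nu \in \mathbb{Z}^d} f(\rho(x-\nu)), \qquad x \in \mathbb{R}^d,$$ regarded as a function on $[0,1]^d$. The series converges absolutely for a.e. $x$, and $g_\rho \in L^1([0,1]^d)$. Here $d\rho$ denotes the normalized Haar (probability) measure on $SO(d)$. *)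

theory Defs
  imports "HOL-Analysis.Analysis" "HOL-Probability.Probability"
begin

definition SOd :: "(real^'n^'n) set" where
  "SOd = {A. orthogonal_matrix A \<and> det A = 1}"

definition haar_SO :: "(real^'n^'n) measure \<Rightarrow> bool" where
  "haar_SO \<mu> \<longleftrightarrow> sets \<mu> = sets (restrict_space borel (SOd :: (real^'n^'n) set))
     \<and> prob_space \<mu>
     \<and> (\<forall>R\<in>SOd. \<forall>B\<in>sets \<mu>. emeasure \<mu> ((\<lambda>A. R ** A) -` B \<inter> SOd) = emeasure \<mu> B)"

definition int_lattice :: "(real^'n) set" where
  "int_lattice = {v. \<forall>i. v $ i \<in> \<int>}"

text \<open>Periodization of f with respect to the rotated lattice:
  g_rho(x) = sum over nu in Z^d of f(rho(x - nu)) (defined a.e., where the series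
  converges absolutely).\<close>
definition periodization :: "(real^'n \<Rightarrow> complex) \<Rightarrow> real^'n^'n \<Rightarrow> real^'n \<Rightarrow> complex" where
  "periodization f \<rho> x = (\<Sum>\<^sub>\<infinity>\<nu>\<in>int_lattice. f (\<rho> *v (x - \<nu>)))"

definition unit_cube :: "(real^'n) set" where
  "unit_cube = cbox 0 1"

end

theory Submission
  imports Defs
begin

text \<open>
  Write \<open>F\<close> for the squared modulus of the Fourier transform of \<open>f\<close>. Bessel's inequality on the cube bounds
  \<open>\<Sum>\<^bsub>m\<in>\<int>\<^sup>d\<^esub> F(\<rho>m)\<close> by the squared norm of the periodization, and averaging over
  \<open>\<rho>\<close> gives \<open>\<Sum>\<^sub>n r\<^sub>d(n) M(n) \<le> G\<^sup>2\<close>, where \<open>r\<^sub>d(n)\<close> counts the lattice points with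
  \<open>|m|\<^sup>2 = n\<close> and \<open>M(t)\<close> is the mean of \<open>F\<close> over the sphere \<open>|\<xi>|\<^sup>2 = t\<close>.
  For \<open>n \<equiv> 4 (mod 8)\<close> the four-square theorem yields \<open>r\<^sub>d(n) \<ge> c n\<^bsup>d/2-1\<^esup>\<close>, the density of
  \<open>|\<xi>|\<^sup>2\<close> under Lebesgue measure. So \<open>G\<^sup>2\<close> controls a Riemann sum of \<open>\<integral>F\<close> along
  \<open>t = 4, 12, 20, \<dots>\<close>. By Poisson summation in \<open>t\<close> (carried out with the Fejer kernel and the
  weight \<open>exp (- a t)\<close>) the Riemann sum differs from the integral by terms
  \<open>\<integral>F(\<xi>) exp (2\<pi>ik|\<xi>|\<^sup>2/8)\<close>, which by the decay of the Fresnel kernel are at most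
  \<open>(4/|k|)\<^bsup>d/2\<^esup> \<parallel>f\<parallel>\<^sub>1\<^sup>2\<close>, and this is summable in \<open>k\<close> because \<open>d \<ge> 4\<close>.
\<close>

section \<open>Representations by four odd squares\<close>

text \<open>The residue class 4 modulo 8 is what makes d = 4 accessible: over all n the number of
  representations by four squares has no lower bound of order n (it is 24 at every power of 2 beyond
  1), whereas representations by four odd squares are counted exactly by a divisor sum that is at
  least n / 4. That count is obtained from an elementary recurrence, using Zagier's windmill
  involution in place of modular forms. Of the spherical mean M only continuity and boundedness are
  known, and integrability of F is part of what has to be shown. Hence the weight exp (- a t), with
  all final bounds uniform in a > 0, and hence the Fejer kernel: it is nonnegative and has finitely
  many harmonics, so that the Poisson summation becomes an identity between finite sums followed by
  a limit. Only one direction of the comparison is wanted, integral at most Riemann sum plus error,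
  and so a lower bound for the lattice count is enough. The return from F to f goes by duality: f is
  tested against its own truncations, with Gaussian smoothing to justify the pairing on the Fourier
  side.\<close>

definition windmills :: "int \<Rightarrow> (int \<times> int \<times> int) set" where
  "windmills n = {(x, a, b). a > 0 \<and> b > 0 \<and> x\<^sup>2 + 4 * (a * b) = n}"

lemma odd_square_int:
  assumes "odd (x::int)"
  obtains l where "x\<^sup>2 = 8 * l + 1"
proof -
  obtain k where k: "x = 2 * k + 1" using assms by (auto elim: oddE)
  have "even (k * (k + 1))" by simp
  then obtain l where "k * (k + 1) = 2 * l" by (elim evenE)
  with k have "x\<^sup>2 = 8 * l + 1" by (auto simp: power2_eq_square algebra_simps)
  then show thesis by (rule that)
qed

lemma finite_windmills: "finite (windmills n)"
proof (rule finite_subset)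
  show "windmills n \<subseteq> {-n..n} \<times> {0..n} \<times> {0..n}"
  proof safe
    fix x a b assume "(x, a, b) \<in> windmills n"
    then have *: "a > 0" "b > 0" "x\<^sup>2 + 4 * (a * b) = n" by (auto simp: windmills_def)
    have "a * b \<ge> a" "a * b \<ge> b" using * by (simp_all add: mult_le_cancel_left1 mult_le_cancel_right1)
    moreover have "\<bar>x\<bar> \<le> x\<^sup>2" using self_le_power[of "\<bar>x\<bar>" 2] by (cases "x = 0") auto
    moreover have "x\<^sup>2 \<ge> 0" by simp
    ultimately have "\<bar>x\<bar> \<le> n" "a \<le> n" "b \<le> n" using * by linarith+
    then show "x \<in> {-n..n}" "a \<in> {0..n}" "b \<in> {0..n}" using * by auto
  qed
qed auto

text \<open>Modulo 8 the odd square is 1, which leaves \<open>4 * (a * b)\<close> congruent to 4.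
  The parities exclude \<open>x = 0\<close> and \<open>b = a + x\<close>, the borderline cases in
  the splittings of the set made below.\<close>

lemma odd_of_windmill:
  assumes "n mod 8 = 5" "(x, a, b) \<in> windmills n"
  shows "odd x" "odd a" "odd b"
proof -
  have eq: "x\<^sup>2 + 4 * (a * b) = n" using assms by (auto simp: windmills_def)
  have "odd n" using assms(1) by presburger
  then show "odd x" using eq by (metis even_add even_mult_iff even_numeral even_power zero_less_numeral)
  then obtain l where "x\<^sup>2 = 8 * l + 1" by (rule odd_square_int)
  then have "8 * l + 1 + 4 * (a * b) = n" using eq by simp
  moreover have "odd p" if "8 * l + 1 + 4 * p = n" for p using that assms(1) by presburger
  ultimately have "odd (a * b)" by blast
  then show "odd a" "odd b" by auto
qed

text \<open>Modulo terms odd in \<open>x\<close>, adding the summand at \<open>(x, a, b)\<close> and at \<open>(- x, b, a)\<close>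
  gives \<open>(a + b) (x + a) (b - x)\<close>, which changes sign under Zagier's windmill involution of the
  half \<open>a + x < b\<close>.\<close>

lemma sum_windmills_eq_0:
  assumes n: "n mod 8 = 5"
  shows "(\<Sum>(x, a, b)\<in>windmills n. a * (a * b - x\<^sup>2)) = 0"
proof -
  let ?S = "windmills n"
  define A where "A = {(x, a, b) \<in> ?S. a + x < b}"
  define B where "B = {(x, a, b) \<in> ?S. b < a + x}"
  have fin: "finite A" "finite B" using finite_windmills[of n] by (auto simp: A_def B_def intro: finite_subset)
  have S: "?S = A \<union> B" "A \<inter> B = {}"
  proof -
    have "b \<noteq> a + x" if "(x, a, b) \<in> ?S" for x a b
      using odd_of_windmill[OF n that] by auto
    then show "?S = A \<union> B" "A \<inter> B = {}" unfolding A_def B_def by force+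
  qed
  define g where "g = (\<lambda>(x::int, a, b). a * (a * b - x\<^sup>2) - x * a\<^sup>2)"
  define h where "h = (\<lambda>(x::int, a, b). (a + b) * (x + a) * (b - x))"
  have odd: "(\<Sum>(x, a, b)\<in>?S. x * a\<^sup>2) = 0"
  proof -
    have "(\<Sum>(x, a, b)\<in>?S. x * a\<^sup>2) = (\<Sum>(x, a, b)\<in>?S. - x * a\<^sup>2)"
      by (rule sum.reindex_bij_witness[of _ "\<lambda>(x, a, b). (- x, a, b)" "\<lambda>(x, a, b). (- x, a, b)"])
         (auto simp: windmills_def)
    also have "\<dots> = - (\<Sum>(x, a, b)\<in>?S. x * a\<^sup>2)" by (simp add: sum_negf case_prod_unfold)
    finally show ?thesis by simp
  qed
  have "(\<Sum>(x, a, b)\<in>?S. a * (a * b - x\<^sup>2)) = sum g ?S + (\<Sum>(x, a, b)\<in>?S. x * a\<^sup>2)"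
    by (simp add: g_def case_prod_unfold flip: sum.distrib)
  also have "\<dots> = sum g A + sum g B" using S fin odd by (simp add: sum.union_disjoint)
  also have "sum g B = (\<Sum>(x, a, b)\<in>A. g (- x, b, a))"
    by (rule sum.reindex_bij_witness[of _ "\<lambda>(x, a, b). (- x, b, a)" "\<lambda>(x, a, b). (- x, b, a)"])
       (auto simp: A_def B_def windmills_def algebra_simps)
  also have "sum g A + (\<Sum>(x, a, b)\<in>A. g (- x, b, a)) = sum h A"
    unfolding sum.distrib[symmetric]
    by (rule sum.cong) (auto simp: g_def h_def algebra_simps power2_eq_square)
  also have "sum h A = 0"
  proof -
    \<comment> \<open>The involution exchanges the factors \<open>a + b\<close> and
      \<open>b - x\<close> of \<open>h\<close> and negates \<open>x + a\<close>.\<close>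
    have "sum h A = (\<Sum>p\<in>A. - h p)"
      by (rule sum.reindex_bij_witness[of _ "\<lambda>(x, a, b). (- x - 2 * a, a, b - a - x)"
            "\<lambda>(x, a, b). (- x - 2 * a, a, b - a - x)"])
         (auto simp: A_def h_def windmills_def algebra_simps power2_eq_square)
    then show ?thesis by (simp add: sum_negf)
  qed
  finally show ?thesis .
qed

definition odd_quads :: "int \<Rightarrow> (int \<times> int \<times> int \<times> int) set" where
  "odd_quads m = {(w, x, y, z). w > 0 \<and> x > 0 \<and> y > 0 \<and> z > 0 \<and> odd w \<and> odd x \<and> odd y \<and> odd z
     \<and> w\<^sup>2 + x\<^sup>2 + y\<^sup>2 + z\<^sup>2 = m}"

text \<open>If 4 divides \<open>m\<close>, the first components run over the divisors of
  \<open>m / 4\<close>, so their sum is the divisor sum in Jacobi's count of four odd squares. The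
  slice \<open>x = v\<close> of \<open>windmills n\<close> is
  \<open>factor_pairs (n - v^2)\<close>.\<close>

definition factor_pairs :: "int \<Rightarrow> (int \<times> int) set" where
  "factor_pairs m = {(a, b). a > 0 \<and> b > 0 \<and> 4 * (a * b) = m}"

definition small_odds :: "int \<Rightarrow> int set" where
  "small_odds n = {v. v > 0 \<and> odd v \<and> v\<^sup>2 < n}"

lemma pos_le_square: "(v::int) > 0 \<Longrightarrow> v \<le> v\<^sup>2"
  using self_le_power[of v 2] by auto

lemma finite_odd_quads: "finite (odd_quads m)"
proof (rule finite_subset)
  show "odd_quads m \<subseteq> {0..m} \<times> {0..m} \<times> {0..m} \<times> {0..m}"
  proof safe
    fix w x y z assume "(w, x, y, z) \<in> odd_quads m"
    then have *: "w > 0" "x > 0" "y > 0" "z > 0" "w\<^sup>2 + x\<^sup>2 + y\<^sup>2 + z\<^sup>2 = m" by (auto simp: odd_quads_def)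
    then have "w \<le> m" "x \<le> m" "y \<le> m" "z \<le> m"
      using pos_le_square[of w] pos_le_square[of x] pos_le_square[of y] pos_le_square[of z] by linarith+
    then show "w \<in> {0..m}" "x \<in> {0..m}" "y \<in> {0..m}" "z \<in> {0..m}" using * by auto
  qed
qed auto

lemma finite_factor_pairs: "finite (factor_pairs m)"
proof (rule finite_subset)
  show "factor_pairs m \<subseteq> snd ` windmills m"
    by (force simp: factor_pairs_def windmills_def image_iff)
qed (simp add: finite_windmills)

lemma finite_small_odds: "finite (small_odds n)"
proof (rule finite_subset)
  show "small_odds n \<subseteq> {0..n}" using pos_le_square by (force simp: small_odds_def)
qed auto

text \<open>By symmetry each of five odd squares with sum \<open>n\<close> has average \<open>n / 5\<close>.\<close>

lemma odd_quads_recurrence: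
  "(\<Sum>v\<in>small_odds n. (n - 5 * v\<^sup>2) * int (card (odd_quads (n - v\<^sup>2)))) = 0"
proof -
  define T where "T = Sigma (small_odds n) (\<lambda>v. odd_quads (n - v\<^sup>2))"
  have fin: "finite T" unfolding T_def using finite_small_odds finite_odd_quads by blast
  have T: "(v, w, x, y, z) \<in> T \<longleftrightarrow> v > 0 \<and> w > 0 \<and> x > 0 \<and> y > 0 \<and> z > 0 \<and> odd v \<and> odd w \<and> odd x
      \<and> odd y \<and> odd z \<and> v\<^sup>2 + w\<^sup>2 + x\<^sup>2 + y\<^sup>2 + z\<^sup>2 = n" for v w x y z
  proof -
    have "w\<^sup>2 + x\<^sup>2 + y\<^sup>2 + z\<^sup>2 > 0" if "w > 0"
    proof -
      have "w\<^sup>2 > 0" using that by simp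
      then show ?thesis by (smt (verit) zero_le_power2)
    qed
    then show ?thesis by (auto simp: T_def small_odds_def odd_quads_def)
  qed
  let ?I = "\<Sum>(v, w, x, y, z)\<in>T. v\<^sup>2"
  have w: "(\<Sum>(v, w, x, y, z)\<in>T. w\<^sup>2) = ?I"
    by (rule sum.reindex_bij_witness[of _ "\<lambda>(v, w, x, y, z). (w, v, x, y, z)" "\<lambda>(v, w, x, y, z). (w, v, x, y, z)"])
       (auto simp: T)
  have x: "(\<Sum>(v, w, x, y, z)\<in>T. x\<^sup>2) = ?I"
    by (rule sum.reindex_bij_witness[of _ "\<lambda>(v, w, x, y, z). (x, w, v, y, z)" "\<lambda>(v, w, x, y, z). (x, w, v, y, z)"])
       (auto simp: T)
  have y: "(\<Sum>(v, w, x, y, z)\<in>T. y\<^sup>2) = ?I"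
    by (rule sum.reindex_bij_witness[of _ "\<lambda>(v, w, x, y, z). (y, w, x, v, z)" "\<lambda>(v, w, x, y, z). (y, w, x, v, z)"])
       (auto simp: T)
  have z: "(\<Sum>(v, w, x, y, z)\<in>T. z\<^sup>2) = ?I"
    by (rule sum.reindex_bij_witness[of _ "\<lambda>(v, w, x, y, z). (z, w, x, y, v)" "\<lambda>(v, w, x, y, z). (z, w, x, y, v)"])
       (auto simp: T)
  have "(\<Sum>v\<in>small_odds n. (n - 5 * v\<^sup>2) * int (card (odd_quads (n - v\<^sup>2))))
      = (\<Sum>v\<in>small_odds n. \<Sum>q\<in>odd_quads (n - v\<^sup>2). n - 5 * v\<^sup>2)"
    by (simp add: mult.commute)
  also have "\<dots> = (\<Sum>(v, w, x, y, z)\<in>T. n - 5 * v\<^sup>2)"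
    unfolding T_def using finite_small_odds finite_odd_quads
    by (subst sum.Sigma) (auto simp: case_prod_unfold)
  also have "\<dots> = (\<Sum>(v, w, x, y, z)\<in>T. v\<^sup>2 + w\<^sup>2 + x\<^sup>2 + y\<^sup>2 + z\<^sup>2 - 5 * v\<^sup>2)"
    by (rule sum.cong) (auto simp: T)
  also have "\<dots> = ?I + (\<Sum>(v, w, x, y, z)\<in>T. w\<^sup>2) + (\<Sum>(v, w, x, y, z)\<in>T. x\<^sup>2)
      + (\<Sum>(v, w, x, y, z)\<in>T. y\<^sup>2) + (\<Sum>(v, w, x, y, z)\<in>T. z\<^sup>2) - 5 * ?I"
    by (simp only: case_prod_unfold sum.distrib sum_subtractf sum_distrib_left)
  also have "\<dots> = 0" unfolding w x y z by simp
  finally show ?thesis .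
qed

text \<open>On \<open>windmills n\<close> one has 4 (ab - x^2) = n - 5 x^2, so the vanishing
  windmill sum, cut into slices of constant x, is the recurrence already satisfied by the counts of
  \<open>odd_quads\<close>. The summand is even in x, hence the half x > 0 vanishes by
  itself.\<close>

lemma factor_pairs_recurrence:
  assumes n: "n mod 8 = 5"
  shows "(\<Sum>v\<in>small_odds n. (n - 5 * v\<^sup>2) * (\<Sum>(a, b)\<in>factor_pairs (n - v\<^sup>2). a)) = 0"
proof -
  let ?S = "windmills n"
  define P where "P = {(x, a, b) \<in> ?S. x > 0}"
  define N where "N = {(x, a, b) \<in> ?S. x < 0}"
  let ?f = "\<lambda>(x::int, a, b). a * (n - 5 * x\<^sup>2)"
  have fin: "finite P" "finite N" using finite_windmills[of n] by (auto simp: P_def N_def intro: finite_subset)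
  have S: "?S = P \<union> N" "P \<inter> N = {}"
  proof -
    have "x \<noteq> 0" if "(x, a, b) \<in> ?S" for x a b
      using odd_of_windmill[OF n that] by auto
    then show "?S = P \<union> N" "P \<inter> N = {}" unfolding P_def N_def by force+
  qed
  have "0 = 4 * (\<Sum>(x, a, b)\<in>?S. a * (a * b - x\<^sup>2))" using sum_windmills_eq_0[OF n] by simp
  also have "\<dots> = (\<Sum>p\<in>?S. ?f p)"
    unfolding sum_distrib_left by (rule sum.cong) (auto simp: windmills_def algebra_simps)
  also have "\<dots> = sum ?f P + sum ?f N" using S fin by (simp add: sum.union_disjoint)
  also have "sum ?f N = sum ?f P"
    by (rule sum.reindex_bij_witness[of _ "\<lambda>(x, a, b). (- x, a, b)" "\<lambda>(x, a, b). (- x, a, b)"])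
       (auto simp: P_def N_def windmills_def)
  finally have "sum ?f P = 0" by simp
  moreover have "P = Sigma (small_odds n) (\<lambda>v. factor_pairs (n - v\<^sup>2))"
  proof -
    have "(x, a, b) \<in> P \<longleftrightarrow> (x, a, b) \<in> Sigma (small_odds n) (\<lambda>v. factor_pairs (n - v\<^sup>2))" for x a b
    proof -
      have "odd x" if "(x, a, b) \<in> windmills n" using odd_of_windmill[OF n that] by simp
      moreover have "a * b > 0" if "a > 0" "b > 0" using that by simp
      ultimately show ?thesis
        by (auto simp: P_def small_odds_def factor_pairs_def windmills_def)
    qed
    then show ?thesis by auto
  qed
  ultimately have "0 = sum ?f (Sigma (small_odds n) (\<lambda>v. factor_pairs (n - v\<^sup>2)))" by simp
  also have "\<dots> = (\<Sum>v\<in>small_odds n. \<Sum>(a, b)\<in>factor_pairs (n - v\<^sup>2). a * (n - 5 * v\<^sup>2))"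
    using finite_small_odds finite_factor_pairs
    by (subst sum.Sigma) (auto simp: case_prod_unfold)
  also have "\<dots> = (\<Sum>v\<in>small_odds n. (n - 5 * v\<^sup>2) * (\<Sum>(a, b)\<in>factor_pairs (n - v\<^sup>2). a))"
    unfolding case_prod_unfold sum_distrib_right[symmetric] by (simp add: mult.commute)
  finally show ?thesis by simp
qed

text \<open>The term \<open>v = 1\<close> of the two recurrences for \<open>n = m + 1\<close> determines the value at \<open>m\<close>
  unless \<open>m = 4\<close>.\<close>

lemma card_odd_quads:
  assumes "m mod 8 = 4" "m > 0"
  shows "int (card (odd_quads m)) = (\<Sum>(a, b)\<in>factor_pairs m. a)"
  using assms
proof (induction "nat m" arbitrary: m rule: less_induct)
  case less
  show ?case
  proof (cases "m = 4")
    case True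
    have "odd_quads 4 = {(1, 1, 1, 1)}"
    proof -
      have "w = 1 \<and> x = 1 \<and> y = 1 \<and> z = 1"
        if "w > 0" "x > 0" "y > 0" "z > 0" "w\<^sup>2 + x\<^sup>2 + y\<^sup>2 + z\<^sup>2 = 4" for w x y z :: int
        using that pos_le_square[of w] pos_le_square[of x] pos_le_square[of y] pos_le_square[of z]
        by linarith
      then show ?thesis by (auto simp: odd_quads_def)
    qed
    moreover have "factor_pairs 4 = {(1, 1)}"
      by (auto simp: factor_pairs_def) (metis pos_zmult_eq_1_iff, metis mult.commute pos_zmult_eq_1_iff)
    ultimately show ?thesis using True by simp
  next
    case False
    define n where "n = m + 1"
    define D where "D = (\<lambda>m. int (card (odd_quads m)) - (\<Sum>(a, b)\<in>factor_pairs m. a))"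
    have n: "n mod 8 = 5" using less.prems unfolding n_def by presburger
    have "0 = (\<Sum>v\<in>small_odds n. (n - 5 * v\<^sup>2) * D (n - v\<^sup>2))"
      using odd_quads_recurrence[of n] factor_pairs_recurrence[OF n]
      by (simp add: D_def right_diff_distrib sum_subtractf)
    \<comment> \<open>For \<open>v > 1\<close> the number \<open>n - v^2\<close> is smaller than
      \<open>m\<close> and still 4 modulo 8, so the induction hypothesis makes the defect
      \<open>D\<close> vanish there.\<close>
    also have "\<dots> = (\<Sum>v\<in>{1}. (n - 5 * v\<^sup>2) * D (n - v\<^sup>2))"
    proof (rule sum.mono_neutral_right[OF finite_small_odds])
      show "{1} \<subseteq> small_odds n" using less.prems by (auto simp: small_odds_def n_def)
      show "\<forall>v\<in>small_odds n - {1}. (n - 5 * v\<^sup>2) * D (n - v\<^sup>2) = 0"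
      proof
        fix v assume "v \<in> small_odds n - {1}"
        then have v: "v > 1" "odd v" "v\<^sup>2 < n" by (auto simp: small_odds_def)
        then obtain l where "v\<^sup>2 = 8 * l + 1" by (elim odd_square_int)
        then have "(n - v\<^sup>2) mod 8 = 4" using n by presburger
        moreover have "v\<^sup>2 > 1" using v by simp
        then have "nat (n - v\<^sup>2) < nat m" using v less.prems by (simp add: n_def)
        ultimately have "D (n - v\<^sup>2) = 0" using less.hyps[of "n - v\<^sup>2"] v by (simp add: D_def)
        then show "(n - 5 * v\<^sup>2) * D (n - v\<^sup>2) = 0" by simp
      qed
    qed
    also have "\<dots> = (m - 4) * D m" by (simp add: n_def)
    finally have "D m = 0" using False by simp
    then show ?thesis by (simp add: D_def)
  qed
qed

text \<open>The single divisor m / 4 of m / 4 contributes enough, whatever the arithmetic of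
  m.\<close>

lemma card_odd_quads_ge:
  assumes "m mod 8 = 4" "m > 0"
  shows "4 * int (card (odd_quads m)) \<ge> m"
proof -
  have "m div 4 = (\<Sum>(a, b)\<in>{(m div 4, 1::int)}. a)" by simp
  also have "\<dots> \<le> (\<Sum>(a, b)\<in>factor_pairs m. a)"
  proof (rule sum_mono2[OF finite_factor_pairs])
    have "4 * (m div 4) = m" using assms by presburger
    then show "{(m div 4, 1)} \<subseteq> factor_pairs m" using assms by (auto simp: factor_pairs_def)
  qed (auto simp: factor_pairs_def)
  finally have "m div 4 \<le> int (card (odd_quads m))" using card_odd_quads[OF assms] by simp
  then show ?thesis using assms by presburger
qed

section \<open>Lattice points on spheres\<close>

lemma finite_lattice_sphere: "finite {v \<in> int_lattice :: (real^'n) set. (norm v)\<^sup>2 = t}"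
proof (rule finite_subset)
  let ?N = "\<lceil>t\<rceil>"
  show "{v \<in> int_lattice :: (real^'n) set. (norm v)\<^sup>2 = t}
      \<subseteq> (\<lambda>k. \<chi> i. real_of_int (k i)) ` (PiE UNIV (\<lambda>_. {-?N..?N}))"
  proof
    fix v :: "real^'n" assume "v \<in> {v \<in> int_lattice. (norm v)\<^sup>2 = t}"
    then have v: "\<And>i. v $ i \<in> \<int>" "(norm v)\<^sup>2 = t" by (auto simp: int_lattice_def)
    define k where "k i = \<lfloor>v $ i\<rfloor>" for i
    have k: "v $ i = real_of_int (k i)" for i using v(1)[of i] by (auto simp: k_def elim: Ints_cases)
    have "k i \<in> {-?N..?N}" for i
    proof -
      have "\<bar>k i\<bar> \<le> (k i)\<^sup>2" using self_le_power[of "\<bar>k i\<bar>" 2] by (cases "k i = 0") auto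
      also have "real_of_int ((k i)\<^sup>2) = (v $ i)\<^sup>2" by (simp add: k)
      then have "real_of_int ((k i)\<^sup>2) \<le> t"
        using component_le_norm_cart[of v i] v(2) power_mono[of "\<bar>v $ i\<bar>" "norm v" 2] by simp
      then have "(k i)\<^sup>2 \<le> ?N" by linarith
      finally show ?thesis by auto
    qed
    then have "k \<in> PiE UNIV (\<lambda>_. {-?N..?N})" by auto
    moreover have "v = (\<chi> i. real_of_int (k i))" by (simp add: vec_eq_iff k)
    ultimately show "v \<in> (\<lambda>k. \<chi> i. real_of_int (k i)) ` (PiE UNIV (\<lambda>_. {-?N..?N}))" by blast
  qed
qed (auto intro!: finite_imageI finite_PiE)

lemma obtain_4_distinct:
  assumes "CARD('n) \<ge> 4"
  obtains i j k l :: "'n::finite" where "distinct [i, j, k, l]"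
proof -
  obtain I :: "'n set" where I: "card I = 4"
    using obtain_subset_with_card_n[OF assms] by metis
  then have "finite I" by (metis card.infinite zero_neq_numeral)
  then obtain xs where "set xs = I" "distinct xs" using finite_distinct_list by blast
  then have "length xs = 4" "distinct xs" using I distinct_card by fastforce+
  then obtain i j k l where "xs = [i, j, k, l]"
    by (auto simp: numeral_eq_Suc length_Suc_conv)
  with \<open>distinct xs\<close> that show thesis by blast
qed

text \<open>Four coordinates carry an odd quadruple; the remaining ones run over multiples of 4,
  which keeps the residue modulo 8.\<close>

lemma card_lattice_sphere_ge:
  assumes d: "CARD('n) \<ge> 4"
  shows "\<exists>c>0. \<forall>n::nat. n mod 8 = 4 \<longrightarrow>
    c * real n powr (real CARD('n) / 2 - 1) \<le> real (card {v \<in> int_lattice :: (real^'n::finite) set. (norm v)\<^sup>2 = real n})"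
proof -
  obtain i1 i2 i3 i4 :: 'n where dist: "distinct [i1, i2, i3, i4]" using obtain_4_distinct[OF d] .
  define J where "J = UNIV - {i1, i2, i3, i4}"
  have cardJ: "card J = CARD('n) - 4"
    using dist unfolding J_def by (subst card_Diff_subset) auto
  define D where "D = real CARD('n)"
  have D: "D \<ge> 4" using d by (simp add: D_def)
  \<comment> \<open>The 1 / 8 is what each choice of the free coordinates contributes relative to
    \<open>n\<close>; the power bounds the number of choices, with exponent half the number of free
    coordinates.\<close>
  define c where "c = 1 / 8 * (1 / (32 * D)) powr ((D - 4) / 2)"
  have "c > 0" using D by (simp add: c_def)
  moreover have "c * real n powr (D / 2 - 1) \<le> real (card {v \<in> int_lattice :: (real^'n) set. (norm v)\<^sup>2 = real n})"
    if n: "n mod 8 = 4" for n :: nat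
  proof -
    have npos: "n > 0" using n by (cases n) auto
    \<comment> \<open>With \<open>32 * D * q^2\<close> at most \<open>n\<close>, the free
      coordinates use up at most half of \<open>n\<close>. The remainder \<open>m k\<close> is at
      least n / 2, hence is a sum of four odd squares in at least n / 8 ways.\<close>
    define q where "q = \<lfloor>sqrt (real n / (32 * D))\<rfloor>"
    have q0: "q \<ge> 0" using D by (simp add: q_def)
    have "real_of_int q \<le> sqrt (real n / (32 * D))" by (simp add: q_def)
    then have "(real_of_int q)\<^sup>2 \<le> (sqrt (real n / (32 * D)))\<^sup>2" using q0 by (intro power_mono) auto
    then have q2: "32 * D * (real_of_int q)\<^sup>2 \<le> real n" using D by (simp add: field_simps)
    define m where "m k = int n - 16 * (\<Sum>j\<in>J. (k j)\<^sup>2)" for k :: "'n \<Rightarrow> int"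
    define K where "K = PiE J (\<lambda>_. {-q..q})"
    have finK: "finite K" by (auto simp: K_def intro!: finite_PiE)
    have mk: "2 * m k \<ge> int n" "m k mod 8 = 4" if "k \<in> K" for k
    proof -
      have "(\<Sum>j\<in>J. (k j)\<^sup>2) \<le> (\<Sum>j\<in>J. q\<^sup>2)"
      proof (rule sum_mono)
        fix j assume "j \<in> J"
        then have "\<bar>k j\<bar> \<le> q" using that by (auto simp: K_def PiE_iff abs_le_iff)
        then show "(k j)\<^sup>2 \<le> q\<^sup>2" by (metis abs_ge_zero power2_abs power_mono)
      qed
      also have "\<dots> = int (card J) * q\<^sup>2" by simp
      also have "\<dots> \<le> int CARD('n) * q\<^sup>2" using cardJ by (intro mult_right_mono) auto
      finally have "32 * (\<Sum>j\<in>J. (k j)\<^sup>2) \<le> 32 * (int CARD('n) * q\<^sup>2)" by simp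
      also have "\<dots> \<le> int n"
      proof -
        have "real_of_int (32 * (int CARD('n) * q\<^sup>2)) \<le> real_of_int (int n)"
          using q2 by (simp add: D_def mult_ac)
        then show ?thesis by linarith
      qed
      finally show "2 * m k \<ge> int n" by (simp add: m_def)
      show "m k mod 8 = 4" using n unfolding m_def by presburger
    qed
    define S where "S = Sigma K (\<lambda>k. odd_quads (m k))"
    define \<Phi> :: "('n \<Rightarrow> int) \<times> int \<times> int \<times> int \<times> int \<Rightarrow> real^'n" where
      "\<Phi> = (\<lambda>(k, w, x, y, z). \<chi> i. real_of_int (if i = i1 then w else if i = i2 then x else if i = i3 then y
        else if i = i4 then z else 4 * k i))"
    have \<Phi>_nth: "\<Phi> (k, w, x, y, z) $ i1 = w" "\<Phi> (k, w, x, y, z) $ i2 = x" "\<Phi> (k, w, x, y, z) $ i3 = y"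
        "\<Phi> (k, w, x, y, z) $ i4 = z" "\<And>j. j \<in> J \<Longrightarrow> \<Phi> (k, w, x, y, z) $ j = 4 * k j" for k w x y z
      using dist by (auto simp: \<Phi>_def J_def)
    have inj: "inj_on \<Phi> S"
    proof (rule inj_onI)
      fix p p' assume p: "p \<in> S" "p' \<in> S" "\<Phi> p = \<Phi> p'"
      obtain k w x y z k' w' x' y' z' where pp: "p = (k, w, x, y, z)" "p' = (k', w', x', y', z')"
        by (metis prod_cases5)
      note * = p[unfolded pp]
      have "w = w'" "x = x'" "y = y'" "z = z'"
        using *(3) \<Phi>_nth(1-4)[of k w x y z] \<Phi>_nth(1-4)[of k' w' x' y' z'] by (metis of_int_eq_iff)+
      moreover have "k j = k' j" for j
      proof (cases "j \<in> J")
        case True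
        then have "4 * real_of_int (k j) = 4 * real_of_int (k' j)"
          using *(3) \<Phi>_nth(5)[of j k w x y z] \<Phi>_nth(5)[of j k' w' x' y' z'] by (metis of_int_mult of_int_numeral)
        then show ?thesis by simp
      next
        case False
        then show ?thesis using * by (auto simp: S_def K_def PiE_iff extensional_def)
      qed
      ultimately show "p = p'" unfolding pp by blast
    qed
    have sub: "\<Phi> ` S \<subseteq> {v \<in> int_lattice. (norm v)\<^sup>2 = real n}"
    proof clarify
      fix k w x y z assume "(k, w, x, y, z) \<in> S"
      then have eq: "w\<^sup>2 + x\<^sup>2 + y\<^sup>2 + z\<^sup>2 = m k" by (auto simp: S_def odd_quads_def)
      let ?v = "\<Phi> (k, w, x, y, z)"
      have int: "?v \<in> int_lattice" by (auto simp: \<Phi>_def int_lattice_def)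
      have "(norm ?v)\<^sup>2 = (\<Sum>i\<in>UNIV. (?v $ i)\<^sup>2)"
        by (simp add: norm_vec_def L2_set_def sum_nonneg)
      also have "\<dots> = (\<Sum>i\<in>J. (?v $ i)\<^sup>2) + (\<Sum>i\<in>{i1, i2, i3, i4}. (?v $ i)\<^sup>2)"
        unfolding J_def by (rule sum.subset_diff) auto
      also have "(\<Sum>i\<in>J. (?v $ i)\<^sup>2) = 16 * (\<Sum>j\<in>J. (real_of_int (k j))\<^sup>2)"
        unfolding sum_distrib_left by (rule sum.cong) (auto simp: \<Phi>_nth power_mult_distrib)
      also have "(\<Sum>i\<in>{i1, i2, i3, i4}. (?v $ i)\<^sup>2) = real_of_int (w\<^sup>2 + x\<^sup>2 + y\<^sup>2 + z\<^sup>2)"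
        using dist by (simp add: \<Phi>_nth)
      also have "\<dots> = real_of_int (m k)" by (simp only: eq)
      also have "\<dots> = real n - 16 * (\<Sum>j\<in>J. (real_of_int (k j))\<^sup>2)" by (simp add: m_def)
      finally show "?v \<in> int_lattice \<and> (norm ?v)\<^sup>2 = real n" using int by (simp only: m_def; simp)
    qed
    have "c * real n powr (D / 2 - 1) = (real n / 8) * (real n / (32 * D)) powr ((D - 4) / 2)"
    proof -
      have "real n powr (D / 2 - 1) = real n powr (1 + (D - 4) / 2)" by (simp add: field_simps)
      also have "\<dots> = real n * real n powr ((D - 4) / 2)" using npos by (simp add: powr_add)
      finally show ?thesis using D npos by (simp add: c_def powr_divide)
    qed
    also have "(real n / (32 * D)) powr ((D - 4) / 2) = sqrt (real n / (32 * D)) ^ card J"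
    proof -
      have "(real n / (32 * D)) powr ((D - 4) / 2) = sqrt (real n / (32 * D)) powr (D - 4)"
        using D npos by (simp add: powr_half_sqrt[symmetric] powr_powr)
      also have "sqrt (real n / (32 * D)) powr (D - 4) = sqrt (real n / (32 * D)) powr real (card J)"
        using d by (simp add: cardJ D_def)
      also have "\<dots> = sqrt (real n / (32 * D)) ^ card J"
        using D npos by (intro powr_realpow) auto
      finally show ?thesis .
    qed
    \<comment> \<open>A nonnegative real is below its floor plus 1, hence below
      \<open>2 * q + 1\<close>, also when \<open>q = 0\<close>.\<close>
    also have "\<dots> \<le> (2 * real_of_int q + 1) ^ card J"
      using D q0 unfolding q_def by (intro power_mono) linarith+
    also have "(2 * real_of_int q + 1) ^ card J = real (card K)"
      using q0 by (simp add: K_def card_PiE J_def)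
    also have "real n / 8 * real (card K) = (\<Sum>k\<in>K. real n / 8)" by simp
    also have "\<dots> \<le> (\<Sum>k\<in>K. real (card (odd_quads (m k))))"
    proof (rule sum_mono)
      fix k assume "k \<in> K"
      then have "4 * int (card (odd_quads (m k))) \<ge> m k"
        using mk[of k] npos by (intro card_odd_quads_ge) auto
      then have "8 * int (card (odd_quads (m k))) \<ge> int n" using mk[OF \<open>k \<in> K\<close>] by linarith
      then show "real n / 8 \<le> real (card (odd_quads (m k)))" by linarith
    qed
    also have "\<dots> = real (card S)"
      using finK by (simp add: S_def card_SigmaI finite_odd_quads)
    also have "card S = card (\<Phi> ` S)" using inj by (simp add: card_image)
    also have "real (card (\<Phi> ` S)) \<le> real (card {v \<in> int_lattice :: (real^'n) set. (norm v)\<^sup>2 = real n})"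
      using card_mono[OF finite_lattice_sphere sub] by simp
    finally show ?thesis by (simp add: mult_left_mono)
  qed
  ultimately show ?thesis unfolding D_def by blast
qed

section \<open>Gaussian and Fresnel integrals\<close>

lemma measurable_cis [measurable]: "cis \<in> borel_measurable borel"
  by (intro borel_measurable_continuous_onI continuous_intros)

lemma measurable_cnj [measurable]: "cnj \<in> borel_measurable borel"
  by (intro borel_measurable_continuous_onI continuous_intros)

lemma norm_square_eq_sum_Basis: "(norm x)\<^sup>2 = (\<Sum>b\<in>Basis. (x \<bullet> b)\<^sup>2)" for x :: "'a::euclidean_space"
  unfolding power2_norm_eq_inner by (subst euclidean_inner) (simp add: power2_eq_square)

text \<open>Fubini in product form. It reduces the Gaussian and Fresnel integrals, and later the
  characters on the cube, to dimension one.\<close>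

lemma has_bochner_integral_prod_lborel:
  fixes g :: "'a::euclidean_space \<Rightarrow> real \<Rightarrow> 'b::{real_normed_field,banach,second_countable_topology}"
  assumes g: "\<And>b. b \<in> Basis \<Longrightarrow> integrable lborel (g b)"
  shows "has_bochner_integral lborel (\<lambda>x::'a. \<Prod>b\<in>Basis. g b (x \<bullet> b)) (\<Prod>b\<in>Basis. \<integral>t. g b t \<partial>lborel)"
proof -
  interpret P: product_sigma_finite "\<lambda>_::'a. lborel :: real measure" ..
  let ?T = "\<lambda>f::'a \<Rightarrow> real. \<Sum>b\<in>Basis. f b *\<^sub>R b"
  have [measurable]: "\<And>b. b \<in> Basis \<Longrightarrow> g b \<in> borel_measurable borel"
    using g borel_measurable_integrable by fastforce
  have T: "?T \<in> measurable (Pi\<^sub>M Basis (\<lambda>_. lborel)) borel" by measurable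
  have eq: "(\<Prod>b\<in>Basis. g b (?T x \<bullet> b)) = (\<Prod>b\<in>Basis. g b (x b))" for x
    by (rule prod.cong) (auto simp: inner_sum_left inner_Basis if_distrib sum.delta cong: if_cong)
  have "has_bochner_integral (Pi\<^sub>M Basis (\<lambda>_. lborel)) (\<lambda>x. \<Prod>b\<in>Basis. g b (x b)) (\<Prod>b\<in>Basis. \<integral>t. g b t \<partial>lborel)"
    using P.product_integrable_prod[of Basis g] P.product_integral_prod[of Basis g] g
    by (simp add: has_bochner_integral_iff)
  then show ?thesis
    by (subst lborel_eq) (intro has_bochner_integral_distr T, auto simp: eq)
qed

text \<open>This is the characteristic function of the standard normal distribution, rescaled by
  \<open>c = sqrt (2 * a)\<close>.\<close>

lemma has_bochner_integral_gaussian_fourier: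
  assumes a: "a > (0::real)"
  shows "has_bochner_integral lborel (\<lambda>s. exp (- a * s\<^sup>2) *\<^sub>R cis (t * s))
    (complex_of_real (sqrt (pi / a) * exp (- t\<^sup>2 / (4 * a))))"
proof -
  define c where "c = sqrt (2 * a)"
  have c: "c > 0" "c\<^sup>2 = 2 * a" using a by (auto simp: c_def)
  have N: "has_bochner_integral lborel (\<lambda>x. std_normal_density x *\<^sub>R cis (u * x)) (complex_of_real (exp (- u\<^sup>2 / 2)))" for u
  proof -
    have "integrable std_normal_distribution (\<lambda>x. iexp (u * x))"
      by (rule finite_measure.integrable_const_bound[where B = 1])
         (auto intro: real_dist_normal_dist[THEN real_distribution.axioms(1), THEN prob_space.axioms(1)])
    moreover have "(CLINT x|std_normal_distribution. iexp (u * x)) = complex_of_real (exp (- u\<^sup>2 / 2))"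
      using fun_cong[OF char_std_normal_distribution, of u] by (simp add: char_def)
    ultimately have "has_bochner_integral std_normal_distribution (\<lambda>x. iexp (u * x)) (complex_of_real (exp (- u\<^sup>2 / 2)))"
      by (simp add: has_bochner_integral_iff)
    then show ?thesis
      by (simp add: has_bochner_integral_iff integrable_density integral_density normal_density_nonneg cis_conv_exp)
  qed
  have "has_bochner_integral lborel (\<lambda>x. std_normal_density (c * x) *\<^sub>R cis (t / c * (c * x)))
      (complex_of_real (exp (- (t / c)\<^sup>2 / 2)) /\<^sub>R \<bar>c\<bar>)"
    using lborel_has_bochner_integral_real_affine_iff[of c "\<lambda>x. std_normal_density x *\<^sub>R cis (t / c * x)" _ 0] N[of "t / c"] c
    by simp
  then have "has_bochner_integral lborel (\<lambda>x. sqrt (2 * pi) *\<^sub>R (std_normal_density (c * x) *\<^sub>R cis (t / c * (c * x))))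
      (sqrt (2 * pi) *\<^sub>R (complex_of_real (exp (- (t / c)\<^sup>2 / 2)) /\<^sub>R \<bar>c\<bar>))"
    by (intro has_bochner_integral_scaleR_right)
  moreover have "sqrt (2 * pi) *\<^sub>R (std_normal_density (c * x) *\<^sub>R cis (t / c * (c * x))) = exp (- a * x\<^sup>2) *\<^sub>R cis (t * x)" for x
    using c by (simp add: normal_density_def power_mult_distrib)
  moreover have "sqrt (2 * pi) *\<^sub>R (complex_of_real (exp (- (t / c)\<^sup>2 / 2)) /\<^sub>R \<bar>c\<bar>)
      = complex_of_real (sqrt (pi / a) * exp (- t\<^sup>2 / (4 * a)))"
  proof -
    have "sqrt (2 * pi) / c = sqrt (pi / a)" using a by (simp add: c_def real_sqrt_divide[symmetric])
    moreover have "(t / c)\<^sup>2 / 2 = t\<^sup>2 / (4 * a)" using c by (simp add: power_divide)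
    ultimately show ?thesis using c by (simp add: scaleR_conv_of_real divide_simps)
  qed
  ultimately show ?thesis by simp
qed

lemma has_bochner_integral_gaussian:
  assumes "a > (0::real)"
  shows "has_bochner_integral lborel (\<lambda>s. exp (- a * s\<^sup>2)) (sqrt (pi / a))"
proof -
  have "has_bochner_integral lborel (\<lambda>s. complex_of_real (exp (- a * s\<^sup>2))) (complex_of_real (sqrt (pi / a)))"
    using has_bochner_integral_gaussian_fourier[OF assms, of 0] by (simp add: scaleR_conv_of_real)
  from has_bochner_integral_Re[OF this] show ?thesis by (simp only: Re_complex_of_real)
qed

lemmas integrable_gaussian = has_bochner_integral_gaussian[THEN integrable.intros]
  and integral_gaussian = has_bochner_integral_gaussian[THEN has_bochner_integral_integral_eq]

text \<open>\<open>\<bar>I\<bar>\<^sup>2\<close> as a double integral in \<open>s\<close> and \<open>p = s - r\<close>: the phase becomes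
  linear in \<open>s\<close>, so that only real Gaussians occur.\<close>

lemma norm_fresnel_integral_le:
  fixes a l t :: real
  assumes a: "a > 0" and l: "l \<noteq> 0"
  defines "g \<equiv> \<lambda>s::real. exp (- a * s\<^sup>2) *\<^sub>R cis (l * s\<^sup>2 + t * s)"
  shows "integrable lborel g" "cmod (\<integral>s. g s \<partial>lborel) \<le> sqrt (pi / \<bar>l\<bar>)"
proof -
  have [measurable]: "g \<in> borel_measurable borel" unfolding g_def by measurable
  show int: "integrable lborel g"
    by (rule Bochner_Integration.integrable_bound[OF integrable_gaussian[OF a]]) (auto simp: g_def)
  let ?I = "\<integral>s. g s \<partial>lborel"
  have "?I * cnj ?I = (\<integral>s. g s * cnj ?I \<partial>lborel)" by simp
  also have "\<dots> = (\<integral>s. \<integral>p. g s * cnj (g (s - p)) \<partial>lborel \<partial>lborel)"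
  proof (rule Bochner_Integration.integral_cong[OF refl])
    fix s :: real
    have "cnj ?I = (\<integral>r. cnj (g r) \<partial>lborel)" by simp
    also have "\<dots> = (\<integral>p. cnj (g (s - p)) \<partial>lborel)"
      using lborel_integral_real_affine[of "-1" "\<lambda>r. cnj (g r)" s] by simp
    finally show "g s * cnj ?I = (\<integral>p. g s * cnj (g (s - p)) \<partial>lborel)" by simp
  qed
  also have "\<dots> = (\<integral>p. \<integral>s. g s * cnj (g (s - p)) \<partial>lborel \<partial>lborel)"
  proof (rule lborel_pair.Fubini_integral[symmetric])
    have n: "(\<integral>p. norm (g s * cnj (g (s - p))) \<partial>lborel) = norm (g s) * (\<integral>r. norm (g r) \<partial>lborel)" for s
      using lborel_integral_real_affine[of "-1" "\<lambda>r. norm (g r)" s] by (simp add: norm_mult)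
    have "integrable lborel (\<lambda>p. g (s - p))" for s
      using lborel_integrable_real_affine[OF int, of "-1" s] by simp
    then show "integrable (lborel \<Otimes>\<^sub>M lborel) (\<lambda>(s, p). g s * cnj (g (s - p)))"
      by (intro lborel_pair.Fubini_integrable) (auto simp: n integrable_norm[OF int])
  qed
  also have "\<dots> = (\<integral>p. complex_of_real (sqrt (pi / (2 * a)) * exp (- ((a\<^sup>2 + l\<^sup>2) / (2 * a)) * p\<^sup>2)) * cis (t * p) \<partial>lborel)"
  proof (rule Bochner_Integration.integral_cong[OF refl])
    fix p :: real
    \<comment> \<open>Completing the square: s^2 + (s - p)^2 = 2 (s - p/2)^2 + p^2 / 2, while s^2 -
      (s - p)^2 = 2 p (s - p/2) is linear in s.\<close>
    have gg: "g s * cnj (g (s - p)) = (exp (- a * p\<^sup>2 / 2) *\<^sub>R cis (t * p)) * (exp (- (2 * a) * (s - p / 2)\<^sup>2) *\<^sub>R cis (2 * l * p * (s - p / 2)))" for s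
    proof -
      have e: "exp (- a * s\<^sup>2) * exp (- a * (s - p)\<^sup>2) = exp (- a * p\<^sup>2 / 2) * exp (- (2 * a) * (s - p / 2)\<^sup>2)"
        unfolding exp_add[symmetric] by (simp add: field_simps power2_eq_square)
      have c: "cis (l * s\<^sup>2 + t * s) * cis (- (l * (s - p)\<^sup>2 + t * (s - p))) = cis (t * p) * cis (2 * l * p * (s - p / 2))"
        unfolding cis_mult by (rule arg_cong[where f = cis]) (simp add: field_simps power2_eq_square)
      have "g s * cnj (g (s - p)) = complex_of_real (exp (- a * s\<^sup>2) * exp (- a * (s - p)\<^sup>2))
          * (cis (l * s\<^sup>2 + t * s) * cis (- (l * (s - p)\<^sup>2 + t * (s - p))))"
        by (simp add: g_def cis_cnj scaleR_conv_of_real)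
      then show ?thesis unfolding e c by (simp add: scaleR_conv_of_real)
    qed
    have "(\<integral>s. g s * cnj (g (s - p)) \<partial>lborel) = (exp (- a * p\<^sup>2 / 2) *\<^sub>R cis (t * p)) *
       (\<integral>s. exp (- (2 * a) * (s - p / 2)\<^sup>2) *\<^sub>R cis (2 * l * p * (s - p / 2)) \<partial>lborel)"
      by (simp only: gg integral_mult_right_zero)
    also have "(\<integral>s. exp (- (2 * a) * (s - p / 2)\<^sup>2) *\<^sub>R cis (2 * l * p * (s - p / 2)) \<partial>lborel)
        = (\<integral>s. exp (- (2 * a) * s\<^sup>2) *\<^sub>R cis (2 * l * p * s) \<partial>lborel)"
      using lborel_integral_real_affine[of 1 "\<lambda>s. exp (- (2 * a) * s\<^sup>2) *\<^sub>R cis (2 * l * p * s)" "- p / 2"]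
      by (simp add: algebra_simps)
    also have "\<dots> = complex_of_real (sqrt (pi / (2 * a)) * exp (- (2 * l * p)\<^sup>2 / (4 * (2 * a))))"
      using has_bochner_integral_gaussian_fourier[of "2 * a" "2 * l * p"] a by (simp add: has_bochner_integral_iff)
    also have "(exp (- a * p\<^sup>2 / 2) *\<^sub>R cis (t * p)) * complex_of_real (sqrt (pi / (2 * a)) * exp (- (2 * l * p)\<^sup>2 / (4 * (2 * a))))
       = complex_of_real (sqrt (pi / (2 * a)) * (exp (- a * p\<^sup>2 / 2) * exp (- (2 * l * p)\<^sup>2 / (4 * (2 * a))))) * cis (t * p)"
      by (simp add: scaleR_conv_of_real)
    also have "exp (- a * p\<^sup>2 / 2) * exp (- (2 * l * p)\<^sup>2 / (4 * (2 * a))) = exp (- ((a\<^sup>2 + l\<^sup>2) / (2 * a)) * p\<^sup>2)"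
      using a by (simp add: field_simps power2_eq_square flip: exp_add)
    finally show "(\<integral>s. g s * cnj (g (s - p)) \<partial>lborel) = complex_of_real (sqrt (pi / (2 * a)) * exp (- ((a\<^sup>2 + l\<^sup>2) / (2 * a)) * p\<^sup>2)) * cis (t * p)" .
  qed
  finally have I2: "?I * cnj ?I = (\<integral>p. complex_of_real (sqrt (pi / (2 * a)) * exp (- ((a\<^sup>2 + l\<^sup>2) / (2 * a)) * p\<^sup>2)) * cis (t * p) \<partial>lborel)" .
  have pos: "(a\<^sup>2 + l\<^sup>2) / (2 * a) > 0" using a by (simp add: add_pos_nonneg)
  have "cmod (?I * cnj ?I) \<le> (\<integral>p. cmod (complex_of_real (sqrt (pi / (2 * a)) * exp (- ((a\<^sup>2 + l\<^sup>2) / (2 * a)) * p\<^sup>2)) * cis (t * p)) \<partial>lborel)"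
    unfolding I2 by (rule Bochner_Integration.integral_norm_bound)
  also have "\<dots> = (\<integral>p. sqrt (pi / (2 * a)) * exp (- ((a\<^sup>2 + l\<^sup>2) / (2 * a)) * p\<^sup>2) \<partial>lborel)"
    using a by (simp add: norm_mult)
  also have "\<dots> = sqrt (pi / (2 * a)) * sqrt (pi / ((a\<^sup>2 + l\<^sup>2) / (2 * a)))"
    by (simp only: integral_mult_right_zero integral_gaussian[OF pos])
  also have "\<dots> = pi / sqrt (a\<^sup>2 + l\<^sup>2)"
  proof -
    have "sqrt (pi / (2 * a)) * sqrt (pi / ((a\<^sup>2 + l\<^sup>2) / (2 * a))) = sqrt (pi\<^sup>2 / (a\<^sup>2 + l\<^sup>2))"
      using a by (simp add: power2_eq_square flip: real_sqrt_mult)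
    then show ?thesis by (simp add: real_sqrt_divide)
  qed
  \<comment> \<open>Dropping \<open>a^2\<close> makes the bound independent of the Gaussian
    weight.\<close>
  also have "\<dots> \<le> pi / \<bar>l\<bar>" using l a by (intro divide_left_mono) (auto intro: real_le_rsqrt simp: add_pos_pos mult_pos_pos)
  finally have "(cmod ?I)\<^sup>2 \<le> pi / \<bar>l\<bar>" by (simp add: norm_mult power2_eq_square)
  then show "cmod ?I \<le> sqrt (pi / \<bar>l\<bar>)" by (rule real_le_rsqrt)
qed

lemma gaussian_fourier_euclidean:
  fixes u :: "'a::euclidean_space"
  assumes a: "a > 0"
  shows "has_bochner_integral lborel (\<lambda>x. exp (- a * (norm x)\<^sup>2) *\<^sub>R cis (u \<bullet> x))
    (complex_of_real (sqrt (pi / a) ^ DIM('a) * exp (- (norm u)\<^sup>2 / (4 * a))))"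
proof -
  have "has_bochner_integral lborel (\<lambda>x::'a. \<Prod>b\<in>Basis. exp (- a * (x \<bullet> b)\<^sup>2) *\<^sub>R cis ((u \<bullet> b) * (x \<bullet> b)))
      (\<Prod>b\<in>(Basis::'a set). complex_of_real (sqrt (pi / a) * exp (- (u \<bullet> b)\<^sup>2 / (4 * a))))"
    using has_bochner_integral_prod_lborel[of "\<lambda>b s. exp (- a * s\<^sup>2) *\<^sub>R cis ((u \<bullet> b) * s)"]
      has_bochner_integral_gaussian_fourier[OF a] by (auto simp: has_bochner_integral_iff)
  moreover have "(\<Prod>b\<in>Basis. exp (- a * (x \<bullet> b)\<^sup>2) *\<^sub>R cis ((u \<bullet> b) * (x \<bullet> b))) = exp (- a * (norm x)\<^sup>2) *\<^sub>R cis (u \<bullet> x)" for x :: 'a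
  proof -
    have "exp (- a * (norm x)\<^sup>2) = (\<Prod>b\<in>Basis. exp (- a * (x \<bullet> b)\<^sup>2))"
      by (simp add: norm_square_eq_sum_Basis[of x] sum_distrib_left exp_sum[symmetric] sum_negf)
    moreover have "cis (u \<bullet> x) = (\<Prod>b\<in>Basis. cis ((u \<bullet> b) * (x \<bullet> b)))"
      by (simp add: euclidean_inner[of u x] cis_conv_exp sum_distrib_left exp_sum)
    ultimately show ?thesis by (simp add: scaleR_conv_of_real prod.distrib)
  qed
  moreover have "(\<Prod>b\<in>(Basis::'a set). complex_of_real (sqrt (pi / a) * exp (- (u \<bullet> b)\<^sup>2 / (4 * a))))
      = complex_of_real (sqrt (pi / a) ^ DIM('a) * exp (- (norm u)\<^sup>2 / (4 * a)))"
  proof -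
    have "exp (- (norm u)\<^sup>2 / (4 * a)) = (\<Prod>b\<in>Basis. exp (- (u \<bullet> b)\<^sup>2 / (4 * a)))"
      by (simp add: norm_square_eq_sum_Basis[of u] exp_sum[symmetric] sum_negf sum_divide_distrib)
    then show ?thesis by (simp add: prod.distrib del: of_real_mult of_real_exp flip: of_real_prod)
  qed
  ultimately show ?thesis by simp
qed

text \<open>The phase and the weight are sums over the coordinates, so the integral factors; each
  coordinate supplies one factor of order |l|^(-1/2), uniformly in \<open>a\<close> and
  \<open>u\<close>.\<close>

lemma norm_fresnel_integral_euclidean_le:
  fixes u :: "'a::euclidean_space"
  assumes a: "a > 0" and l: "l \<noteq> 0"
  shows "cmod (\<integral>x. exp (- a * (norm x)\<^sup>2) *\<^sub>R cis (l * (norm x)\<^sup>2 + u \<bullet> x) \<partial>lborel) \<le> sqrt (pi / \<bar>l\<bar>) ^ DIM('a)"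
proof -
  let ?g = "\<lambda>b s. exp (- a * s\<^sup>2) *\<^sub>R cis (l * s\<^sup>2 + (u \<bullet> b) * s)"
  have "exp (- a * (norm x)\<^sup>2) *\<^sub>R cis (l * (norm x)\<^sup>2 + u \<bullet> x) = (\<Prod>b\<in>Basis. ?g b (x \<bullet> b))" for x :: 'a
  proof -
    have "exp (- a * (norm x)\<^sup>2) = (\<Prod>b\<in>Basis. exp (- a * (x \<bullet> b)\<^sup>2))"
      by (simp add: norm_square_eq_sum_Basis[of x] sum_distrib_left exp_sum[symmetric] sum_negf)
    moreover have "cis (l * (norm x)\<^sup>2 + u \<bullet> x) = (\<Prod>b\<in>Basis. cis (l * (x \<bullet> b)\<^sup>2 + (u \<bullet> b) * (x \<bullet> b)))"
      by (simp add: norm_square_eq_sum_Basis[of x] euclidean_inner[of u x] cis_conv_exp sum_distrib_left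
           sum.distrib[symmetric] exp_sum[symmetric] distrib_left)
    ultimately show ?thesis by (simp add: scaleR_conv_of_real prod.distrib)
  qed
  then have "(\<integral>x. exp (- a * (norm x)\<^sup>2) *\<^sub>R cis (l * (norm x)\<^sup>2 + u \<bullet> x) \<partial>lborel) = (\<Prod>b\<in>Basis. \<integral>t. ?g b t \<partial>lborel)"
    using has_bochner_integral_prod_lborel[of ?g] norm_fresnel_integral_le(1)[OF a l] by (auto simp: has_bochner_integral_iff)
  also have "cmod \<dots> \<le> (\<Prod>b\<in>(Basis::'a set). sqrt (pi / \<bar>l\<bar>))"
    unfolding prod_norm[symmetric] using norm_fresnel_integral_le(2)[OF a l] by (intro prod_mono) auto
  finally show ?thesis by simp
qed

section \<open>The Fourier transform\<close>

text \<open>With 2 pi in the exponent, the Fourier coefficients of a periodization over the integer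
  lattice are values of the transform at lattice points.\<close>

definition fourier :: "('a::euclidean_space \<Rightarrow> complex) \<Rightarrow> 'a \<Rightarrow> complex" where
  "fourier f \<xi> = (\<integral>x. f x * cis (- (2 * pi * (x \<bullet> \<xi>))) \<partial>lborel)"

lemma integrable_mult_cis:
  fixes f :: "'a \<Rightarrow> complex"
  assumes "integrable M f" "g \<in> borel_measurable M"
  shows "integrable M (\<lambda>x. f x * cis (g x))"
  by (rule Bochner_Integration.integrable_bound[OF assms(1)])
     (use assms borel_measurable_integrable[OF assms(1)] in \<open>auto simp: norm_mult\<close>)

lemma integrable_fourier: "integrable lborel f \<Longrightarrow> integrable lborel (\<lambda>x. f x * cis (- (2 * pi * (x \<bullet> \<xi>))))"
  by (rule integrable_mult_cis) auto

lemma norm_fourier_le: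
  assumes f: "integrable lborel f"
  shows "cmod (fourier f \<xi>) \<le> (\<integral>x. cmod (f x) \<partial>lborel)"
proof -
  have "cmod (fourier f \<xi>) \<le> (\<integral>x. cmod (f x * cis (- (2 * pi * (x \<bullet> \<xi>)))) \<partial>lborel)"
    unfolding fourier_def by (rule integral_norm_bound)
  then show ?thesis by (simp add: norm_mult)
qed

lemma continuous_fourier:
  assumes f: "integrable lborel f"
  shows "continuous_on UNIV (fourier f)"
  unfolding continuous_on_sequentially comp_def
proof safe
  fix X and \<xi> :: 'a assume "X \<longlonglongrightarrow> \<xi>"
  then show "(\<lambda>n. fourier f (X n)) \<longlonglongrightarrow> fourier f \<xi>"
    unfolding fourier_def using f
    by (intro integral_dominated_convergence[where w = "\<lambda>x. cmod (f x)"])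
       (auto simp: norm_mult intro!: tendsto_intros AE_I2)
qed

lemma borel_measurable_fourier [measurable]:
  "integrable lborel f \<Longrightarrow> fourier f \<in> borel_measurable borel"
  by (intro borel_measurable_continuous_onI continuous_fourier)

lemma integrable_fourier_mult:
  assumes "integrable lborel f" "integrable lborel h"
  shows "integrable lborel (\<lambda>\<xi>. fourier f \<xi> * h \<xi>)"
  by (rule Bochner_Integration.integrable_bound[of _ "\<lambda>\<xi>. (\<integral>x. cmod (f x) \<partial>lborel) * h \<xi>"])
     (use assms borel_measurable_integrable[OF assms(2)] in
      \<open>auto simp: norm_mult intro!: mult_right_mono order.trans[OF norm_fourier_le]\<close>)

lemma fourier_multiplication_formula:
  fixes f :: "'a::euclidean_space \<Rightarrow> complex"
  assumes f: "integrable lborel f" and h: "integrable lborel h"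
  shows "(\<integral>\<xi>. fourier f \<xi> * h \<xi> \<partial>lborel) = (\<integral>x. f x * fourier h x \<partial>lborel)"
proof -
  have [measurable]: "f \<in> borel_measurable borel" "h \<in> borel_measurable borel"
    using f h borel_measurable_integrable by fastforce+
  let ?F = "\<lambda>\<xi> x. f x * cis (- (2 * pi * (x \<bullet> \<xi>))) * h \<xi>"
  have "(\<integral>\<xi>. fourier f \<xi> * h \<xi> \<partial>lborel) = (\<integral>\<xi>. \<integral>x. ?F \<xi> x \<partial>lborel \<partial>lborel)"
    by (simp add: fourier_def)
  also have "\<dots> = (\<integral>x. \<integral>\<xi>. ?F \<xi> x \<partial>lborel \<partial>lborel)"
  proof (rule lborel_pair.Fubini_integral[symmetric])
    have "integrable lborel (\<lambda>\<xi>. (\<integral>x. cmod (f x) \<partial>lborel) * cmod (h \<xi>))" using h by simp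
    then show "integrable (lborel \<Otimes>\<^sub>M lborel) (\<lambda>(\<xi>, x). ?F \<xi> x)"
      by (intro lborel_pair.Fubini_integrable) (use integrable_fourier[OF f] in \<open>auto simp: norm_mult\<close>)
  qed
  also have "\<dots> = (\<integral>x. f x * fourier h x \<partial>lborel)"
    by (simp add: fourier_def inner_commute mult_ac)
  finally show ?thesis .
qed

text \<open>The multiplication formula, applied once to \<open>f\<close> and once more to compute
  the transform of cnj (\<open>fourier g\<close>) times \<open>w\<close>. A weight on the frequency
  side becomes the convolution kernel \<open>fourier w (x - y)\<close> between \<open>f\<close> and
  \<open>g\<close>.\<close>

lemma integral_fourier_cnj_fourier_mult:
  fixes f g :: "'a::euclidean_space \<Rightarrow> complex"
  assumes f: "integrable lborel f" and g: "integrable lborel g" and w: "integrable lborel w"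
  shows "(\<integral>\<xi>. fourier f \<xi> * cnj (fourier g \<xi>) * w \<xi> \<partial>lborel)
       = (\<integral>x. f x * (\<integral>y. cnj (g y) * fourier w (x - y) \<partial>lborel) \<partial>lborel)"
proof -
  have wc: "integrable lborel (\<lambda>\<xi>. cnj (w \<xi>) * cis (2 * pi * (x \<bullet> \<xi>)))" for x
    using w by (intro integrable_mult_cis) auto
  have "integrable lborel (\<lambda>\<xi>. cnj (fourier g \<xi> * cnj (w \<xi>)))"
    using integrable_fourier_mult[OF g, of "\<lambda>\<xi>. cnj (w \<xi>)"] w by (simp del: complex_cnj_mult)
  then have "(\<integral>\<xi>. fourier f \<xi> * (cnj (fourier g \<xi>) * w \<xi>) \<partial>lborel)
      = (\<integral>x. f x * fourier (\<lambda>\<xi>. cnj (fourier g \<xi>) * w \<xi>) x \<partial>lborel)"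
    by (intro fourier_multiplication_formula f) simp
  moreover have "fourier (\<lambda>\<xi>. cnj (fourier g \<xi>) * w \<xi>) x = (\<integral>y. cnj (g y) * fourier w (x - y) \<partial>lborel)" for x
  proof -
    have fy: "cnj (fourier (\<lambda>\<xi>. cnj (w \<xi>) * cis (2 * pi * (x \<bullet> \<xi>))) y) = fourier w (x - y)" for y
    proof -
      have "cnj (fourier (\<lambda>\<xi>. cnj (w \<xi>) * cis (2 * pi * (x \<bullet> \<xi>))) y)
         = (\<integral>\<xi>. cnj (cnj (w \<xi>) * cis (2 * pi * (x \<bullet> \<xi>)) * cis (- (2 * pi * (\<xi> \<bullet> y)))) \<partial>lborel)"
        unfolding fourier_def by (rule Bochner_Integration.integral_cnj[symmetric])
      also have "\<dots> = fourier w (x - y)"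
        unfolding fourier_def
        by (intro Bochner_Integration.integral_cong refl)
           (simp add: cis_cnj cis_mult inner_diff inner_commute algebra_simps)
      finally show ?thesis .
    qed
    have "fourier (\<lambda>\<xi>. cnj (fourier g \<xi>) * w \<xi>) x
        = (\<integral>\<xi>. cnj (fourier g \<xi> * (cnj (w \<xi>) * cis (2 * pi * (x \<bullet> \<xi>)))) \<partial>lborel)"
      by (simp add: fourier_def cis_cnj inner_commute mult_ac)
    also have "\<dots> = cnj (\<integral>y. g y * fourier (\<lambda>\<xi>. cnj (w \<xi>) * cis (2 * pi * (x \<bullet> \<xi>))) y \<partial>lborel)"
      unfolding fourier_multiplication_formula[OF g wc, symmetric] by (rule Bochner_Integration.integral_cnj)
    also have "\<dots> = (\<integral>y. cnj (g y) * cnj (fourier (\<lambda>\<xi>. cnj (w \<xi>) * cis (2 * pi * (x \<bullet> \<xi>))) y) \<partial>lborel)"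
      by (subst Bochner_Integration.integral_cnj[symmetric]) simp
    also have "\<dots> = (\<integral>y. cnj (g y) * fourier w (x - y) \<partial>lborel)" by (simp only: fy)
    finally show ?thesis .
  qed
  ultimately show ?thesis by (simp add: mult.assoc)
qed

lemma integrable_gaussian_euclidean:
  "a > 0 \<Longrightarrow> integrable lborel (\<lambda>x::'a::euclidean_space. exp (- a * (norm x)\<^sup>2))"
  "a > 0 \<Longrightarrow> (\<integral>x. exp (- a * (norm x)\<^sup>2) \<partial>(lborel::'a measure)) = sqrt (pi / a) ^ DIM('a)"
proof -
  assume "a > 0"
  from has_bochner_integral_Re[OF gaussian_fourier_euclidean[OF this, of "0::'a"]]
  have "has_bochner_integral lborel (\<lambda>x::'a. exp (- a * (norm x)\<^sup>2)) (sqrt (pi / a) ^ DIM('a))"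
    by (simp del: of_real_exp of_real_mult of_real_power add: scaleR_conv_of_real)
  then show "integrable lborel (\<lambda>x::'a::euclidean_space. exp (- a * (norm x)\<^sup>2))"
     "(\<integral>x. exp (- a * (norm x)\<^sup>2) \<partial>(lborel::'a measure)) = sqrt (pi / a) ^ DIM('a)"
    by (auto simp: has_bochner_integral_iff)
qed

text \<open>On the space side the integral is a sesquilinear form in \<open>f\<close> with kernel
  \<open>fourier w (x - y)\<close>. The sup bound for that kernel leaves nothing but the square of
  the L1 norm of \<open>f\<close>.\<close>

lemma norm_fresnel_transform_le:
  fixes f :: "'a::euclidean_space \<Rightarrow> complex"
  assumes f: "integrable lborel f" and a: "a > 0" and l: "l \<noteq> 0"
  shows "cmod (\<integral>\<xi>. (cmod (fourier f \<xi>))\<^sup>2 * (exp (- a * (norm \<xi>)\<^sup>2) *\<^sub>R cis (l * (norm \<xi>)\<^sup>2)) \<partial>lborel)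
    \<le> sqrt (pi / \<bar>l\<bar>) ^ DIM('a) * (\<integral>x. cmod (f x) \<partial>lborel)\<^sup>2"
proof -
  define w where "w \<xi> = exp (- a * (norm \<xi>)\<^sup>2) *\<^sub>R cis (l * (norm \<xi>)\<^sup>2)" for \<xi> :: 'a
  define c where "c = sqrt (pi / \<bar>l\<bar>) ^ DIM('a)"
  have c0: "c \<ge> 0" by (simp add: c_def)
  have w: "integrable lborel w"
    by (rule Bochner_Integration.integrable_bound[OF integrable_gaussian_euclidean(1)[OF a]]) (auto simp: w_def[abs_def])
  have fw: "cmod (fourier w u) \<le> c" for u
  proof -
    have "fourier w u = (\<integral>x. exp (- a * (norm x)\<^sup>2) *\<^sub>R cis (l * (norm x)\<^sup>2 + (- 2 * pi) *\<^sub>R u \<bullet> x) \<partial>lborel)"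
      unfolding fourier_def w_def by (simp add: cis_mult inner_commute)
    then show ?thesis using norm_fresnel_integral_euclidean_le[OF a l, of "(- 2 * pi) *\<^sub>R u"] by (simp add: c_def)
  qed
  have "(\<integral>\<xi>. (cmod (fourier f \<xi>))\<^sup>2 * w \<xi> \<partial>lborel) = (\<integral>\<xi>. fourier f \<xi> * cnj (fourier f \<xi>) * w \<xi> \<partial>lborel)"
    by (simp flip: complex_norm_square)
  also have "\<dots> = (\<integral>x. f x * (\<integral>y. cnj (f y) * fourier w (x - y) \<partial>lborel) \<partial>lborel)"
    by (rule integral_fourier_cnj_fourier_mult[OF f f w])
  also have "cmod \<dots> \<le> (\<integral>x. cmod (f x) * (c * (\<integral>y. cmod (f y) \<partial>lborel)) \<partial>lborel)"
  proof (rule Bochner_Integration.integral_norm_bound_integral)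
    have [measurable]: "f \<in> borel_measurable borel" "fourier w \<in> borel_measurable borel"
      using f w borel_measurable_fourier borel_measurable_integrable by fastforce+
    have inner: "cmod (\<integral>y. cnj (f y) * fourier w (x - y) \<partial>lborel) \<le> c * (\<integral>y. cmod (f y) \<partial>lborel)" for x
    proof -
      have le: "cmod (cnj (f y) * fourier w (x - y)) \<le> c * cmod (f y)" for y
        using mult_right_mono[OF fw norm_ge_zero] by (simp add: norm_mult mult.commute)
      have "integrable lborel (\<lambda>y. c * cmod (f y))" using f by simp
      moreover from this have "integrable lborel (\<lambda>y. cnj (f y) * fourier w (x - y))"
        by (rule Bochner_Integration.integrable_bound) (use le c0 in \<open>auto intro!: AE_I2\<close>)
      ultimately have "cmod (\<integral>y. cnj (f y) * fourier w (x - y) \<partial>lborel) \<le> (\<integral>y. c * cmod (f y) \<partial>lborel)"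
        using le by (intro Bochner_Integration.integral_norm_bound_integral)
      then show ?thesis by simp
    qed
    show "cmod (f x * (\<integral>y. cnj (f y) * fourier w (x - y) \<partial>lborel)) \<le> cmod (f x) * (c * (\<integral>y. cmod (f y) \<partial>lborel))" for x
      unfolding norm_mult by (intro mult_left_mono inner) auto
    show "integrable lborel (\<lambda>x. f x * (\<integral>y. cnj (f y) * fourier w (x - y) \<partial>lborel))"
      by (rule Bochner_Integration.integrable_bound[of _ "\<lambda>x. (c * (\<integral>y. cmod (f y) \<partial>lborel)) * f x"])
         (use f inner c0 in \<open>auto simp: norm_mult abs_mult mult.commute intro!: mult_left_mono AE_I2\<close>)
  qed (use f in simp)
  finally show ?thesis by (simp add: w_def c_def power2_eq_square mult_ac)
qed

section \<open>The heat kernel, and square integrability by duality\<close>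

lemma lborel_integral_affine:
  fixes h :: "'a::euclidean_space \<Rightarrow> 'b::{banach, second_countable_topology}"
  assumes [measurable]: "h \<in> borel_measurable borel" and c: "c \<noteq> 0"
  shows "(\<integral>x. h x \<partial>lborel) = \<bar>c\<bar> ^ DIM('a) *\<^sub>R (\<integral>x. h (t + c *\<^sub>R x) \<partial>lborel)"
proof -
  have "(\<integral>x. h x \<partial>lborel) = (\<integral>x. h x \<partial>density (distr lborel borel (\<lambda>x. t + c *\<^sub>R x)) (\<lambda>_. \<bar>c\<bar> ^ DIM('a)))"
    by (subst lborel_affine[OF c, of t]) simp
  also have "\<dots> = \<bar>c\<bar> ^ DIM('a) *\<^sub>R (\<integral>x. h (t + c *\<^sub>R x) \<partial>lborel)"
    by (subst integral_density) (auto simp: integral_distr)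
  finally show ?thesis .
qed

text \<open>The Fourier transform of exp (- a |xi|^2). It is the heat kernel at time a / (4 pi^2): a
  probability density that concentrates at 0 as a tends to 0.\<close>

definition heat :: "real \<Rightarrow> 'a::euclidean_space \<Rightarrow> real" where
  "heat a u = sqrt (pi / a) ^ DIM('a) * exp (- pi\<^sup>2 / a * (norm u)\<^sup>2)"

lemma heat_nonneg: "a > 0 \<Longrightarrow> heat a u \<ge> 0"
  by (simp add: heat_def)

lemma borel_measurable_heat [measurable]: "heat a \<in> borel_measurable borel"
  unfolding heat_def[abs_def] by measurable

lemma heat_integral:
  assumes a: "a > 0"
  shows "integrable lborel (heat a :: 'a::euclidean_space \<Rightarrow> real)" "(\<integral>u. heat a (u::'a) \<partial>lborel) = 1"
proof -
  have p: "pi\<^sup>2 / a > 0" using a by simp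
  show "integrable lborel (heat a :: 'a::euclidean_space \<Rightarrow> real)"
    unfolding heat_def[abs_def] using integrable_gaussian_euclidean(1)[OF p] by (intro integrable_mult_right) simp
  have "sqrt (pi / a) * sqrt (pi / (pi\<^sup>2 / a)) = 1"
    using a by (simp add: power2_eq_square flip: real_sqrt_mult)
  then show "(\<integral>u. heat a (u::'a) \<partial>lborel) = 1"
    unfolding heat_def using integrable_gaussian_euclidean(2)[OF p, where 'a = 'a]
    by (simp flip: power_mult_distrib)
qed

lemma heat_diff_integral:
  fixes x :: "'a::euclidean_space"
  assumes a: "a > 0"
  shows "integrable lborel (\<lambda>y. heat a (x - y))" "(\<integral>y. heat a (x - y) \<partial>lborel) = 1"
proof -
  have eq: "heat a (x - y) = heat a (- x + 1 *\<^sub>R y)" for y by (simp add: heat_def norm_minus_commute)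
  have "(\<integral>y. heat a (x - y) \<partial>lborel) = 1"
    using heat_integral(2)[OF a, where 'a = 'a] lborel_integral_affine[of "heat a" 1 "- x"] by (simp add: eq)
  then show "(\<integral>y. heat a (x - y) \<partial>lborel) = 1" "integrable lborel (\<lambda>y. heat a (x - y))"
    using not_integrable_integral_eq by fastforce+
qed

lemma fourier_gaussian:
  assumes a: "a > 0"
  shows "fourier (\<lambda>\<xi>. complex_of_real (exp (- a * (norm \<xi>)\<^sup>2))) u = heat a (u :: 'a::euclidean_space)"
proof -
  have "fourier (\<lambda>\<xi>. complex_of_real (exp (- a * (norm \<xi>)\<^sup>2))) u
     = (\<integral>x. exp (- a * (norm x)\<^sup>2) *\<^sub>R cis ((- 2 * pi) *\<^sub>R u \<bullet> x) \<partial>lborel)"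
    unfolding fourier_def by (simp add: scaleR_conv_of_real inner_commute)
  also have "\<dots> = complex_of_real (sqrt (pi / a) ^ DIM('a) * exp (- (norm ((- 2 * pi) *\<^sub>R u))\<^sup>2 / (4 * a)))"
    by (rule has_bochner_integral_integral_eq[OF gaussian_fourier_euclidean[OF a]])
  also have "- (norm ((- 2 * pi) *\<^sub>R u))\<^sup>2 / (4 * a) = - pi\<^sup>2 / a * (norm u)\<^sup>2"
    using a by (simp add: power_mult_distrib)
  finally show ?thesis by (simp add: heat_def)
qed

lemma integral_fourier_gaussian:
  fixes f g :: "'a::euclidean_space \<Rightarrow> complex"
  assumes f: "integrable lborel f" and g: "integrable lborel g" and a: "a > 0"
  shows "(\<integral>\<xi>. fourier f \<xi> * cnj (fourier g \<xi>) * exp (- a * (norm \<xi>)\<^sup>2) \<partial>lborel)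
       = (\<integral>x. f x * (\<integral>y. cnj (g y) * heat a (x - y) \<partial>lborel) \<partial>lborel)"
proof -
  have "integrable lborel (\<lambda>\<xi>::'a. complex_of_real (exp (- a * (norm \<xi>)\<^sup>2)))"
    using integrable_gaussian_euclidean(1)[OF a] by (simp only: complex_of_real_integrable_eq)
  from integral_fourier_cnj_fourier_mult[OF f g this] show ?thesis
    by (simp only: fourier_gaussian[OF a])
qed

lemma integrable_norm_fourier_square_gaussian:
  fixes f :: "'a::euclidean_space \<Rightarrow> complex"
  assumes f: "integrable lborel f" and a: "a > 0"
  shows "integrable lborel (\<lambda>\<xi>. (cmod (fourier f \<xi>))\<^sup>2 * exp (- a * (norm \<xi>)\<^sup>2))"
  by (rule Bochner_Integration.integrable_bound[of _ "\<lambda>\<xi>. (\<integral>x. cmod (f x) \<partial>lborel)\<^sup>2 * exp (- a * (norm \<xi>)\<^sup>2)"])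
     (use integrable_gaussian_euclidean(1)[OF a] f in
      \<open>auto intro!: mult_right_mono power_mono norm_fourier_le AE_I2\<close>)

text \<open>One half of Plancherel, uniformly in \<open>a\<close>. On the space side the kernel is a
  probability density in either variable, so the inequality 2 |g(x) g(y)| <= |g(x)|^2 + |g(y)|^2
  integrates to the claim (Schur's test).\<close>

lemma integral_norm_fourier_square_gaussian_le:
  fixes g :: "'a::euclidean_space \<Rightarrow> complex"
  assumes g: "integrable lborel g" and g2: "integrable lborel (\<lambda>x. (cmod (g x))\<^sup>2)" and a: "a > 0"
  shows "(\<integral>\<xi>. (cmod (fourier g \<xi>))\<^sup>2 * exp (- a * (norm \<xi>)\<^sup>2) \<partial>lborel) \<le> (\<integral>x. (cmod (g x))\<^sup>2 \<partial>lborel)"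
proof -
  have [measurable]: "g \<in> borel_measurable borel" using g borel_measurable_integrable by fastforce
  let ?N = "\<integral>x. (cmod (g x))\<^sup>2 \<partial>lborel"
  have "ennreal (\<integral>\<xi>. (cmod (fourier g \<xi>))\<^sup>2 * exp (- a * (norm \<xi>)\<^sup>2) \<partial>lborel)
     = ennreal (cmod (complex_of_real (\<integral>\<xi>. (cmod (fourier g \<xi>))\<^sup>2 * exp (- a * (norm \<xi>)\<^sup>2) \<partial>lborel)))"
    by (simp add: integral_nonneg_AE)
  also have "complex_of_real (\<integral>\<xi>. (cmod (fourier g \<xi>))\<^sup>2 * exp (- a * (norm \<xi>)\<^sup>2) \<partial>lborel)
      = (\<integral>\<xi>. fourier g \<xi> * cnj (fourier g \<xi>) * exp (- a * (norm \<xi>)\<^sup>2) \<partial>lborel)"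
    unfolding integral_complex_of_real[symmetric] by (simp flip: complex_norm_square)
  also have "\<dots> = (\<integral>x. g x * (\<integral>y. cnj (g y) * heat a (x - y) \<partial>lborel) \<partial>lborel)"
    by (rule integral_fourier_gaussian[OF g g a])
  \<comment> \<open>Without integrability the Bochner integral is 0 by convention and the bound is
    trivial; likewise for the inner integral below.\<close>
  also have "ennreal (cmod \<dots>) \<le> (\<integral>\<^sup>+x. ennreal (cmod (g x * (\<integral>y. cnj (g y) * heat a (x - y) \<partial>lborel))) \<partial>lborel)"
    by (cases "integrable lborel (\<lambda>x. g x * (\<integral>y. cnj (g y) * heat a (x - y) \<partial>lborel))")
       (auto simp: not_integrable_integral_eq intro: integral_norm_bound_ennreal)
  also have "\<dots> \<le> (\<integral>\<^sup>+x. \<integral>\<^sup>+y. ennreal (cmod (g x) * cmod (g y) * heat a (x - y)) \<partial>lborel \<partial>lborel)"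
  proof (rule nn_integral_mono)
    fix x
    have "ennreal (cmod (\<integral>y. cnj (g y) * heat a (x - y) \<partial>lborel)) \<le> (\<integral>\<^sup>+y. ennreal (cmod (cnj (g y) * heat a (x - y))) \<partial>lborel)"
      by (cases "integrable lborel (\<lambda>y. cnj (g y) * heat a (x - y))")
         (auto simp: not_integrable_integral_eq intro: integral_norm_bound_ennreal)
    then have "ennreal (cmod (g x)) * ennreal (cmod (\<integral>y. cnj (g y) * heat a (x - y) \<partial>lborel))
        \<le> ennreal (cmod (g x)) * (\<integral>\<^sup>+y. ennreal (cmod (g y) * heat a (x - y)) \<partial>lborel)"
      by (intro mult_left_mono) (auto simp: norm_mult heat_nonneg[OF a])
    also have "\<dots> = (\<integral>\<^sup>+y. ennreal (cmod (g x) * cmod (g y) * heat a (x - y)) \<partial>lborel)"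
      by (subst nn_integral_cmult[symmetric]) (auto simp: ennreal_mult' mult.assoc heat_nonneg[OF a])
    finally show "ennreal (cmod (g x * (\<integral>y. cnj (g y) * heat a (x - y) \<partial>lborel)))
       \<le> (\<integral>\<^sup>+y. ennreal (cmod (g x) * cmod (g y) * heat a (x - y)) \<partial>lborel)"
      by (simp add: norm_mult ennreal_mult)
  qed
  also have "\<dots> \<le> (\<integral>\<^sup>+x. \<integral>\<^sup>+y. ennreal ((cmod (g x))\<^sup>2 / 2) * ennreal (heat a (x - y)) + ennreal ((cmod (g y))\<^sup>2 / 2) * ennreal (heat a (x - y)) \<partial>lborel \<partial>lborel)"
  proof (intro nn_integral_mono)
    fix x y
    have "cmod (g x) * cmod (g y) \<le> (cmod (g x))\<^sup>2 / 2 + (cmod (g y))\<^sup>2 / 2"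
      using sum_squares_bound[of "cmod (g x)" "cmod (g y)"] by (simp add: field_simps)
    then have "cmod (g x) * cmod (g y) * heat a (x - y) \<le> ((cmod (g x))\<^sup>2 / 2 + (cmod (g y))\<^sup>2 / 2) * heat a (x - y)"
      using heat_nonneg[OF a] by (rule mult_right_mono)
    then show "ennreal (cmod (g x) * cmod (g y) * heat a (x - y))
       \<le> ennreal ((cmod (g x))\<^sup>2 / 2) * ennreal (heat a (x - y)) + ennreal ((cmod (g y))\<^sup>2 / 2) * ennreal (heat a (x - y))"
      by (simp add: ennreal_mult'[symmetric] ennreal_plus[symmetric] heat_nonneg[OF a] distrib_right ennreal_leI del: ennreal_plus)
  qed
  also have "\<dots> = (\<integral>\<^sup>+x. \<integral>\<^sup>+y. ennreal ((cmod (g x))\<^sup>2 / 2) * ennreal (heat a (x - y)) \<partial>lborel \<partial>lborel)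
      + (\<integral>\<^sup>+x. \<integral>\<^sup>+y. ennreal ((cmod (g y))\<^sup>2 / 2) * ennreal (heat a (x - y)) \<partial>lborel \<partial>lborel)"
    by (simp add: nn_integral_add)
  also have "(\<integral>\<^sup>+x. \<integral>\<^sup>+y. ennreal ((cmod (g y))\<^sup>2 / 2) * ennreal (heat a (x - y)) \<partial>lborel \<partial>lborel)
      = (\<integral>\<^sup>+y. \<integral>\<^sup>+x. ennreal ((cmod (g y))\<^sup>2 / 2) * ennreal (heat a (y - x)) \<partial>lborel \<partial>lborel)"
    by (subst lborel_pair.Fubini'[symmetric]) (auto simp: heat_def norm_minus_commute)
  also have "(\<integral>\<^sup>+x. \<integral>\<^sup>+y. ennreal ((cmod (g x))\<^sup>2 / 2) * ennreal (heat a (x - y)) \<partial>lborel \<partial>lborel) = ennreal (?N / 2)"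
  proof -
    have "(\<integral>\<^sup>+y. ennreal (heat a (x - y)) \<partial>lborel) = 1" for x :: 'a
      using heat_diff_integral[OF a, of x] heat_nonneg[OF a] by (subst nn_integral_eq_integral) auto
    then have "(\<integral>\<^sup>+x. \<integral>\<^sup>+y. ennreal ((cmod (g x))\<^sup>2 / 2) * ennreal (heat a (x - y)) \<partial>lborel \<partial>lborel)
        = (\<integral>\<^sup>+x. ennreal ((cmod (g x))\<^sup>2 / 2) \<partial>lborel)"
      by (simp add: nn_integral_cmult)
    also have "\<dots> = ennreal (\<integral>x. (cmod (g x))\<^sup>2 / 2 \<partial>lborel)"
      using g2 by (intro nn_integral_eq_integral) auto
    finally show ?thesis by simp
  qed
  also have "ennreal (?N / 2) + ennreal (?N / 2) = ennreal ?N"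
    by (subst ennreal_plus[symmetric]) (auto simp: integral_nonneg_AE)
  finally show ?thesis by (subst (asm) ennreal_le_iff) (auto simp: integral_nonneg_AE)
qed

text \<open>The parameter is the square of 1 / (n + 1) because the kernel has width of order sqrt a:
  the substitution y = x + v / (n + 1) turns it into the fixed density \<open>heat 1\<close>, and
  dominated convergence applies.\<close>

lemma tendsto_heat_convolution:
  fixes g :: "'a::euclidean_space \<Rightarrow> complex"
  assumes g: "continuous_on UNIV g" and M: "\<And>x. cmod (g x) \<le> M"
  shows "(\<lambda>n. \<integral>y. g y * heat (1 / (real (Suc n))\<^sup>2) (x - y) \<partial>lborel) \<longlonglongrightarrow> g x"
    and "a > 0 \<Longrightarrow> cmod (\<integral>y. g y * heat a (x - y) \<partial>lborel) \<le> M"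
proof -
  have [measurable]: "g \<in> borel_measurable borel" using g by (rule borel_measurable_continuous_onI)
  have "(\<integral>y. g y * heat (1 / (real (Suc n))\<^sup>2) (x - y) \<partial>lborel) = (\<integral>v. g (x + (1 / real (Suc n)) *\<^sub>R v) * heat 1 v \<partial>lborel)" for n
  proof -
    define c where "c = 1 / real (Suc n)"
    have c: "c > 0" "1 / (real (Suc n))\<^sup>2 = c\<^sup>2" by (auto simp: c_def power_divide)
    have "heat (c\<^sup>2) (c *\<^sub>R v) = heat 1 v / c ^ DIM('a)" for v :: 'a
      using c by (simp add: heat_def real_sqrt_divide power_divide power_mult_distrib)
    then have h: "complex_of_real (heat (c\<^sup>2) (- (c *\<^sub>R v))) = heat 1 v / c ^ DIM('a)" for v :: 'a
      by (simp add: heat_def)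
    show ?thesis
      using c unfolding c(2) c_def[symmetric]
      by (subst lborel_integral_affine[of _ c x]) (simp_all add: h scaleR_conv_of_real)
  qed
  moreover have "(\<lambda>n. \<integral>v. g (x + (1 / real (Suc n)) *\<^sub>R v) * heat 1 v \<partial>lborel) \<longlonglongrightarrow> (\<integral>v. g x * heat 1 (v::'a) \<partial>lborel)"
  proof (rule integral_dominated_convergence[where w = "\<lambda>v::'a. M * heat 1 v"])
    show "integrable lborel (\<lambda>v::'a. M * heat 1 v)" using heat_integral(1)[of 1, where 'a = 'a] by simp
    show "AE v in lborel. (\<lambda>n. g (x + (1 / real (Suc n)) *\<^sub>R v) * complex_of_real (heat 1 v)) \<longlonglongrightarrow> g x * heat 1 v"
    proof (intro AE_I2 tendsto_mult tendsto_const)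
      fix v :: 'a
      have "(\<lambda>n. x + (1 / real (Suc n)) *\<^sub>R v) \<longlonglongrightarrow> x + 0 *\<^sub>R v"
        by (intro tendsto_intros LIMSEQ_Suc lim_1_over_n)
      then show "(\<lambda>n. g (x + (1 / real (Suc n)) *\<^sub>R v)) \<longlonglongrightarrow> g x"
        using g by (intro isCont_tendsto_compose[of _ g]) (auto simp: continuous_on_eq_continuous_at)
    qed
    show "AE v in lborel. norm (g (x + (1 / real (Suc n)) *\<^sub>R v) * complex_of_real (heat 1 v)) \<le> M * heat 1 v" for n
      by (auto simp: norm_mult heat_nonneg M intro!: AE_I2 mult_right_mono)
  qed auto
  moreover have "(\<integral>v. heat 1 (v::'a) \<partial>lborel) = 1"
    by (simp add: heat_integral(2))
  ultimately show "(\<lambda>n. \<integral>y. g y * heat (1 / (real (Suc n))\<^sup>2) (x - y) \<partial>lborel) \<longlonglongrightarrow> g x" by simp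
  show "cmod (\<integral>y. g y * heat a (x - y) \<partial>lborel) \<le> M" if a: "a > 0"
  proof -
    have "cmod (\<integral>y. g y * heat a (x - y) \<partial>lborel) \<le> (\<integral>y. M * heat a (x - y) \<partial>lborel)"
    proof (rule Bochner_Integration.integral_norm_bound_integral)
      show "integrable lborel (\<lambda>y. M * heat a (x - y))" using heat_diff_integral(1)[OF a, of x] by simp
      then show "integrable lborel (\<lambda>y. g y * heat a (x - y))"
        by (rule Bochner_Integration.integrable_bound)
           (auto simp: norm_mult abs_mult heat_nonneg[OF a] M intro!: AE_I2 mult_right_mono order.trans[OF M])
    qed (auto simp: norm_mult heat_nonneg[OF a] M intro!: mult_right_mono)
    then show ?thesis using heat_diff_integral(2)[OF a, of x] by simp
  qed
qed

text \<open>For each a the pairing of \<open>f\<close> with the heat-smoothed \<open>g\<close>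
  equals a weighted pairing of transforms, bounded by \<open>B\<close> for \<open>f\<close> and by
  half Plancherel for \<open>g\<close>. Letting a tend to 0 removes the smoothing. The additive form
  2 |uv| <= |u|^2 + |v|^2 is kept in place of Cauchy-Schwarz because it is exactly what is used when
  \<open>g\<close> is a truncation of \<open>f\<close>.\<close>

lemma integral_mult_cnj_le_continuous:
  fixes f g :: "'a::euclidean_space \<Rightarrow> complex"
  assumes f: "integrable lborel f"
    and B: "\<And>a. a > 0 \<Longrightarrow> (\<integral>\<xi>. (cmod (fourier f \<xi>))\<^sup>2 * exp (- a * (norm \<xi>)\<^sup>2) \<partial>lborel) \<le> B"
    and g: "integrable lborel g" "integrable lborel (\<lambda>x. (cmod (g x))\<^sup>2)"
    and gc: "continuous_on UNIV g" and gM: "\<And>x. cmod (g x) \<le> M"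
  shows "2 * cmod (\<integral>x. f x * cnj (g x) \<partial>lborel) \<le> B + (\<integral>x. (cmod (g x))\<^sup>2 \<partial>lborel)"
proof -
  have [measurable]: "f \<in> borel_measurable borel" "g \<in> borel_measurable borel"
    using f g borel_measurable_integrable by fastforce+
  have bound: "2 * cmod (\<integral>x. f x * (\<integral>y. cnj (g y) * heat a (x - y) \<partial>lborel) \<partial>lborel) \<le> B + (\<integral>x. (cmod (g x))\<^sup>2 \<partial>lborel)"
    if a: "a > 0" for a
  proof -
    let ?w = "\<lambda>\<xi>::'a. exp (- a * (norm \<xi>)\<^sup>2)"
    let ?F = "\<lambda>\<xi>. (cmod (fourier f \<xi>))\<^sup>2 * ?w \<xi>" and ?G = "\<lambda>\<xi>. (cmod (fourier g \<xi>))\<^sup>2 * ?w \<xi>"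
    have int: "integrable lborel ?F" "integrable lborel ?G"
      using integrable_norm_fourier_square_gaussian[OF f a] integrable_norm_fourier_square_gaussian[OF g(1) a] .
    have le: "cmod (fourier f \<xi> * cnj (fourier g \<xi>) * ?w \<xi>) \<le> (?F \<xi> + ?G \<xi>) / 2" for \<xi>
    proof -
      have "cmod (fourier f \<xi>) * cmod (fourier g \<xi>) \<le> ((cmod (fourier f \<xi>))\<^sup>2 + (cmod (fourier g \<xi>))\<^sup>2) / 2"
        using sum_squares_bound[of "cmod (fourier f \<xi>)" "cmod (fourier g \<xi>)"] by simp
      from mult_right_mono[OF this, of "?w \<xi>"] show ?thesis by (simp add: norm_mult distrib_right)
    qed
    have "cmod (\<integral>\<xi>. fourier f \<xi> * cnj (fourier g \<xi>) * ?w \<xi> \<partial>lborel) \<le> (\<integral>\<xi>. (?F \<xi> + ?G \<xi>) / 2 \<partial>lborel)"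
    proof (rule Bochner_Integration.integral_norm_bound_integral)
      show int2: "integrable lborel (\<lambda>\<xi>. (?F \<xi> + ?G \<xi>) / 2)" using int by simp
      show "integrable lborel (\<lambda>\<xi>. fourier f \<xi> * cnj (fourier g \<xi>) * ?w \<xi>)"
        by (rule Bochner_Integration.integrable_bound[OF int2]) (use f g le in \<open>auto intro!: AE_I2 order.trans[OF le]\<close>)
    qed (rule le)
    also have "\<dots> = ((\<integral>\<xi>. ?F \<xi> \<partial>lborel) + (\<integral>\<xi>. ?G \<xi> \<partial>lborel)) / 2" using int by simp
    also have "\<dots> \<le> (B + (\<integral>x. (cmod (g x))\<^sup>2 \<partial>lborel)) / 2"
      using B[OF a] integral_norm_fourier_square_gaussian_le[OF g a] by simp
    finally show ?thesis unfolding integral_fourier_gaussian[OF f g(1) a] by simp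
  qed
  have cnj: "continuous_on UNIV (\<lambda>y. cnj (g y))" "\<And>x. cmod (cnj (g x)) \<le> M"
    using gc gM by (auto intro: continuous_intros)
  have "(\<lambda>n. \<integral>x. f x * (\<integral>y. cnj (g y) * heat (1 / (real (Suc n))\<^sup>2) (x - y) \<partial>lborel) \<partial>lborel) \<longlonglongrightarrow> (\<integral>x. f x * cnj (g x) \<partial>lborel)"
  proof (rule integral_dominated_convergence[where w = "\<lambda>x. cmod (f x) * M"])
    show "AE x in lborel. (\<lambda>n. f x * (\<integral>y. cnj (g y) * heat (1 / (real (Suc n))\<^sup>2) (x - y) \<partial>lborel)) \<longlonglongrightarrow> f x * cnj (g x)"
      by (intro AE_I2 tendsto_mult tendsto_const tendsto_heat_convolution(1)[OF cnj])
    show "AE x in lborel. norm (f x * (\<integral>y. cnj (g y) * heat (1 / (real (Suc n))\<^sup>2) (x - y) \<partial>lborel)) \<le> cmod (f x) * M" for n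
      unfolding norm_mult by (intro AE_I2 mult_left_mono tendsto_heat_convolution(2)[OF cnj]) auto
  qed (use f in auto)
  then have "(\<lambda>n. 2 * cmod (\<integral>x. f x * (\<integral>y. cnj (g y) * heat (1 / (real (Suc n))\<^sup>2) (x - y) \<partial>lborel) \<partial>lborel))
      \<longlonglongrightarrow> 2 * cmod (\<integral>x. f x * cnj (g x) \<partial>lborel)"
    by (intro tendsto_intros)
  then show ?thesis by (rule LIMSEQ_le_const2) (auto intro!: exI bound simp del: of_nat_Suc)
qed

text \<open>Luzin approximation of \<open>g\<close> by clamped continuous functions with a fixed compact support.\<close>

lemma integral_mult_cnj_le_bounded:
  fixes f g :: "'a::euclidean_space \<Rightarrow> complex"
  assumes f: "integrable lborel f"
    and B: "\<And>a. a > 0 \<Longrightarrow> (\<integral>\<xi>. (cmod (fourier f \<xi>))\<^sup>2 * exp (- a * (norm \<xi>)\<^sup>2) \<partial>lborel) \<le> B"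
    and g [measurable]: "g \<in> borel_measurable borel"
    and M: "M > 0" and gM: "\<And>x. cmod (g x) \<le> M" and supp: "\<And>x. norm x > M \<Longrightarrow> g x = 0"
  shows "2 * cmod (\<integral>x. f x * cnj (g x) \<partial>lborel) \<le> B + (\<integral>x. (cmod (g x))\<^sup>2 \<partial>lborel)"
proof -
  have fm [measurable]: "f \<in> borel_measurable borel" using f borel_measurable_integrable by fastforce
  have "g measurable_on UNIV" by (intro lebesgue_measurable_imp_measurable_on measurable_completion) auto
  then obtain N h where N: "negligible N" and hc: "\<And>n. continuous_on UNIV (h n)"
    and hg: "\<And>x. x \<notin> N \<Longrightarrow> (\<lambda>n. h n x) \<longlonglongrightarrow> g x"
    unfolding measurable_on_def by auto
  have "AE x in lebesgue. x \<notin> N" using N by (intro AE_not_in) (simp add: negligible_iff_null_sets)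
  then have AE_N: "AE x in lborel. x \<notin> N" by (simp add: AE_completion_iff)
  \<comment> \<open>\<open>cl\<close> retracts the plane radially onto the disc of radius
    \<open>M\<close>, and \<open>\<phi>\<close> cuts off continuously between radius
    \<open>M\<close> and \<open>M + 1\<close>. Both leave \<open>g\<close> unchanged, so convergence
    survives while the approximants gain a common bound and support.\<close>
  define cl where "cl z = complex_of_real (M / max M (cmod z)) * z" for z
  define \<phi> where "\<phi> x = max 0 (min 1 (M + 1 - norm x))" for x :: 'a
  define k where "k n x = cl (h n x) * complex_of_real (\<phi> x)" for n x
  have clc: "continuous_on UNIV cl" unfolding cl_def[abs_def] using M by (intro continuous_intros) auto
  have cl_le: "cmod (cl z) \<le> M" for z
  proof -
    have "cmod (cl z) = M / max M (cmod z) * cmod z" using M by (simp add: cl_def norm_mult norm_divide)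
    then show ?thesis using M by (auto simp: max_def field_simps)
  qed
  have cl_id: "cl z = z" if "cmod z \<le> M" for z using that M by (simp add: cl_def max_def)
  have chi: "0 \<le> \<phi> x" "\<phi> x \<le> 1" "norm x \<le> M \<Longrightarrow> \<phi> x = 1" "x \<notin> cball 0 (M + 1) \<Longrightarrow> \<phi> x = 0" for x
    by (auto simp: \<phi>_def max_def min_def)
  have kc: "continuous_on UNIV (k n)" for n
    unfolding k_def[abs_def] \<phi>_def by (intro continuous_intros continuous_on_compose2[OF clc hc]) auto
  have [measurable]: "k n \<in> borel_measurable borel" for n using kc by (rule borel_measurable_continuous_onI)
  have k_le: "cmod (k n x) \<le> M * indicator (cball 0 (M + 1)) x" for n x
  proof (cases "x \<in> cball 0 (M + 1)")
    case True
    have "cmod (cl (h n x)) * \<phi> x \<le> M * 1" using M chi cl_le by (intro mult_mono) auto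
    then show ?thesis using True chi by (simp add: k_def norm_mult)
  qed (auto simp: k_def chi)
  have ind: "integrable lborel (\<lambda>x::'a. c * indicator (cball 0 (M + 1)) x :: real)" for c
    by (intro integrable_mult_right integrable_real_indicator emeasure_lborel_cball_finite) auto
  have lim: "AE x in lborel. (\<lambda>n. k n x) \<longlonglongrightarrow> g x"
    using AE_N
  proof eventually_elim
    case (elim x)
    have "(\<lambda>n. k n x) \<longlonglongrightarrow> cl (g x) * complex_of_real (\<phi> x)"
      unfolding k_def using hg[OF elim] clc
      by (intro tendsto_mult tendsto_const isCont_tendsto_compose[of _ cl]) (auto simp: continuous_on_eq_continuous_at)
    moreover have "cl (g x) * complex_of_real (\<phi> x) = g x"
      unfolding cl_id[OF gM] using chi(3)[of x] supp[of x] by (cases "norm x \<le> M") auto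
    ultimately show ?case by simp
  qed
  have kM: "cmod (k n x) \<le> M" for n x using k_le[of n x] M by (cases "x \<in> cball 0 (M + 1)") auto
  have k2: "(cmod (k n x))\<^sup>2 \<le> M\<^sup>2 * indicator (cball 0 (M + 1)) x" for n x
    using power_mono[OF k_le[of n x], of 2] by (cases "x \<in> cball 0 (M + 1)") auto
  have int1: "integrable lborel (k n)" for n
    by (rule Bochner_Integration.integrable_bound[OF ind[of M]]) (use k_le in \<open>auto intro!: AE_I2 order.trans[OF k_le]\<close>)
  have int2: "integrable lborel (\<lambda>x. (cmod (k n x))\<^sup>2)" for n
    by (rule Bochner_Integration.integrable_bound[OF ind[of "M\<^sup>2"]]) (use k2 in \<open>auto intro!: AE_I2 order.trans[OF k2]\<close>)
  have "(\<lambda>n. \<integral>x. f x * cnj (k n x) \<partial>lborel) \<longlonglongrightarrow> (\<integral>x. f x * cnj (g x) \<partial>lborel)"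
  proof (rule integral_dominated_convergence[where w = "\<lambda>x. cmod (f x) * M"])
    show "AE x in lborel. (\<lambda>n. f x * cnj (k n x)) \<longlonglongrightarrow> f x * cnj (g x)"
      using lim by eventually_elim (intro tendsto_intros)
    show "AE x in lborel. norm (f x * cnj (k n x)) \<le> cmod (f x) * M" for n
      by (auto simp: norm_mult intro!: AE_I2 mult_left_mono kM)
  qed (use f in auto)
  moreover have "(\<lambda>n. \<integral>x. (cmod (k n x))\<^sup>2 \<partial>lborel) \<longlonglongrightarrow> (\<integral>x. (cmod (g x))\<^sup>2 \<partial>lborel)"
  proof (rule integral_dominated_convergence[OF _ _ ind[of "M\<^sup>2"]])
    show "AE x in lborel. (\<lambda>n. (cmod (k n x))\<^sup>2) \<longlonglongrightarrow> (cmod (g x))\<^sup>2"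
      using lim by eventually_elim (intro tendsto_intros)
    show "AE x in lborel. norm ((cmod (k n x))\<^sup>2) \<le> M\<^sup>2 * indicator (cball 0 (M + 1)) x" for n
      using k2 by (auto intro!: AE_I2)
  qed auto
  ultimately show ?thesis
    using integral_mult_cnj_le_continuous[OF f B int1 int2 kc kM]
    by (intro LIMSEQ_le[OF tendsto_mult[OF tendsto_const tendsto_norm] tendsto_add[OF tendsto_const]]) auto
qed

text \<open>Test \<open>f\<close> against its truncation g: the pairing is the squared norm of g, so
  2 |g|^2 <= B + |g|^2 in norms, that is |g|^2 <= B. Fatou then removes the truncation.\<close>

lemma square_integrable_of_fourier:
  fixes f :: "'a::euclidean_space \<Rightarrow> complex"
  assumes f: "integrable lborel f"
    and B: "\<And>a. a > 0 \<Longrightarrow> (\<integral>\<xi>. (cmod (fourier f \<xi>))\<^sup>2 * exp (- a * (norm \<xi>)\<^sup>2) \<partial>lborel) \<le> B"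
  shows "integrable lborel (\<lambda>x. (cmod (f x))\<^sup>2)" "(\<integral>x. (cmod (f x))\<^sup>2 \<partial>lborel) \<le> B"
proof -
  have [measurable]: "f \<in> borel_measurable borel" using f borel_measurable_integrable by fastforce
  have "0 \<le> (\<integral>\<xi>. (cmod (fourier f \<xi>))\<^sup>2 * exp (- 1 * (norm \<xi>)\<^sup>2) \<partial>lborel)" by (intro integral_nonneg_AE) auto
  then have B0: "B \<ge> 0" by (rule order.trans) (rule B, simp)
  \<comment> \<open>Truncating both the value and the position makes \<open>g\<close> bounded with
    bounded support, as the duality inequality requires.\<close>
  define A where "A n = {x. cmod (f x) \<le> real (Suc n) \<and> norm x \<le> real (Suc n)}" for n
  have A [measurable]: "A n \<in> sets borel" for n unfolding A_def by measurable
  have le: "(\<integral>\<^sup>+x. ennreal ((cmod (f x))\<^sup>2) * indicator (A n) x \<partial>lborel) \<le> ennreal B" for n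
  proof -
    define g where "g x = f x * complex_of_real (indicator (A n) x)" for x
    have gm [measurable]: "g \<in> borel_measurable borel" unfolding g_def[abs_def] by measurable
    have "2 * cmod (\<integral>x. f x * cnj (g x) \<partial>lborel) \<le> B + (\<integral>x. (cmod (g x))\<^sup>2 \<partial>lborel)"
      by (rule integral_mult_cnj_le_bounded[OF f B, of _ "real (Suc n)"])
         (auto simp: g_def A_def indicator_def simp del: of_nat_Suc)
    moreover have "f x * cnj (g x) = complex_of_real ((cmod (g x))\<^sup>2)" for x
      unfolding complex_norm_square by (auto simp: g_def indicator_def)
    ultimately have "\<bar>\<integral>x. (cmod (g x))\<^sup>2 \<partial>lborel\<bar> * 2 \<le> B + (\<integral>x. (cmod (g x))\<^sup>2 \<partial>lborel)"
      by (simp only: integral_complex_of_real norm_of_real mult.commute)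
    then have "(\<integral>x. (cmod (g x))\<^sup>2 \<partial>lborel) \<le> B" by linarith
    moreover have "integrable lborel (\<lambda>x. (cmod (g x))\<^sup>2)"
    proof (rule Bochner_Integration.integrable_bound)
      show "integrable lborel (\<lambda>x. real (Suc n) * cmod (f x))" using f by simp
      have "(cmod (g x))\<^sup>2 \<le> real (Suc n) * cmod (f x)" for x
        by (auto simp: g_def A_def indicator_def power2_eq_square intro!: mult_right_mono simp del: of_nat_Suc)
      then show "AE x in lborel. norm ((cmod (g x))\<^sup>2) \<le> norm (real (Suc n) * cmod (f x))"
        by (intro AE_I2) (simp add: abs_mult del: of_nat_Suc)
    qed auto
    ultimately have "(\<integral>\<^sup>+x. ennreal ((cmod (g x))\<^sup>2) \<partial>lborel) \<le> ennreal B"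
      by (simp add: nn_integral_eq_integral ennreal_leI)
    moreover have "ennreal ((cmod (g x))\<^sup>2) = ennreal ((cmod (f x))\<^sup>2) * indicator (A n) x" for x
      by (auto simp: g_def indicator_def)
    ultimately show ?thesis by simp
  qed
  have "(\<integral>\<^sup>+x. ennreal ((cmod (f x))\<^sup>2) \<partial>lborel) = (\<integral>\<^sup>+x. liminf (\<lambda>n. ennreal ((cmod (f x))\<^sup>2) * indicator (A n) x) \<partial>lborel)"
  proof (rule nn_integral_cong)
    fix x
    obtain m where m: "max (cmod (f x)) (norm x) \<le> real m" using real_arch_simple by blast
    have "eventually (\<lambda>n. ennreal ((cmod (f x))\<^sup>2) * indicator (A n) x = ennreal ((cmod (f x))\<^sup>2)) sequentially"
      using eventually_ge_at_top[of m] by eventually_elim (use m in \<open>auto simp: A_def indicator_def\<close>)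
    then have "(\<lambda>n. ennreal ((cmod (f x))\<^sup>2) * indicator (A n) x) \<longlonglongrightarrow> ennreal ((cmod (f x))\<^sup>2)"
      by (rule tendsto_eventually)
    then show "ennreal ((cmod (f x))\<^sup>2) = liminf (\<lambda>n. ennreal ((cmod (f x))\<^sup>2) * indicator (A n) x)"
      by (simp add: lim_imp_Liminf)
  qed
  also have "\<dots> \<le> liminf (\<lambda>n. \<integral>\<^sup>+x. ennreal ((cmod (f x))\<^sup>2) * indicator (A n) x \<partial>lborel)"
    by (rule nn_integral_liminf) auto
  also have "\<dots> \<le> ennreal B" using le by (intro Liminf_le) auto
  finally have fin: "(\<integral>\<^sup>+x. ennreal ((cmod (f x))\<^sup>2) \<partial>lborel) \<le> ennreal B" .
  show int: "integrable lborel (\<lambda>x. (cmod (f x))\<^sup>2)"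
    by (rule integrableI_bounded) (use fin in \<open>auto simp: le_less_trans\<close>)
  show "(\<integral>x. (cmod (f x))\<^sup>2 \<partial>lborel) \<le> B"
    using fin B0 by (simp add: nn_integral_eq_integral[OF int] ennreal_le_iff)
qed

section \<open>The Fejer kernel\<close>

text \<open>The Fejer kernel of period 1. The squared modulus makes it visibly nonnegative; the case
  \<open>N = 0\<close> is the zero function by division by zero.\<close>

definition fejer :: "nat \<Rightarrow> real \<Rightarrow> real" where
  "fejer N t = (cmod (\<Sum>j<N. cis (2 * pi * (real j * t))))\<^sup>2 / real N"

lemma fejer_nonneg: "fejer N t \<ge> 0"
  by (simp add: fejer_def)

lemma continuous_fejer [continuous_intros]: "continuous_on S g \<Longrightarrow> continuous_on S (\<lambda>t. fejer N (g t))"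
  unfolding fejer_def divide_inverse by (intro continuous_intros)

lemma borel_measurable_fejer [measurable]: "fejer N \<in> borel_measurable borel"
  by (intro borel_measurable_continuous_onI continuous_intros)

lemma fejer_le: "fejer N t \<le> real N"
proof -
  have "cmod (\<Sum>j<N. cis (2 * pi * (real j * t))) \<le> (\<Sum>j<N. 1)" by (rule sum_norm_le) simp
  then have "(cmod (\<Sum>j<N. cis (2 * pi * (real j * t))))\<^sup>2 \<le> (real N)\<^sup>2" by (intro power_mono) auto
  then show ?thesis by (cases "N = 0") (auto simp: fejer_def power2_eq_square field_simps)
qed

lemma fejer_periodic: "fejer N (t + of_int k) = fejer N t"
proof -
  have "cis (2 * pi * (real j * (t + of_int k))) = cis (2 * pi * (real j * t))" for j
  proof -
    have "cis (2 * pi * (real j * (t + of_int k))) = cis (2 * pi * (real j * t)) * cis (2 * pi * of_int (int j * k))"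
      by (simp add: cis_mult algebra_simps)
    also have "cis (2 * pi * of_int (int j * k)) = 1" by (rule cis_multiple_2pi) simp
    finally show ?thesis by simp
  qed
  then show ?thesis by (simp add: fejer_def)
qed

text \<open>Sum the geometric series and use |1 - w| = 2 |sin (pi t)| and |1 - w^N| <= 2. The
  multiplied-out form stays meaningful at integers, where the kernel peaks.\<close>

lemma fejer_sin_le:
  shows "fejer N t * (sin (pi * t))\<^sup>2 \<le> 1 / real N"
proof -
  define w where "w = cis (2 * pi * t)"
  have "(\<Sum>j<N. cis (2 * pi * (real j * t))) = (\<Sum>j<N. w ^ j)"
    by (rule sum.cong) (auto simp: w_def Complex.DeMoivre mult_ac)
  then have geo: "(1 - w) * (\<Sum>j<N. cis (2 * pi * (real j * t))) = 1 - w ^ N"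
    by (simp add: one_diff_power_eq)
  have "(cmod (1 - w))\<^sup>2 = 4 * (sin (pi * t))\<^sup>2"
  proof -
    have "(cmod (1 - w))\<^sup>2 = (1 - cos (2 * (pi * t)))\<^sup>2 + (sin (2 * (pi * t)))\<^sup>2"
      by (simp add: w_def cmod_power2 mult_ac)
    also have "\<dots> = 2 - 2 * cos (2 * (pi * t))"
      using sin_cos_squared_add[of "2 * (pi * t)"] by (simp add: power2_eq_square algebra_simps)
    also have "\<dots> = 4 * (sin (pi * t))\<^sup>2" by (simp add: cos_double_sin)
    finally show ?thesis .
  qed
  then have "4 * (fejer N t * (sin (pi * t))\<^sup>2) = (cmod (1 - w ^ N))\<^sup>2 / real N"
    by (simp add: fejer_def power_mult_distrib norm_mult flip: geo)
  also have "(cmod (1 - w ^ N))\<^sup>2 \<le> 2\<^sup>2"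
    by (intro power_mono norm_triangle_le_diff) (auto simp: w_def norm_power)
  finally show ?thesis by (simp add: divide_right_mono field_simps)
qed

text \<open>The diagonal of the double sum gives the constant 1. Harmonics stay indexed by pairs and
  are not collected into triangular weights: a bound for each row \<open>j\<close>, averaged over
  the rows, is then all that is needed.\<close>

lemma fejer_eq_sum_cos:
  assumes "N > 0"
  shows "fejer N t = 1 + (\<Sum>j<N. \<Sum>k\<in>{..<N} - {j}. cos (2 * pi * (real j - real k) * t)) / real N"
proof -
  let ?S = "\<Sum>j<N. cis (2 * pi * (real j * t))"
  have "complex_of_real ((cmod ?S)\<^sup>2) = (\<Sum>j<N. \<Sum>k<N. cis (2 * pi * (real j - real k) * t))"
    unfolding complex_norm_square sum_product cnj_sum cis_cnj cis_mult
    by (simp add: sum_product cis_mult algebra_simps)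
  then have "(cmod ?S)\<^sup>2 = Re (\<Sum>j<N. \<Sum>k<N. cis (2 * pi * (real j - real k) * t))"
    by (metis Re_complex_of_real)
  also have "\<dots> = (\<Sum>j<N. \<Sum>k<N. cos (2 * pi * (real j - real k) * t))" by simp
  also have "\<dots> = (\<Sum>j<N. 1 + (\<Sum>k\<in>{..<N} - {j}. cos (2 * pi * (real j - real k) * t)))"
    by (rule sum.cong) (auto simp: sum.remove)
  also have "\<dots> = real N + (\<Sum>j<N. \<Sum>k\<in>{..<N} - {j}. cos (2 * pi * (real j - real k) * t))"
    by (simp add: sum.distrib)
  finally show ?thesis using assms by (simp add: fejer_def add_divide_distrib)
qed

lemma has_bochner_integral_fejer:
  assumes "N > 0"
  shows "has_bochner_integral lborel (\<lambda>t. fejer N t * indicator {-1/2..1/2} t) 1"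
proof -
  have cos: "has_bochner_integral lborel (\<lambda>t. cos (2 * pi * (real j - real k) * t) * indicator {-1/2..1/2} t) 0"
    if "j \<noteq> k" for j k :: nat
  proof -
    define m where "m = real j - real k"
    have m: "m \<noteq> 0" using that by (simp add: m_def)
    have "sin (pi * m) = 0"
      using sin_npi_int[of "int j - int k"] by (simp add: m_def)
    then have eq: "sin (2 * pi * m * (1/2)) / (2 * pi * m) - sin (2 * pi * m * (-1/2)) / (2 * pi * m) = 0"
      by simp
    have "has_bochner_integral lborel (\<lambda>t. cos (2 * pi * m * t) * indicator {-1/2..1/2} t)
       (sin (2 * pi * m * (1/2)) / (2 * pi * m) - sin (2 * pi * m * (-1/2)) / (2 * pi * m))"
      by (rule has_bochner_integral_FTC_Icc_real) (use m in \<open>auto intro!: derivative_eq_intros continuous_intros\<close>)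
    from this[unfolded eq] show ?thesis unfolding m_def .
  qed
  have one: "has_bochner_integral lborel (\<lambda>t::real. indicator {-1/2..1/2} t :: real) 1"
    using has_bochner_integral_real_indicator[of "{-1/2..1/2::real}" lborel] by simp
  have "has_bochner_integral lborel (\<lambda>t. indicator {-1/2..1/2} t +
      (\<Sum>j<N. \<Sum>k\<in>{..<N} - {j}. cos (2 * pi * (real j - real k) * t) * indicator {-1/2..1/2} t) / real N)
      (1 + (\<Sum>j<N. \<Sum>k\<in>{..<N} - {j}. 0) / real N)"
    by (intro has_bochner_integral_add one has_bochner_integral_divide has_bochner_integral_sum cos) auto
  moreover have "indicator {-1/2..1/2} t +
      (\<Sum>j<N. \<Sum>k\<in>{..<N} - {j}. cos (2 * pi * (real j - real k) * t) * indicator {-1/2..1/2} t) / real N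
      = fejer N t * indicator {-1/2..1/2} t" for t
    by (simp add: fejer_eq_sum_cos[OF assms] distrib_right sum_distrib_right)
  ultimately show ?thesis by simp
qed

text \<open>The deviation of \<open>\<phi>\<close> from its value at 0 is at most e near 0 by
  continuity, and elsewhere at most a multiple of sin (pi t)^2. Against the kernel the first part
  integrates to e and the second to O(1/N) by \<open>fejer_sin_le\<close>.\<close>

lemma fejer_approximation:
  assumes \<phi>: "continuous_on {-1/2..1/2} \<phi>"
  shows "(\<lambda>N. \<integral>t. fejer N t * \<phi> t * indicator {-1/2..1/2} t \<partial>lborel) \<longlonglongrightarrow> \<phi> 0"
proof -
  let ?I = "{-1/2..1/2::real}"
  have "compact (\<phi> ` ?I)" using \<phi> by (intro compact_continuous_image) auto
  then obtain M where "\<forall>x\<in>\<phi> ` ?I. norm x \<le> M"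
    using compact_imp_bounded bounded_iff by metis
  then have M: "\<bar>\<phi> t\<bar> \<le> M" if "t \<in> ?I" for t using that by (metis imageI real_norm_def)
  have M0: "M \<ge> 0" using M[of 0] by auto
  have close: "\<exists>C\<ge>0. \<forall>t\<in>?I. \<bar>\<phi> t - \<phi> 0\<bar> \<le> e + C * (sin (pi * t))\<^sup>2" if "e > 0" for e
  proof -
    obtain d0 where d0: "d0 > 0" "\<forall>t\<in>?I. dist t 0 < d0 \<longrightarrow> dist (\<phi> t) (\<phi> 0) < e"
      using \<phi>[unfolded continuous_on_iff, rule_format, of 0 e] \<open>e > 0\<close> by auto
    \<comment> \<open>The minimum with 1/2 keeps \<open>pi * d\<close> in the range where the sine
      is positive and increasing, so its value there bounds |sin (pi t)| from below for all
      \<open>t\<close> in the interval with |t| at least \<open>d\<close>.\<close>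
    define d where "d = min d0 (1/2)"
    have d: "d > 0" "d \<le> 1/2" "d \<le> d0" using d0 by (auto simp: d_def)
    have sd: "sin (pi * d) > 0" using d by (intro sin_gt_zero) auto
    define C where "C = 2 * M / (sin (pi * d))\<^sup>2"
    have "\<bar>\<phi> t - \<phi> 0\<bar> \<le> e + C * (sin (pi * t))\<^sup>2" if t: "t \<in> ?I" for t
    proof (cases "\<bar>t\<bar> < d0")
      case True
      have "C * (sin (pi * t))\<^sup>2 \<ge> 0" using M0 by (simp add: C_def)
      then show ?thesis using d0(2) t True by (force simp: dist_real_def)
    next
      case False
      have "pi * d \<ge> 0" "pi * d \<le> pi * \<bar>t\<bar>" "pi * \<bar>t\<bar> \<le> pi * (1 / 2)"
        using d t False by (auto intro!: mult_left_mono)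
      then have "sin (pi * d) \<le> sin (pi * \<bar>t\<bar>)"
        using pi_gt_zero by (intro sin_monotone_2pi_le) linarith+
      then have "(sin (pi * d))\<^sup>2 \<le> (sin (pi * \<bar>t\<bar>))\<^sup>2" using sd by (intro power_mono) auto
      also have "(sin (pi * \<bar>t\<bar>))\<^sup>2 = (sin (pi * t))\<^sup>2" by (cases "t \<ge> 0") auto
      finally have "2 * M \<le> C * (sin (pi * t))\<^sup>2"
        using sd M0 by (auto simp: C_def field_simps intro: mult_left_mono)
      moreover have "\<bar>\<phi> t - \<phi> 0\<bar> \<le> 2 * M" using M[OF t] M[of 0] by auto
      ultimately show ?thesis using \<open>e > 0\<close> by linarith
    qed
    moreover have "C \<ge> 0" using M0 by (simp add: C_def)
    ultimately show ?thesis by blast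
  qed
  have est: "\<bar>(\<integral>t. fejer N t * \<phi> t * indicator ?I t \<partial>lborel) - \<phi> 0\<bar> \<le> e + C / real N"
    if C: "C \<ge> 0" "\<forall>t\<in>?I. \<bar>\<phi> t - \<phi> 0\<bar> \<le> e + C * (sin (pi * t))\<^sup>2" and N: "N > 0" for e C N
  proof -
    note F = has_bochner_integral_fejer[OF N]
    have int1: "integrable lborel (\<lambda>t. fejer N t * \<phi> t * indicator ?I t)"
      using borel_integrable_atLeastAtMost'[of "-1/2" "1/2" "\<lambda>t. fejer N t * \<phi> t"] \<phi>
      by (simp add: continuous_intros set_integrable_def mult.commute)
    have int2: "integrable lborel (\<lambda>t. \<phi> 0 * (fejer N t * indicator ?I t))" "integrable lborel (\<lambda>t. e * (fejer N t * indicator ?I t))"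
      using F by (auto simp: has_bochner_integral_iff)
    have int3: "integrable lborel (\<lambda>t. C / real N * indicator ?I t)" by simp
    have eq: "(\<integral>t. fejer N t * \<phi> t * indicator ?I t \<partial>lborel) - \<phi> 0
        = (\<integral>t. fejer N t * \<phi> t * indicator ?I t - \<phi> 0 * (fejer N t * indicator ?I t) \<partial>lborel)"
      using F int1 int2 by (simp add: has_bochner_integral_iff)
    have "\<bar>(\<integral>t. fejer N t * \<phi> t * indicator ?I t \<partial>lborel) - \<phi> 0\<bar> \<le> (\<integral>t. e * (fejer N t * indicator ?I t) + C / real N * indicator ?I t \<partial>lborel)"
      unfolding eq
    proof (rule Bochner_Integration.integral_abs_bound_integral)
      fix t
      show "\<bar>fejer N t * \<phi> t * indicator ?I t - \<phi> 0 * (fejer N t * indicator ?I t)\<bar>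
         \<le> e * (fejer N t * indicator ?I t) + C / real N * indicator ?I t"
      proof (cases "t \<in> ?I")
        case True
        have "fejer N t * \<bar>\<phi> t - \<phi> 0\<bar> \<le> fejer N t * (e + C * (sin (pi * t))\<^sup>2)"
          using C True fejer_nonneg by (intro mult_left_mono) auto
        also have "\<dots> = e * fejer N t + C * (fejer N t * (sin (pi * t))\<^sup>2)" by (simp add: algebra_simps)
        also have "\<dots> \<le> e * fejer N t + C * (1 / real N)" using C fejer_sin_le by (intro add_left_mono mult_left_mono)
        finally have "\<bar>fejer N t * (\<phi> t - \<phi> 0)\<bar> \<le> e * fejer N t + C / real N"
          by (simp add: abs_mult fejer_nonneg)
        then show ?thesis using True by (simp add: algebra_simps)
      qed simp
    qed (use int1 int2 int3 in auto)
    also have "\<dots> = e + C / real N"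
      using F int2 int3 by (simp add: has_bochner_integral_iff)
    finally show ?thesis .
  qed
  show ?thesis
  proof (rule LIMSEQ_I)
    fix r :: real assume r: "r > 0"
    obtain C where C: "C \<ge> 0" "\<forall>t\<in>?I. \<bar>\<phi> t - \<phi> 0\<bar> \<le> r / 2 + C * (sin (pi * t))\<^sup>2" using close[of "r / 2"] r by auto
    obtain N0 :: nat where N0: "2 * C / r < real N0" using reals_Archimedean2 by blast
    have "\<bar>(\<integral>t. fejer N t * \<phi> t * indicator ?I t \<partial>lborel) - \<phi> 0\<bar> < r" if "N \<ge> Suc N0" for N
    proof -
      have "2 * C / r < real N" using N0 that by linarith
      then have "C / real N < r / 2" using r that by (simp add: field_simps)
      moreover have "N > 0" using that by simp
      ultimately show ?thesis using est[OF C, of N] by linarith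
    qed
    then show "\<exists>no. \<forall>n\<ge>no. norm ((\<integral>t. fejer n t * \<phi> t * indicator ?I t \<partial>lborel) - \<phi> 0) < r" by auto
  qed
qed

text \<open>As a function of t the kernel has period 8 and peaks at 4, 12, 20 and so on. Each
  interval [8j, 8j + 8) has one peak, at its centre, and tends to 8 times the value of
  \<open>\<psi>\<close> there, 8 being the Jacobian. The exponential bound dominates the pieces by a
  geometric series, so Tannery's theorem exchanges sum and limit.\<close>

lemma fejer_sampling:
  assumes \<psi>: "continuous_on UNIV \<psi>" and b: "b > 0"
    and bound: "\<And>t. t \<ge> 0 \<Longrightarrow> \<bar>\<psi> t\<bar> \<le> K * exp (- b * t)"
  shows "summable (\<lambda>j. \<psi> (8 * real j + 4))"
    and "(\<lambda>N. LBINT t:{0..}. fejer N ((t - 4) / 8) * \<psi> t) \<longlonglongrightarrow> 8 * (\<Sum>j. \<psi> (8 * real j + 4))"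
    and "set_integrable lborel {0..} (\<lambda>t. fejer N ((t - 4) / 8) * \<psi> t)"
proof -
  define A where "A j = {8 * real j..<8 * real j + 8}" for j
  have [measurable]: "A j \<in> sets borel" for j by (simp add: A_def)
  have K0: "K \<ge> 0" using order.trans[OF abs_ge_zero bound[of 0]] by simp
  have [measurable]: "\<psi> \<in> borel_measurable borel" using \<psi> by (rule borel_measurable_continuous_onI)
  have UA: "(\<Union>j. A j) = {0..}"
  proof (rule set_eqI)
    fix t :: real
    have "t \<in> A (nat \<lfloor>t / 8\<rfloor>)" if "t \<ge> 0"
    proof -
      have "real (nat \<lfloor>t / 8\<rfloor>) = real_of_int \<lfloor>t / 8\<rfloor>" using that by simp
      moreover have "real_of_int \<lfloor>t / 8\<rfloor> \<le> t / 8" "t / 8 < real_of_int \<lfloor>t / 8\<rfloor> + 1" by linarith+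
      ultimately show ?thesis unfolding A_def atLeastLessThan_iff by linarith
    qed
    moreover have "t \<ge> 0" if "t \<in> A j" for j using that by (simp add: A_def)
    ultimately show "t \<in> (\<Union>j. A j) \<longleftrightarrow> t \<in> {0..}" by auto
  qed
  have disj: "A i \<inter> A j = {}" if "i \<noteq> j" for i j
  proof -
    have "real i + 1 \<le> real j \<or> real j + 1 \<le> real i" using that by linarith
    then show ?thesis by (auto simp: A_def)
  qed
  define a where "a j N = (LBINT t:A j. fejer N ((t - 4) / 8) * \<psi> t)" for j N
  show int: "set_integrable lborel {0..} (\<lambda>t. fejer N ((t - 4) / 8) * \<psi> t)" for N
  proof (rule set_integrable_bound)
    have "set_integrable lborel {0<..} (\<lambda>t. exp (- (t * b)))" by (rule integrable_I0i_exp_mscale[OF b])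
    then have "set_integrable lborel {0<..} (\<lambda>t. real N * (K * exp (- b * t)))"
      by (simp add: mult.commute)
    moreover have "AE t in lborel. indicator {0<..} t *\<^sub>R (real N * (K * exp (- b * t))) = indicator {0..} t *\<^sub>R (real N * (K * exp (- b * t)))"
      using AE_lborel_singleton[of 0] by eventually_elim (auto simp: indicator_def)
    ultimately show "set_integrable lborel {0..} (\<lambda>t. real N * (K * exp (- b * t)))"
      unfolding set_integrable_def by (subst (asm) integrable_cong_AE) auto
    show "set_borel_measurable lborel {0..} (\<lambda>t. fejer N ((t - 4) / 8) * \<psi> t)"
      unfolding set_borel_measurable_def by measurable
    show "AE t in lborel. t \<in> {0..} \<longrightarrow> norm (fejer N ((t - 4) / 8) * \<psi> t) \<le> norm (real N * (K * exp (- b * t)))"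
    proof (intro AE_I2 impI)
      fix t :: real assume "t \<in> {0..}"
      then have "fejer N ((t - 4) / 8) * \<bar>\<psi> t\<bar> \<le> real N * (K * exp (- b * t))"
        using fejer_le bound by (intro mult_mono) auto
      then show "norm (fejer N ((t - 4) / 8) * \<psi> t) \<le> norm (real N * (K * exp (- b * t)))"
        using K0 by (simp add: abs_mult fejer_nonneg)
    qed
  qed
  have sum: "(LBINT t:{0..}. fejer N ((t - 4) / 8) * \<psi> t) = (\<Sum>j. a j N)" for N
    unfolding a_def UA[symmetric]
    by (rule lebesgue_integral_countable_add) (use disj int[of N] UA in auto)
  have a_eq: "a j N = 8 * (\<integral>s. fejer N s * \<psi> (8 * s + 8 * real j + 4) * indicator {-1/2..1/2} s \<partial>lborel)" for j N
  proof -
    let ?B = "{8 * real j..8 * real j + 8}"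
    have "a j N = (\<integral>t. fejer N ((t - 4) / 8) * \<psi> t * indicator (A j) t \<partial>lborel)"
      by (simp add: a_def set_lebesgue_integral_def mult.commute)
    also have "\<dots> = (\<integral>t. fejer N ((t - 4) / 8) * \<psi> t * indicator ?B t \<partial>lborel)"
    proof (rule integral_cong_AE)
      show "AE t in lborel. fejer N ((t - 4) / 8) * \<psi> t * indicator (A j) t = fejer N ((t - 4) / 8) * \<psi> t * indicator ?B t"
        using AE_lborel_singleton[of "8 * real j + 8"] by eventually_elim (auto simp: A_def indicator_def)
    qed measurable
    also have "\<dots> = 8 * (\<integral>s. fejer N ((8 * real j + 4 + 8 * s - 4) / 8) * \<psi> (8 * real j + 4 + 8 * s) * indicator ?B (8 * real j + 4 + 8 * s) \<partial>lborel)"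
      by (subst lborel_integral_real_affine[where c = 8 and t = "8 * real j + 4"]) auto
    also have "(\<lambda>s. fejer N ((8 * real j + 4 + 8 * s - 4) / 8) * \<psi> (8 * real j + 4 + 8 * s) * indicator ?B (8 * real j + 4 + 8 * s))
        = (\<lambda>s. fejer N s * \<psi> (8 * s + 8 * real j + 4) * indicator {-1/2..1/2} s)"
    proof
      fix s :: real
      have "(8 * real j + 4 + 8 * s - 4) / 8 = s + of_int (int j)" by simp
      then have "fejer N ((8 * real j + 4 + 8 * s - 4) / 8) = fejer N s" by (simp only: fejer_periodic)
      moreover have "8 * real j + 4 + 8 * s = 8 * s + 8 * real j + 4" by simp
      moreover have "(indicator ?B (8 * s + 8 * real j + 4) :: real) = indicator {-1/2..1/2} s"
        by (auto simp: indicator_def)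
      ultimately show "fejer N ((8 * real j + 4 + 8 * s - 4) / 8) * \<psi> (8 * real j + 4 + 8 * s) * indicator ?B (8 * real j + 4 + 8 * s)
         = fejer N s * \<psi> (8 * s + 8 * real j + 4) * indicator {-1/2..1/2} s" by (simp only:)
    qed
    finally show ?thesis .
  qed
  have lim: "a j \<longlonglongrightarrow> 8 * \<psi> (8 * real j + 4)" for j
  proof -
    have "(\<lambda>N. \<integral>s. fejer N s * \<psi> (8 * s + 8 * real j + 4) * indicator {-1/2..1/2} s \<partial>lborel) \<longlonglongrightarrow> \<psi> (8 * 0 + 8 * real j + 4)"
      by (rule fejer_approximation) (intro continuous_intros continuous_on_compose2[OF \<psi>], auto)
    then show ?thesis unfolding a_eq by (intro tendsto_intros) simp
  qed
  have a_le: "norm (a j N) \<le> 8 * K * exp (- b * 8) ^ j" if N: "N > 0" for j N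
  proof -
    note F = has_bochner_integral_fejer[OF N]
    let ?k = "K * exp (- b * 8) ^ j"
    have "norm (\<integral>s. fejer N s * \<psi> (8 * s + 8 * real j + 4) * indicator {-1/2..1/2} s \<partial>lborel)
       \<le> (\<integral>s. ?k * (fejer N s * indicator {-1/2..1/2} s) \<partial>lborel)"
    proof (rule Bochner_Integration.integral_norm_bound_integral)
      show i: "integrable lborel (\<lambda>s. ?k * (fejer N s * indicator {-1/2..1/2} s))"
        using F by (simp add: has_bochner_integral_iff)
      show le: "norm (fejer N s * \<psi> (8 * s + 8 * real j + 4) * indicator {-1/2..1/2} s) \<le> ?k * (fejer N s * indicator {-1/2..1/2} s)" for s
      proof (cases "s \<in> {-1/2..1/2}")
        case True
        then have s: "8 * s + 8 * real j + 4 \<ge> 8 * real j" by simp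
        then have "\<bar>\<psi> (8 * s + 8 * real j + 4)\<bar> \<le> K * exp (- b * (8 * s + 8 * real j + 4))" by (intro bound) linarith
        also have "\<dots> \<le> K * exp (- b * (8 * real j))" using s b K0 by (intro mult_left_mono) (auto simp: mult_left_mono)
        also have "exp (- b * (8 * real j)) = exp (- b * 8) ^ j" by (simp add: exp_of_nat_mult[symmetric] mult_ac)
        finally have "fejer N s * \<bar>\<psi> (8 * s + 8 * real j + 4)\<bar> \<le> fejer N s * ?k" by (intro mult_left_mono fejer_nonneg)
        then show ?thesis using True by (simp add: abs_mult fejer_nonneg mult.commute)
      qed simp
      show "integrable lborel (\<lambda>s. fejer N s * \<psi> (8 * s + 8 * real j + 4) * indicator {-1/2..1/2} s)"
        by (rule Bochner_Integration.integrable_bound[OF i])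
           (use le K0 in \<open>auto simp: abs_mult fejer_nonneg intro!: AE_I2 order.trans[OF le]\<close>)
    qed
    also have "\<dots> = ?k" using F by (simp add: has_bochner_integral_iff)
    finally show ?thesis unfolding a_eq by simp
  qed
  have T: "eventually (\<lambda>n. summable (\<lambda>k. norm (a k n))) sequentially \<and>
           summable (\<lambda>n. norm (8 * \<psi> (8 * real n + 4))) \<and>
           ((\<lambda>n. suminf (\<lambda>k. a k n)) \<longlonglongrightarrow> suminf (\<lambda>j. 8 * \<psi> (8 * real j + 4)))"
  proof (rule tannerys_theorem[OF lim])
    \<comment> \<open>\<open>a_le\<close> rests on the unit mass of the kernel and is therefore
      available for positive \<open>N\<close> only.\<close>
    show "eventually (\<lambda>(k, n). norm (a k n) \<le> 8 * K * exp (- b * 8) ^ k) (at_top \<times>\<^sub>F sequentially)"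
      by (rule eventually_mono[OF eventually_prodI[OF eventually_True eventually_gt_at_top[of 0]]]) (use a_le in auto)
    show "summable (\<lambda>k. 8 * K * exp (- b * 8) ^ k)" using b by (intro summable_mult summable_geometric) simp
  qed simp
  from T[THEN conjunct2, THEN conjunct1]
  have "summable (\<lambda>j. norm (8 * \<psi> (8 * real j + 4)))" .
  from summable_mult[OF summable_norm_cancel[OF this], of "1 / 8"]
  show s: "summable (\<lambda>j. \<psi> (8 * real j + 4))" by simp
  from T[THEN conjunct2, THEN conjunct2] have "(\<lambda>N. \<Sum>j. a j N) \<longlonglongrightarrow> (\<Sum>j. 8 * \<psi> (8 * real j + 4))" .
  then show "(\<lambda>N. LBINT t:{0..}. fejer N ((t - 4) / 8) * \<psi> t) \<longlonglongrightarrow> 8 * (\<Sum>j. \<psi> (8 * real j + 4))"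
    unfolding sum suminf_mult[OF s] .
qed

section \<open>Rotations and Haar measure\<close>

text \<open>Two translation-invariant measures agreeing on the unit ball coincide: integrate
  \<open>(x, y) \<mapsto> 1\<^sub>E(x) 1\<^sub>b(y - x)\<close> in both orders.\<close>

lemma translation_invariant_eq_lborel:
  fixes M :: "'a::euclidean_space measure"
  assumes sets: "sets M = sets borel" and "sigma_finite_measure M"
    and inv: "\<And>t. distr M borel (\<lambda>x. t + x) = M" and neg: "distr M borel uminus = M"
    and ball: "emeasure M (ball 0 1) = emeasure lborel (ball (0::'a) 1)"
  shows "M = lborel"
proof (rule measure_eqI)
  have [measurable_cong]: "sets M = sets borel" by (rule sets)
  interpret M: sigma_finite_measure M by fact
  interpret P: pair_sigma_finite M lborel ..
  let ?b = "ball (0::'a) 1"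
  show "sets M = sets lborel" using sets by simp
  fix E assume "E \<in> sets M"
  then have E [measurable]: "E \<in> sets borel" using sets by simp
  have minus: "(\<integral>\<^sup>+u. h (y - u) \<partial>M) = (\<integral>\<^sup>+x. h x \<partial>M)" if [measurable]: "h \<in> borel_measurable borel" for h :: "'a \<Rightarrow> ennreal" and y
  proof -
    have "(\<integral>\<^sup>+x. h x \<partial>M) = (\<integral>\<^sup>+x. h x \<partial>distr M borel (\<lambda>x. y + x))" by (simp only: inv)
    also have "\<dots> = (\<integral>\<^sup>+x. h (y + x) \<partial>M)" by (simp add: nn_integral_distr)
    also have "\<dots> = (\<integral>\<^sup>+x. h (y + x) \<partial>distr M borel uminus)" by (simp only: neg)
    also have "\<dots> = (\<integral>\<^sup>+u. h (y - u) \<partial>M)" by (simp add: nn_integral_distr)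
    finally show ?thesis by simp
  qed
  have lplus: "(\<integral>\<^sup>+y. h (y - x) \<partial>lborel) = (\<integral>\<^sup>+y. h y \<partial>lborel)" if [measurable]: "h \<in> borel_measurable borel" for h :: "'a \<Rightarrow> ennreal" and x
  proof -
    have "(\<integral>\<^sup>+y. h y \<partial>lborel) = (\<integral>\<^sup>+y. h y \<partial>distr lborel borel ((+) (- x)))" by (simp only: lborel_distr_plus)
    also have "\<dots> = (\<integral>\<^sup>+y. h (y - x) \<partial>lborel)" by (simp add: nn_integral_distr)
    finally show ?thesis by simp
  qed
  have [measurable]: "?b \<in> sets borel" by simp
  have "emeasure M E * emeasure lborel ?b = (\<integral>\<^sup>+x. indicator E x * emeasure lborel ?b \<partial>M)"
    by (simp add: nn_integral_multc)
  also have "\<dots> = (\<integral>\<^sup>+x. \<integral>\<^sup>+y. indicator E x * indicator ?b (y - x) \<partial>lborel \<partial>M)"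
  proof (rule nn_integral_cong)
    fix x
    have "(\<integral>\<^sup>+y. indicator ?b (y - x) \<partial>lborel) = (\<integral>\<^sup>+y. indicator ?b y \<partial>(lborel :: 'a measure))" by (rule lplus) measurable
    then show "indicator E x * emeasure lborel ?b = (\<integral>\<^sup>+y. indicator E x * indicator ?b (y - x) \<partial>lborel)"
      by (simp add: nn_integral_cmult)
  qed
  also have "\<dots> = (\<integral>\<^sup>+y. \<integral>\<^sup>+x. indicator E x * indicator ?b (y - x) \<partial>M \<partial>lborel)"
    by (rule P.Fubini'[symmetric]) measurable
  also have "\<dots> = (\<integral>\<^sup>+y. \<integral>\<^sup>+u. indicator E (y - u) * indicator ?b u \<partial>M \<partial>lborel)"
  proof (rule nn_integral_cong)
    fix y :: 'a
    show "(\<integral>\<^sup>+x. indicator E x * indicator ?b (y - x) \<partial>M) = (\<integral>\<^sup>+u. indicator E (y - u) * indicator ?b u \<partial>M)"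
      using minus[of "\<lambda>x. indicator E x * indicator ?b (y - x)" y] by simp
  qed
  also have "\<dots> = (\<integral>\<^sup>+u. \<integral>\<^sup>+y. indicator E (y - u) * indicator ?b u \<partial>lborel \<partial>M)"
    by (rule P.Fubini') measurable
  also have "\<dots> = (\<integral>\<^sup>+u. emeasure lborel E * indicator ?b u \<partial>M)"
  proof (rule nn_integral_cong)
    fix u :: 'a
    have "(\<integral>\<^sup>+y. indicator E (y - u) \<partial>lborel) = (\<integral>\<^sup>+y. indicator E y \<partial>lborel)" by (rule lplus) simp
    then show "(\<integral>\<^sup>+y. indicator E (y - u) * indicator ?b u \<partial>lborel) = emeasure lborel E * indicator ?b u"
      by (simp add: nn_integral_multc)
  qed
  also have "\<dots> = emeasure lborel E * emeasure lborel ?b"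
    by (simp add: nn_integral_cmult_indicator ball)
  finally have "emeasure M E * emeasure lborel ?b = emeasure lborel E * emeasure lborel ?b" .
  moreover have "unit_ball_vol (real DIM('a)) \<noteq> 0"
    using unit_ball_vol_pos[OF of_nat_0_le_iff] by (metis less_irrefl)
  then have "emeasure lborel ?b \<noteq> 0" "emeasure lborel ?b \<noteq> \<infinity>"
    using emeasure_lborel_ball_finite[of "0::'a" 1] by (auto simp: emeasure_ball)
  ultimately show "emeasure M E = emeasure lborel E"
    by (simp add: ennreal_mult_cancel_left mult.commute[of _ "emeasure lborel ?b"])
qed

text \<open>A linear isometry carries translations to translations and the unit ball to itself, so
  the image measure satisfies the uniqueness criterion.\<close>

lemma lborel_distr_linear_isometry:
  fixes T :: "'a::euclidean_space \<Rightarrow> 'a"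
  assumes T: "orthogonal_transformation T"
  shows "distr lborel borel T = lborel"
proof (rule translation_invariant_eq_lborel)
  have lin: "linear T" using T by (rule orthogonal_transformation_linear)
  have [measurable]: "T \<in> borel_measurable borel"
    by (intro borel_measurable_continuous_onI linear_continuous_on linear_conv_bounded_linear[THEN iffD1] lin)
  have bij: "bij T" using T by (rule orthogonal_transformation_bij)
  have norm: "norm (T x) = norm x" for x using T by (rule orthogonal_transformation_norm)
  show "sets (distr lborel borel T) = sets borel" by simp
  have b: "T -` ball 0 r \<inter> space lborel = ball 0 r" for r by (auto simp: norm)
  show "emeasure (distr lborel borel T) (ball 0 1) = emeasure lborel (ball (0::'a) 1)"
    by (subst emeasure_distr) (auto simp: b simp del: space_lborel)
  show "sigma_finite_measure (distr lborel borel T)"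
  proof
    show "\<exists>A. countable A \<and> A \<subseteq> sets (distr lborel borel T) \<and> \<Union> A = space (distr lborel borel T)
       \<and> (\<forall>a\<in>A. emeasure (distr lborel borel T) a \<noteq> \<infinity>)"
    proof (intro exI[of _ "range (\<lambda>n::nat. ball 0 (real n))"] conjI ballI)
      show "(\<Union>n. ball 0 (real n)) = space (distr lborel borel T)"
        by (auto simp: reals_Archimedean2)
      fix a assume "a \<in> range (\<lambda>n::nat. ball (0::'a) (real n))"
      then obtain n :: nat where a: "a = ball 0 (real n)" by blast
      have "emeasure (distr lborel borel T) a = emeasure lborel a"
        unfolding a by (subst emeasure_distr) (auto simp: b simp del: space_lborel)
      then show "emeasure (distr lborel borel T) a \<noteq> \<infinity>"
        using emeasure_lborel_ball_finite[of "0::'a" "real n"] by (auto simp: a)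
    qed auto
  qed
  show "distr (distr lborel borel T) borel (\<lambda>x. t + x) = distr lborel borel T" for t
  proof -
    \<comment> \<open>A translation by \<open>t\<close> after \<open>T\<close> is a translation by
      the preimage of \<open>t\<close> before \<open>T\<close>.\<close>
    obtain s where s: "t = T s" using bij by (metis bij_pointE)
    have "distr (distr lborel borel T) borel (\<lambda>x. t + x) = distr lborel borel (\<lambda>x. T (s + x))"
      by (subst distr_distr) (auto simp: comp_def s linear_add[OF lin])
    also have "\<dots> = distr (distr lborel borel ((+) s)) borel T"
      by (subst distr_distr) (auto simp: comp_def)
    finally show ?thesis by (simp only: lborel_distr_plus)
  qed
  have neg: "distr lborel borel uminus = (lborel :: 'a measure)"
    using lborel_affine[of "-1" "0::'a"] by (simp add: density_1)
  have "distr (distr lborel borel T) borel uminus = distr lborel borel (\<lambda>x. T (- x))"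
    by (subst distr_distr) (auto simp: comp_def linear_neg[OF lin])
  also have "\<dots> = distr (distr lborel borel uminus) borel T"
    by (subst distr_distr) (auto simp: comp_def)
  finally show "distr (distr lborel borel T) borel uminus = distr lborel borel T" by (simp only: neg)
qed

lemma orthogonal_transformation_SOd:
  "A \<in> SOd \<Longrightarrow> orthogonal_transformation (\<lambda>x. A *v x)" for A :: "real^'n^'n"
  by (simp add: SOd_def orthogonal_transformation_matrix)

lemma continuous_matrix_vector_mult: "continuous_on S (\<lambda>x. A *v x)" for A :: "real^'n^'m"
  by (intro linear_continuous_on matrix_vector_mul_bounded_linear)

lemma borel_measurable_matrix_mult [measurable (raw)]:
  fixes f :: "'a \<Rightarrow> real^'n^'m" and g :: "'a \<Rightarrow> real^'k^'n"
  assumes "f \<in> borel_measurable M" "g \<in> borel_measurable M"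
  shows "(\<lambda>x. f x ** g x) \<in> borel_measurable M"
  by (rule borel_measurable_continuous_Pair[OF assms])
     (auto simp: matrix_matrix_mult_def intro!: continuous_intros)

lemma borel_measurable_matrix_vector_mult [measurable (raw)]:
  fixes f :: "'a \<Rightarrow> real^'n^'m" and g :: "'a \<Rightarrow> real^'n"
  assumes "f \<in> borel_measurable M" "g \<in> borel_measurable M"
  shows "(\<lambda>x. f x *v g x) \<in> borel_measurable M"
  by (rule borel_measurable_continuous_Pair[OF assms])
     (auto simp: matrix_vector_mult_def intro!: continuous_intros)

lemma nn_integral_SOd_rotate:
  fixes A :: "real^'n^'n" and h :: "real^'n \<Rightarrow> ennreal"
  assumes "A \<in> SOd" and [measurable]: "h \<in> borel_measurable borel"
  shows "(\<integral>\<^sup>+x. h (A *v x) \<partial>lborel) = (\<integral>\<^sup>+x. h x \<partial>lborel)"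
proof -
  have "(\<integral>\<^sup>+x. h x \<partial>lborel) = (\<integral>\<^sup>+x. h x \<partial>distr lborel borel (\<lambda>x. A *v x))"
    by (simp only: lborel_distr_linear_isometry[OF orthogonal_transformation_SOd[OF assms(1)]])
  also have "\<dots> = (\<integral>\<^sup>+x. h (A *v x) \<partial>lborel)"
    by (intro nn_integral_distr) auto
  finally show ?thesis by simp
qed

lemma integral_SOd_rotate:
  fixes A :: "real^'n^'n" and h :: "real^'n \<Rightarrow> 'b::{banach, second_countable_topology}"
  assumes "A \<in> SOd" and h: "integrable lborel h"
  shows "integrable lborel (\<lambda>x. h (A *v x))" "(\<integral>x. h (A *v x) \<partial>lborel) = (\<integral>x. h x \<partial>lborel)"
proof -
  have [measurable]: "h \<in> borel_measurable borel" using h borel_measurable_integrable by fastforce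
  note D = lborel_distr_linear_isometry[OF orthogonal_transformation_SOd[OF assms(1)]]
  have "integrable (distr lborel borel (\<lambda>x. A *v x)) h" unfolding D by (rule h)
  then show "integrable lborel (\<lambda>x. h (A *v x))" by (subst (asm) integrable_distr_eq) auto
  have "(\<integral>x. h x \<partial>distr lborel borel (\<lambda>x. A *v x)) = (\<integral>x. h (A *v x) \<partial>lborel)" by (rule integral_distr) auto
  then show "(\<integral>x. h (A *v x) \<partial>lborel) = (\<integral>x. h x \<partial>lborel)" by (simp only: D)
qed

lemma SOd_mult: "A \<in> SOd \<Longrightarrow> B \<in> SOd \<Longrightarrow> A ** B \<in> SOd"
  by (simp add: SOd_def orthogonal_matrix_mul det_mul)

lemma SOd_transpose: "A \<in> SOd \<Longrightarrow> transpose A \<in> SOd"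
  by (simp add: SOd_def orthogonal_matrix_transpose det_transpose)

lemma borel_measurable_transpose [measurable]:
  "(transpose :: real^'n^'m \<Rightarrow> _) \<in> borel_measurable borel"
  by (rule borel_measurable_continuous_onI) (auto simp: transpose_def intro!: continuous_intros)

section \<open>Haar measure on the rotation group\<close>

context
  fixes \<mu> :: "(real^'n^'n) measure"
  assumes haar: "haar_SO \<mu>"
begin

lemma haar_space: "space \<mu> = SOd"
  using haar sets_eq_imp_space_eq[of \<mu> "restrict_space borel SOd"] by (simp add: haar_SO_def space_restrict_space)

lemma haar_prob: "prob_space \<mu>"
  using haar by (simp add: haar_SO_def)

lemma haar_borel [measurable]: "(\<lambda>A. A) \<in> borel_measurable \<mu>"
  using haar unfolding haar_SO_def
  by (subst measurable_cong_sets[of \<mu> "restrict_space borel SOd" borel borel]) (auto intro: measurable_restrict_space1)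

lemma haar_sets_borel: "X \<in> sets borel \<Longrightarrow> X \<inter> SOd \<in> sets \<mu>"
  using haar by (auto simp: haar_SO_def sets_restrict_space)

lemma haar_left_invariant:
  assumes R: "R \<in> SOd" and [measurable]: "k \<in> borel_measurable borel"
  shows "(\<integral>\<^sup>+A. k (R ** A) \<partial>\<mu>) = (\<integral>\<^sup>+A. k A \<partial>\<mu>)"
proof -
  have "distr \<mu> borel (\<lambda>A. R ** A) = distr \<mu> borel (\<lambda>A. A)"
  proof (rule measure_eqI)
    fix X assume "X \<in> sets (distr \<mu> borel (\<lambda>A. R ** A))"
    then have X: "X \<in> sets borel" by simp
    have "emeasure \<mu> ((\<lambda>A. R ** A) -` (X \<inter> SOd) \<inter> SOd) = emeasure \<mu> (X \<inter> SOd)"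
      using haar[unfolded haar_SO_def, THEN conjunct2, THEN conjunct2] R haar_sets_borel[OF X] by blast
    moreover have "(\<lambda>A. R ** A) -` (X \<inter> SOd) \<inter> SOd = (\<lambda>A. R ** A) -` X \<inter> SOd"
      using SOd_mult[OF R] by auto
    ultimately show "emeasure (distr \<mu> borel (\<lambda>A. R ** A)) X = emeasure (distr \<mu> borel (\<lambda>A. A)) X"
      using X by (simp add: emeasure_distr haar_space)
  qed simp
  then have "(\<integral>\<^sup>+A. k A \<partial>distr \<mu> borel (\<lambda>A. R ** A)) = (\<integral>\<^sup>+A. k A \<partial>distr \<mu> borel (\<lambda>A. A))" by simp
  then show ?thesis by (simp add: nn_integral_distr)
qed

text \<open>Integrate \<open>k (transpose B ** A)\<close> over both variables, in either order.\<close>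

lemma haar_transpose:
  assumes [measurable]: "k \<in> borel_measurable borel"
  shows "(\<integral>\<^sup>+A. k (transpose A) \<partial>\<mu>) = (\<integral>\<^sup>+A. k A \<partial>\<mu>)"
proof -
  interpret prob_space \<mu> by (rule haar_prob)
  interpret P: pair_sigma_finite \<mu> \<mu> ..
  have "(\<integral>\<^sup>+A. k A \<partial>\<mu>) = (\<integral>\<^sup>+B. \<integral>\<^sup>+A. k A \<partial>\<mu> \<partial>\<mu>)" by (simp add: emeasure_space_1)
  also have "\<dots> = (\<integral>\<^sup>+B. \<integral>\<^sup>+A. k (transpose B ** A) \<partial>\<mu> \<partial>\<mu>)"
    by (intro nn_integral_cong haar_left_invariant[symmetric]) (auto simp: haar_space SOd_transpose)
  also have "\<dots> = (\<integral>\<^sup>+A. \<integral>\<^sup>+B. k (transpose B ** A) \<partial>\<mu> \<partial>\<mu>)"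
    by (rule P.Fubini'[symmetric]) measurable
  also have "\<dots> = (\<integral>\<^sup>+A. \<integral>\<^sup>+B. k (transpose (transpose A ** B)) \<partial>\<mu> \<partial>\<mu>)"
    by (simp add: matrix_transpose_mul)
  also have "\<dots> = (\<integral>\<^sup>+A. \<integral>\<^sup>+B. k (transpose B) \<partial>\<mu> \<partial>\<mu>)"
    by (intro nn_integral_cong haar_left_invariant[where k = "\<lambda>B. k (transpose B)"])
       (auto simp: haar_space SOd_transpose)
  also have "\<dots> = (\<integral>\<^sup>+B. k (transpose B) \<partial>\<mu>)" by (simp add: emeasure_space_1)
  finally show ?thesis by simp
qed

text \<open>\<open>haar_SO\<close> demands left invariance; transposition, which is inversion on the
  group, exchanges the two sides.\<close>

lemma haar_right_invariant:
  assumes R: "R \<in> SOd" and [measurable]: "k \<in> borel_measurable borel"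
  shows "(\<integral>\<^sup>+A. k (A ** R) \<partial>\<mu>) = (\<integral>\<^sup>+A. k A \<partial>\<mu>)"
proof -
  have "(\<integral>\<^sup>+A. k (A ** R) \<partial>\<mu>) = (\<integral>\<^sup>+A. k (transpose A ** R) \<partial>\<mu>)"
    by (rule haar_transpose[symmetric]) measurable
  also have "\<dots> = (\<integral>\<^sup>+A. k (transpose (transpose R ** A)) \<partial>\<mu>)" by (simp add: matrix_transpose_mul)
  also have "\<dots> = (\<integral>\<^sup>+A. k (transpose A) \<partial>\<mu>)"
    by (rule haar_left_invariant[where k = "\<lambda>B. k (transpose B)"]) (auto simp: SOd_transpose R)
  also have "\<dots> = (\<integral>\<^sup>+A. k A \<partial>\<mu>)" by (rule haar_transpose) measurable
  finally show ?thesis .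
qed

text \<open>Some rotation carries one vector to the other, and it multiplies the integration
  variable from the right; this is why right invariance was established.\<close>

lemma haar_average_radial:
  fixes h :: "real^'n \<Rightarrow> ennreal"
  assumes card: "CARD('n) \<ge> 2" and [measurable]: "h \<in> borel_measurable borel" and norm: "norm \<xi> = norm \<eta>"
  shows "(\<integral>\<^sup>+A. h (A *v \<xi>) \<partial>\<mu>) = (\<integral>\<^sup>+A. h (A *v \<eta>) \<partial>\<mu>)"
proof -
  obtain f where f: "orthogonal_transformation f" "det (matrix f) = 1" "f \<eta> = \<xi>"
    using rotation_exists[OF card norm[symmetric]] .
  then have R: "matrix f \<in> SOd" "matrix f *v \<eta> = \<xi>"
    by (auto simp: SOd_def orthogonal_transformation_matrix matrix_works orthogonal_transformation_linear matrix_vector_mul)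
  have "(\<integral>\<^sup>+A. h ((A ** matrix f) *v \<eta>) \<partial>\<mu>) = (\<integral>\<^sup>+A. h (A *v \<eta>) \<partial>\<mu>)"
    by (rule haar_right_invariant[OF R(1)]) measurable
  then show ?thesis by (simp add: R(2) flip: matrix_vector_mul_assoc)
qed

end

text \<open>Polar coordinates for radial functions in the variable t = |x|^2. The law of t is fixed
  by the volumes of balls, which are a constant times t^(d/2), and its density is their
  derivative.\<close>

lemma nn_integral_norm_square:
  fixes g :: "real \<Rightarrow> ennreal"
  assumes d: "DIM('a::euclidean_space) \<ge> 2" and g: "g \<in> borel_measurable borel"
  defines "c \<equiv> unit_ball_vol DIM('a) * (DIM('a) / 2)"
  shows "(\<integral>\<^sup>+x. g ((norm x)\<^sup>2) \<partial>(lborel :: 'a measure))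
    = (\<integral>\<^sup>+t. ennreal (indicator {0..} t * (c * t powr (DIM('a) / 2 - 1))) * g t \<partial>lborel)"
proof -
  let ?d = "real DIM('a)"
  let ?w = "\<lambda>t::real. ennreal (indicator {0..} t * (c * t powr (?d / 2 - 1)))"
  have c: "c > 0" using d by (auto simp: c_def intro!: mult_pos_pos)
  have eq: "distr lborel borel (\<lambda>x::'a. (norm x)\<^sup>2) = density lborel ?w"
  proof (rule measure_eqI_generator_eq[where \<Omega> = UNIV and E = "range (\<lambda>a::real. {..a})" and A = "\<lambda>i::nat. {..real i}"])
    show "Int_stable (range (\<lambda>a::real. {..a}))" by (auto simp: Int_stable_def)
    show "sets (distr lborel borel (\<lambda>x::'a. (norm x)\<^sup>2)) = sigma_sets UNIV (range (\<lambda>a::real. {..a}))"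
      by (simp add: borel_eq_atMost)
    show "sets (density lborel ?w) = sigma_sets UNIV (range (\<lambda>a::real. {..a}))"
      by (simp add: borel_eq_atMost)
    show "(\<Union>i::nat. {..real i}) = UNIV" by (auto simp: real_arch_simple)
    have L: "emeasure (distr lborel borel (\<lambda>x::'a. (norm x)\<^sup>2)) {..a} = (if a < 0 then 0 else ennreal (unit_ball_vol ?d * sqrt a ^ DIM('a)))" for a
    proof -
      have "emeasure (distr lborel borel (\<lambda>x::'a. (norm x)\<^sup>2)) {..a} = emeasure lborel {x::'a. (norm x)\<^sup>2 \<le> a}"
        by (subst emeasure_distr) (auto simp: vimage_def)
      also have "{x::'a. (norm x)\<^sup>2 \<le> a} = (if a < 0 then {} else cball 0 (sqrt a))"
        by (auto simp: real_le_rsqrt) (smt (verit) zero_le_power2, metis norm_ge_zero power_mono real_sqrt_pow2 linorder_not_less)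
      finally show ?thesis by (auto simp: emeasure_cball)
    qed
    then show "emeasure (distr lborel borel (\<lambda>x::'a. (norm x)\<^sup>2)) {..real i} \<noteq> \<infinity>" for i by simp
    fix X assume "X \<in> range (\<lambda>a::real. {..a})"
    then obtain a :: real where X: "X = {..a}" by auto
    have "emeasure (density lborel ?w) {..a} = (\<integral>\<^sup>+t. ?w t * indicator {..a} t \<partial>lborel)"
      by (subst emeasure_density) auto
    also have "\<dots> = (if a < 0 then 0 else ennreal (unit_ball_vol ?d * sqrt a ^ DIM('a)))"
    proof (cases "a < 0")
      case True
      then have "?w t * indicator {..a} t = 0" for t by (auto simp: indicator_def)
      then have "(\<integral>\<^sup>+t. ?w t * indicator {..a} t \<partial>lborel) = (\<integral>\<^sup>+(t::real). 0 \<partial>lborel)"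
        by (intro nn_integral_cong)
      then show ?thesis using True by simp
    next
      case False
      let ?F = "\<lambda>t. unit_ball_vol ?d * t powr (?d / 2)"
      have "((\<lambda>t. c * t powr (?d / 2 - 1)) has_integral ?F a - ?F 0) {0..a}"
      \<comment> \<open>At the endpoint 0 continuity suffices in this form; the derivative of the
        power is taken only at positive points.\<close>
      proof (rule fundamental_theorem_of_calculus_interior)
        show "0 \<le> a" using False by simp
        show "continuous_on {0..a} ?F" using d by (intro continuous_on_mult continuous_on_powr' continuous_on_const continuous_on_id) auto
        fix t assume "t \<in> {0<..<a}"
        then have "(?F has_real_derivative c * t powr (?d / 2 - 1)) (at t)"
          by (auto simp: c_def intro!: derivative_eq_intros)
        then show "(?F has_vector_derivative c * t powr (?d / 2 - 1)) (at t)"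
          by (simp add: has_real_derivative_iff_has_vector_derivative)
      qed
      moreover have "?F a - ?F 0 = unit_ball_vol ?d * sqrt a ^ DIM('a)"
      proof -
        have "a powr (?d / 2) = sqrt a ^ DIM('a)"
        proof (cases "a = 0")
          case False
          then have "a > 0" using \<open>\<not> a < 0\<close> by simp
          then show ?thesis by (simp add: powr_half_sqrt[symmetric] powr_powr flip: powr_realpow)
        qed simp
        then show ?thesis by simp
      qed
      ultimately have "((\<lambda>t. c * t powr (?d / 2 - 1)) has_integral unit_ball_vol ?d * sqrt a ^ DIM('a)) {0..a}" by (simp only:)
      from nn_integral_has_integral_lebesgue[OF _ this] c
      have "(\<integral>\<^sup>+t. ennreal (indicator {0..a} t * (c * t powr (?d / 2 - 1))) \<partial>lborel) = ennreal (unit_ball_vol ?d * sqrt a ^ DIM('a))"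
        by simp
      moreover have "?w t * indicator {..a} t = ennreal (indicator {0..a} t * (c * t powr (?d / 2 - 1)))" for t
        by (auto simp: indicator_def)
      ultimately show ?thesis using False by simp
    qed
    finally show "emeasure (distr lborel borel (\<lambda>x::'a. (norm x)\<^sup>2)) X = emeasure (density lborel ?w) X"
      unfolding X L by simp
  qed auto
  have "(\<integral>\<^sup>+x. g ((norm x)\<^sup>2) \<partial>(lborel :: 'a measure)) = (\<integral>\<^sup>+t. g t \<partial>distr lborel borel (\<lambda>x::'a. (norm x)\<^sup>2))"
    using g by (simp add: nn_integral_distr)
  also have "\<dots> = (\<integral>\<^sup>+t. ?w t * g t \<partial>lborel)"
    unfolding eq using g by (subst nn_integral_density) auto
  finally show ?thesis .
qed

section \<open>Periodizations\<close>

text \<open>Half-open, so that its lattice translates tile space exactly; it differs from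
  \<open>unit_cube\<close> by a null set.\<close>

definition cube :: "(real^'n) set" where
  "cube = {x. \<forall>i. 0 \<le> x $ i \<and> x $ i < 1}"

lemma cube_borel [measurable]: "(cube :: (real^'n) set) \<in> sets borel"
  unfolding cube_def by measurable

lemma ex1_lattice_translate:
  "\<exists>!\<nu>. \<nu> \<in> int_lattice \<and> x + \<nu> \<in> (cube :: (real^'n) set)"
proof (rule ex1I)
  let ?n = "(\<chi> i. - of_int \<lfloor>x $ i\<rfloor>) :: real^'n"
  have "x $ i - of_int \<lfloor>x $ i\<rfloor> < 1" for i by linarith
  then show "?n \<in> int_lattice \<and> x + ?n \<in> cube" by (auto simp: int_lattice_def cube_def)
  fix \<nu> :: "real^'n" assume \<nu>: "\<nu> \<in> int_lattice \<and> x + \<nu> \<in> cube"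
  have "\<nu> $ i = - of_int \<lfloor>x $ i\<rfloor>" for i
  proof -
    obtain k where k: "\<nu> $ i = of_int k" using \<nu> by (auto simp: int_lattice_def elim: Ints_cases)
    have "0 \<le> x $ i + of_int k" "x $ i + of_int k < 1" using \<nu> by (auto simp: cube_def simp flip: k)
    then have "\<lfloor>x $ i\<rfloor> = - k" by linarith
    then show ?thesis by (simp add: k)
  qed
  then show "\<nu> = ?n" by (simp add: vec_eq_iff)
qed

lemma countable_int_lattice: "countable (int_lattice :: (real^'n) set)"
proof (rule countable_subset)
  show "int_lattice \<subseteq> (\<lambda>k. \<chi> i. real_of_int (k i)) ` (PiE (UNIV :: 'n set) (\<lambda>_. UNIV))"
  proof
    fix v :: "real^'n" assume "v \<in> int_lattice"
    then have v: "v $ i \<in> \<int>" for i by (auto simp: int_lattice_def)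
    define k where "k i = \<lfloor>v $ i\<rfloor>" for i
    have "v = (\<chi> i. real_of_int (k i))" using v by (simp add: vec_eq_iff k_def)
    moreover have "k \<in> PiE UNIV (\<lambda>_. UNIV)" by simp
    ultimately show "v \<in> (\<lambda>k. \<chi> i. real_of_int (k i)) ` (PiE (UNIV :: 'n set) (\<lambda>_. UNIV))" by blast
  qed
qed (intro countable_image countable_PiE, auto)

lemma infinite_int_lattice: "infinite (int_lattice :: (real^'n) set)"
proof
  assume "finite (int_lattice :: (real^'n) set)"
  moreover have "range (\<lambda>k::int. (\<chi> i. of_int k) :: real^'n) \<subseteq> int_lattice" by (auto simp: int_lattice_def)
  moreover have "inj (\<lambda>k::int. (\<chi> i. of_int k) :: real^'n)" by (auto simp: inj_on_def vec_eq_iff)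
  ultimately show False by (meson finite_imageD finite_subset infinite_UNIV_int)
qed

text \<open>Enumerating the lattice turns the unordered sum into an ordinary series, to which the
  theorems on termwise integration apply.\<close>

abbreviation lattice_enum :: "nat \<Rightarrow> real^'n" where
  "lattice_enum \<equiv> from_nat_into int_lattice"

lemma bij_lattice_enum: "bij_betw (lattice_enum :: nat \<Rightarrow> real^'n) UNIV int_lattice"
  by (rule bij_betw_from_nat_into[OF countable_int_lattice infinite_int_lattice])

lemma lattice_enum_mem: "lattice_enum n \<in> (int_lattice :: (real^'n) set)"
  using bij_betw_imp_surj_on[OF bij_lattice_enum] by (metis rangeI)

text \<open>The tiling as a partition of unity: exactly one term is nonzero.\<close>

lemma sums_indicator_cube:
  fixes c :: "'b::real_normed_vector" and x :: "real^'n"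
  shows "(\<lambda>n. indicator cube (x + lattice_enum n) *\<^sub>R c) sums c"
proof -
  obtain \<nu> where \<nu>: "\<nu> \<in> int_lattice" "x + \<nu> \<in> cube" "\<And>\<nu>'. \<nu>' \<in> int_lattice \<Longrightarrow> x + \<nu>' \<in> cube \<Longrightarrow> \<nu>' = \<nu>"
    using ex1_lattice_translate[of x] by (elim ex1E conjE) metis
  have "\<nu> \<in> range lattice_enum" using \<nu>(1) unfolding bij_betw_imp_surj_on[OF bij_lattice_enum] .
  then obtain m where m: "\<nu> = lattice_enum m" by (rule rangeE)
  have uniq: "n = m" if "x + lattice_enum n \<in> cube" for n
  proof -
    have "lattice_enum n = (lattice_enum m :: real^'n)" using \<nu>(3)[OF lattice_enum_mem that] m by simp
    from injD[OF bij_betw_imp_inj_on[OF bij_lattice_enum] this] show ?thesis .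
  qed
  have mem: "x + lattice_enum m \<in> cube" using \<nu>(2) unfolding m .
  have "(\<lambda>n. indicator cube (x + lattice_enum n) *\<^sub>R c) = (\<lambda>n. if n = m then c else 0)"
  proof
    fix n show "indicator cube (x + lattice_enum n) *\<^sub>R c = (if n = m then c else 0)"
      using uniq[of n] mem by (cases "n = m") (auto simp: indicator_def)
  qed
  then show ?thesis using sums_single[of m "\<lambda>_. c"] by simp
qed

lemma lborel_translate:
  fixes h :: "'a::euclidean_space \<Rightarrow> 'b::{banach, second_countable_topology}"
  shows "integrable lborel h \<Longrightarrow> integrable lborel (\<lambda>x. h (x - t))"
    and "h \<in> borel_measurable borel \<Longrightarrow> (\<integral>x. h (x - t) \<partial>lborel) = (\<integral>x. h x \<partial>lborel)"
proof -
  show "integrable lborel (\<lambda>x. h (x - t))" if h: "integrable lborel h"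
  proof -
    have "h \<in> borel_measurable borel" using h borel_measurable_integrable by fastforce
    moreover have "integrable (distr lborel borel ((+) (- t))) h"
      using h by (simp only: lborel_distr_plus)
    ultimately show ?thesis by (subst (asm) integrable_distr_eq) auto
  qed
  assume "h \<in> borel_measurable borel"
  then have "(\<integral>x. h x \<partial>distr lborel borel ((+) (- t))) = (\<integral>x. h (x - t) \<partial>lborel)"
    by (subst integral_distr) auto
  then show "(\<integral>x. h (x - t) \<partial>lborel) = (\<integral>x. h x \<partial>lborel)" by (simp only: lborel_distr_plus)
qed

abbreviation cube_measure :: "(real^'n) measure" where
  "cube_measure \<equiv> restrict_space lborel cube"

text \<open>The integral of a translate over the cube is the integral of \<open>h\<close> over one
  tile, and the tiles add up to the whole space. Applied to norms this gives absolute convergence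
  almost everywhere, which then permits termwise integration.\<close>

lemma unfolding_lattice_sum:
  fixes h :: "real^'n \<Rightarrow> 'b::{banach, second_countable_topology}"
  assumes h: "integrable lborel h"
  shows "AE x in cube_measure. summable (\<lambda>n. norm (h (x - lattice_enum n)))"
    and "integrable cube_measure (\<lambda>x. \<Sum>n. h (x - lattice_enum n))"
    and "(\<integral>x. (\<Sum>n. h (x - lattice_enum n)) \<partial>cube_measure) = (\<integral>x. h x \<partial>lborel)"
proof -
  have hm [measurable]: "h \<in> borel_measurable borel" using h borel_measurable_integrable by fastforce
  have move: "(\<integral>x. k (x - lattice_enum n) \<partial>cube_measure) = (\<integral>x. indicator cube (x + lattice_enum n) *\<^sub>R k x \<partial>lborel)"
    if [measurable]: "k \<in> borel_measurable borel" for k :: "real^'n \<Rightarrow> 'c::{banach, second_countable_topology}" and n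
    using lborel_translate(2)[of "\<lambda>x. indicator cube (x + lattice_enum n) *\<^sub>R k x" "lattice_enum n"]
    by (simp add: integral_restrict_space)
  have int1: "integrable lborel (\<lambda>x. indicator cube (x + lattice_enum n) *\<^sub>R k x)"
    if "integrable lborel k" for k :: "real^'n \<Rightarrow> 'c::{banach, second_countable_topology}" and n
  proof -
    have [measurable]: "k \<in> borel_measurable borel" using that borel_measurable_integrable by fastforce
    show ?thesis by (rule Bochner_Integration.integrable_bound[OF that]) (auto simp: indicator_def)
  qed
  have nsums: "(\<lambda>n. \<integral>x. norm (indicator cube (x + lattice_enum n) *\<^sub>R h x) \<partial>lborel) sums (\<integral>x. norm (h x) \<partial>lborel)"
    and hsums: "(\<lambda>n. \<integral>x. indicator cube (x + lattice_enum n) *\<^sub>R h x \<partial>lborel) sums (\<integral>x. h x \<partial>lborel)"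
  proof -
    have sm: "summable (\<lambda>n. \<integral>x. norm (indicator cube (x + lattice_enum n) *\<^sub>R h x) \<partial>lborel)"
    proof (rule summableI_nonneg_bounded)
      fix n
      show "0 \<le> (\<integral>x. norm (indicator cube (x + lattice_enum n) *\<^sub>R h x) \<partial>lborel)" by simp
      have "(\<Sum>i<n. \<integral>x. norm (indicator cube (x + lattice_enum i) *\<^sub>R h x) \<partial>lborel)
         = (\<integral>x. (\<Sum>i<n. indicator cube (x + lattice_enum i) *\<^sub>R norm (h x)) \<partial>lborel)"
        using int1[OF integrable_norm[OF h]] by (subst Bochner_Integration.integral_sum) auto
      also have "\<dots> \<le> (\<integral>x. norm (h x) \<partial>lborel)"
      proof (rule integral_mono)
        show "integrable lborel (\<lambda>x. \<Sum>i<n. indicator cube (x + lattice_enum i) *\<^sub>R norm (h x))"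
          by (intro Bochner_Integration.integrable_sum int1 integrable_norm h)
        show "(\<Sum>i<n. indicator cube (x + lattice_enum i) *\<^sub>R norm (h x)) \<le> norm (h x)" for x
          using sums_indicator_cube[of x "norm (h x)"] sum_le_suminf[of "\<lambda>n. indicator cube (x + lattice_enum n) *\<^sub>R norm (h x)" "{..<n}"]
          by (auto simp: sums_iff)
      qed (use h in simp)
      finally show "(\<Sum>i<n. \<integral>x. norm (indicator cube (x + lattice_enum i) *\<^sub>R h x) \<partial>lborel) \<le> (\<integral>x. norm (h x) \<partial>lborel)" .
    qed
    have nrm: "norm (indicator cube (x + lattice_enum n) *\<^sub>R h x) = indicator cube (x + lattice_enum n) *\<^sub>R norm (h x)" for x n
      by simp
    have sn: "summable (\<lambda>n. norm (indicator cube (x + lattice_enum n) *\<^sub>R h x))" for x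
      unfolding nrm using sums_indicator_cube[of x "norm (h x)"] by (rule sums_summable)
    have "(\<lambda>n. integral\<^sup>L lborel (\<lambda>x. norm (indicator cube (x + lattice_enum n) *\<^sub>R h x))) sums (\<integral>x. (\<Sum>n. norm (indicator cube (x + lattice_enum n) *\<^sub>R h x)) \<partial>lborel)"
      by (rule sums_integral) (use int1[OF integrable_norm[OF h]] sn sm in auto)
    moreover have "(\<Sum>n. norm (indicator cube (x + lattice_enum n) *\<^sub>R h x)) = norm (h x)" for x
      unfolding nrm using sums_indicator_cube[of x "norm (h x)"] by (rule sums_unique[symmetric])
    ultimately show "(\<lambda>n. \<integral>x. norm (indicator cube (x + lattice_enum n) *\<^sub>R h x) \<partial>lborel) sums (\<integral>x. norm (h x) \<partial>lborel)"
      by (simp only:)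
    have "(\<lambda>n. integral\<^sup>L lborel (\<lambda>x. indicator cube (x + lattice_enum n) *\<^sub>R h x)) sums (\<integral>x. (\<Sum>n. indicator cube (x + lattice_enum n) *\<^sub>R h x) \<partial>lborel)"
      by (rule sums_integral) (use int1[OF h] sn sm in auto)
    moreover have "(\<Sum>n. indicator cube (x + lattice_enum n) *\<^sub>R h x) = h x" for x
      using sums_indicator_cube[of x "h x"] by (rule sums_unique[symmetric])
    ultimately show "(\<lambda>n. \<integral>x. indicator cube (x + lattice_enum n) *\<^sub>R h x \<partial>lborel) sums (\<integral>x. h x \<partial>lborel)"
      by (simp only:)
  qed
  have iQ: "integrable cube_measure (\<lambda>x. k (x - lattice_enum n))" if "integrable lborel k" for k :: "real^'n \<Rightarrow> 'b" and n
  proof -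
    have "integrable lborel (\<lambda>x. k (x - lattice_enum n))" using that by (rule lborel_translate)
    then show ?thesis
      by (subst integrable_restrict_space) (auto intro!: integrable_mult_indicator)
  qed
  have sQ: "summable (\<lambda>n. \<integral>x. norm (h (x - lattice_enum n)) \<partial>cube_measure)"
    using sums_summable[OF nsums] move[of "\<lambda>x. norm (h x)"] by simp
  have "(\<integral>\<^sup>+x. (\<Sum>n. ennreal (norm (h (x - lattice_enum n)))) \<partial>cube_measure)
     = (\<Sum>n. \<integral>\<^sup>+x. ennreal (norm (h (x - lattice_enum n))) \<partial>cube_measure)"
    by (rule nn_integral_suminf) (auto intro: measurable_restrict_space1)
  also have "\<dots> = (\<Sum>n. ennreal (\<integral>x. norm (h (x - lattice_enum n)) \<partial>cube_measure))"
    using iQ[OF h] by (intro suminf_cong nn_integral_eq_integral integrable_norm) auto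
  also have "\<dots> = ennreal (\<Sum>n. \<integral>x. norm (h (x - lattice_enum n)) \<partial>cube_measure)"
    using sQ by (intro suminf_ennreal2) auto
  finally have "(\<integral>\<^sup>+x. (\<Sum>n. ennreal (norm (h (x - lattice_enum n)))) \<partial>cube_measure) \<noteq> \<infinity>" by simp
  then have "AE x in cube_measure. (\<Sum>n. ennreal (norm (h (x - lattice_enum n)))) \<noteq> \<infinity>"
    by (intro nn_integral_PInf_AE) (auto intro!: borel_measurable_suminf measurable_restrict_space1)
  then show ae: "AE x in cube_measure. summable (\<lambda>n. norm (h (x - lattice_enum n)))"
    by eventually_elim (rule summable_suminf_not_top, auto)
  show "integrable cube_measure (\<lambda>x. \<Sum>n. h (x - lattice_enum n))"
    by (rule integrable_suminf[OF iQ[OF h] ae sQ])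
  have "(\<lambda>n. \<integral>x. h (x - lattice_enum n) \<partial>cube_measure) sums (\<integral>x. (\<Sum>n. h (x - lattice_enum n)) \<partial>cube_measure)"
    by (rule sums_integral[OF iQ[OF h] ae sQ])
  moreover have "(\<lambda>n. \<integral>x. h (x - lattice_enum n) \<partial>cube_measure) sums (\<integral>x. h x \<partial>lborel)"
    using hsums move[of h] by simp
  ultimately show "(\<integral>x. (\<Sum>n. h (x - lattice_enum n)) \<partial>cube_measure) = (\<integral>x. h x \<partial>lborel)"
    by (rule sums_unique2)
qed

section \<open>Fourier coefficients on the cube and Bessel's inequality\<close>

lemma has_bochner_integral_cis_01:
  "has_bochner_integral lborel (\<lambda>t. indicator {0..1} t *\<^sub>R cis (2 * pi * (of_int k * t))) (if k = 0 then 1 else 0)"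
proof (cases "k = 0")
  case True
  have "has_bochner_integral lborel (\<lambda>t::real. complex_of_real (indicator {0..1} t)) (complex_of_real 1)"
    using has_bochner_integral_real_indicator[of "{0..1::real}" lborel] by (intro has_bochner_integral_of_real) simp
  then show ?thesis using True by (simp add: scaleR_conv_of_real)
next
  case False
  let ?w = "2 * pi * of_int k"
  have w: "?w \<noteq> 0" using False by simp
  have "has_bochner_integral lborel (\<lambda>t. cos (?w * t) * indicator {0..1} t) (sin (?w * 1) / ?w - sin (?w * 0) / ?w)"
    by (rule has_bochner_integral_FTC_Icc_real) (use w in \<open>auto intro!: derivative_eq_intros continuous_intros\<close>)
  moreover have "sin (?w * 1) = 0" using sin_npi_int[of "2 * k"] by (simp add: mult_ac)
  ultimately have c: "has_bochner_integral lborel (\<lambda>t. cos (?w * t) * indicator {0..1} t) 0" by simp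
  have "has_bochner_integral lborel (\<lambda>t. sin (?w * t) * indicator {0..1} t) ((- cos (?w * 1) / ?w) - (- cos (?w * 0) / ?w))"
    by (rule has_bochner_integral_FTC_Icc_real) (use w in \<open>auto intro!: derivative_eq_intros continuous_intros\<close>)
  moreover have "cos (?w * 1) = 1" using cos_int_2pin[of k] by (simp add: mult_ac)
  ultimately have s: "has_bochner_integral lborel (\<lambda>t. sin (?w * t) * indicator {0..1} t) 0" by simp
  have "has_bochner_integral lborel (\<lambda>t. complex_of_real (cos (?w * t) * indicator {0..1} t)
      + \<i> * complex_of_real (sin (?w * t) * indicator {0..1} t)) (complex_of_real 0 + \<i> * complex_of_real 0)"
    by (intro has_bochner_integral_add has_bochner_integral_mult_right has_bochner_integral_of_real c s)
  moreover have "complex_of_real (cos (?w * t) * indicator {0..1} t) + \<i> * complex_of_real (sin (?w * t) * indicator {0..1} t)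
      = indicator {0..1} t *\<^sub>R cis (2 * pi * (of_int k * t))" for t
    by (simp add: complex_eq_iff mult_ac)
  ultimately show ?thesis using False by simp
qed

lemma AE_cube_iff: "AE x in lborel. x \<in> cube \<longleftrightarrow> (x::real^'n) \<in> unit_cube"
proof -
  have "negligible (cbox 0 1 - box 0 (1::real^'n))" by (rule negligible_frontier_interval)
  then have "AE x in lebesgue. x \<notin> cbox 0 1 - box 0 (1::real^'n)"
    by (intro AE_not_in) (simp add: negligible_iff_null_sets)
  then have "AE x in lborel. x \<notin> cbox 0 1 - box 0 (1::real^'n)" by (simp add: AE_completion_iff)
  then show ?thesis
    by eventually_elim (auto simp: cube_def unit_cube_def mem_box_cart less_imp_le)
qed

lemma has_bochner_integral_cis_cube:
  assumes m: "m \<in> (int_lattice :: (real^'n) set)"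
  shows "has_bochner_integral cube_measure (\<lambda>x. cis (2 * pi * (x \<bullet> m))) (if m = 0 then 1 else 0)"
proof -
  have mb: "m \<bullet> b \<in> \<int>" if "b \<in> Basis" for b
    using that m by (auto simp: Basis_vec_def inner_axis int_lattice_def)
  define k where "k b = \<lfloor>m \<bullet> b\<rfloor>" for b
  have k: "real_of_int (k b) = m \<bullet> b" if "b \<in> Basis" for b
    using mb[OF that] by (simp add: k_def)
  let ?g = "\<lambda>b t. indicator {0..1} t *\<^sub>R cis (2 * pi * (of_int (k b) * t)) :: complex"
  have "has_bochner_integral lborel (\<lambda>x::real^'n. \<Prod>b\<in>Basis. ?g b (x \<bullet> b)) (\<Prod>b\<in>(Basis :: (real^'n) set). if k b = 0 then 1 else 0)"
    using has_bochner_integral_prod_lborel[of ?g] has_bochner_integral_cis_01 by (auto simp: has_bochner_integral_iff)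
  moreover have "(\<Prod>b\<in>(Basis :: (real^'n) set). if k b = 0 then 1 else 0) = (if m = 0 then 1 else (0::complex))"
  proof (cases "m = 0")
    case False
    then obtain b where "b \<in> Basis" "m \<bullet> b \<noteq> 0" using euclidean_all_zero_iff[of m] by auto
    then have "k b \<noteq> 0" using k[of b] by auto
    then show ?thesis using False \<open>b \<in> Basis\<close> by (auto intro!: prod_zero)
  qed (simp add: k_def)
  moreover have "AE x in lborel. (\<Prod>b\<in>Basis. ?g b (x \<bullet> b)) = indicator cube x *\<^sub>R cis (2 * pi * (x \<bullet> m))"
    using AE_cube_iff
  proof eventually_elim
    case (elim x)
    have "(\<Prod>b\<in>Basis. ?g b (x \<bullet> b)) = complex_of_real (\<Prod>b\<in>Basis. indicator {0..1} (x \<bullet> b)) * (\<Prod>b\<in>Basis. cis (2 * pi * ((m \<bullet> b) * (x \<bullet> b))))"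
      using k by (simp add: scaleR_conv_of_real prod.distrib)
    also have "(\<Prod>b\<in>Basis. cis (2 * pi * ((m \<bullet> b) * (x \<bullet> b)))) = cis (2 * pi * (x \<bullet> m))"
      by (simp add: euclidean_inner[of x m] cis_conv_exp sum_distrib_left exp_sum mult_ac)
    also have "(\<Prod>b\<in>Basis. indicator {0..1} (x \<bullet> b)) = (indicator cube x :: real)"
    proof (cases "x \<in> cube")
      case True
      then have "\<forall>b\<in>Basis. x \<bullet> b \<in> {0..1}"
        by (auto simp: cube_def Basis_vec_def inner_axis less_imp_le)
      then show ?thesis using True by simp
    next
      case False
      then obtain i where "x $ i \<notin> {0..1}" using elim by (auto simp: unit_cube_def mem_box_cart)
      then have "x \<bullet> axis i 1 \<notin> {0..1}" by (simp add: inner_axis)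
      then show ?thesis using False axis_in_Basis_iff[of i "1::real"]
        by (auto intro!: prod_zero bexI[of _ "axis i 1"])
    qed
    finally show ?case by (simp add: scaleR_conv_of_real)
  qed
  ultimately have "has_bochner_integral lborel (\<lambda>x. indicator cube x *\<^sub>R cis (2 * pi * (x \<bullet> m))) (if m = 0 then 1 else 0)"
    by (subst (asm) has_bochner_integral_cong_AE) auto
  then show ?thesis
    by (simp add: has_bochner_integral_iff integrable_restrict_space integral_restrict_space)
qed

text \<open>Integrability of \<open>S\<close> is enough to define the coefficients. If the squared
  norm is infinite the bound is trivial; otherwise it is the nonnegativity of the squared distance
  from \<open>S\<close> to its Fourier polynomial \<open>P\<close>.\<close>

lemma bessel_cube:
  fixes S :: "real^'n \<Rightarrow> complex"
  assumes S: "integrable cube_measure S" and F: "finite F" "F \<subseteq> int_lattice"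
  shows "ennreal (\<Sum>m\<in>F. (cmod (\<integral>x. S x * cis (- (2 * pi * (x \<bullet> m))) \<partial>cube_measure))\<^sup>2)
    \<le> (\<integral>\<^sup>+x. ennreal ((cmod (S x))\<^sup>2) \<partial>cube_measure)"
proof (cases "(\<integral>\<^sup>+x. ennreal ((cmod (S x))\<^sup>2) \<partial>cube_measure) < \<infinity>")
  case True
  have [measurable]: "S \<in> borel_measurable cube_measure" using S by (rule borel_measurable_integrable)
  have cism: "(\<lambda>x. cis (g x)) \<in> borel_measurable cube_measure" if "g \<in> borel_measurable borel" for g :: "real^'n \<Rightarrow> real"
    using that by (intro measurable_restrict_space1) auto
  have S2: "integrable cube_measure (\<lambda>x. (cmod (S x))\<^sup>2)"
    by (rule integrableI_bounded) (use True in auto)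
  define c where "c m = (\<integral>x. S x * cis (- (2 * pi * (x \<bullet> m))) \<partial>cube_measure)" for m
  define P where "P x = (\<Sum>m\<in>F. c m * cis (2 * pi * (x \<bullet> m)))" for x
  define E where "E = (\<Sum>m\<in>F. (cmod (c m))\<^sup>2)"
  have cnjP: "cnj (P x) = (\<Sum>m\<in>F. cnj (c m) * cis (- (2 * pi * (x \<bullet> m))))" for x
    by (simp add: P_def cis_cnj)
  have SP: "has_bochner_integral cube_measure (\<lambda>x. S x * cnj (P x)) (complex_of_real E)"
  proof -
    have "has_bochner_integral cube_measure (\<lambda>x. \<Sum>m\<in>F. cnj (c m) * (S x * cis (- (2 * pi * (x \<bullet> m))))) (\<Sum>m\<in>F. cnj (c m) * c m)"
    proof (intro has_bochner_integral_sum has_bochner_integral_mult_right)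
      show "has_bochner_integral cube_measure (\<lambda>x. S x * cis (- (2 * pi * (x \<bullet> m)))) (c m)" for m
        unfolding has_bochner_integral_iff c_def using S by (intro conjI integrable_mult_cis measurable_restrict_space1) auto
    qed
    moreover have "(\<Sum>m\<in>F. cnj (c m) * c m) = complex_of_real E"
      unfolding E_def of_real_sum complex_norm_square by (simp only: mult.commute)
    moreover have "(\<Sum>m\<in>F. cnj (c m) * (S x * cis (- (2 * pi * (x \<bullet> m))))) = S x * cnj (P x)" for x
      unfolding cnjP sum_distrib_left by (simp only: mult_ac)
    ultimately show ?thesis by simp
  qed
  have PP: "has_bochner_integral cube_measure (\<lambda>x. P x * cnj (P x)) (complex_of_real E)"
  proof -
    have lat: "m - m' \<in> int_lattice" if "m \<in> F" "m' \<in> F" for m m'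
      using subsetD[OF F(2) that(1)] subsetD[OF F(2) that(2)] by (auto simp: int_lattice_def)
    have "has_bochner_integral cube_measure (\<lambda>x. \<Sum>m\<in>F. \<Sum>m'\<in>F. (c m * cnj (c m')) * cis (2 * pi * (x \<bullet> (m - m'))))
        (\<Sum>m\<in>F. \<Sum>m'\<in>F. (c m * cnj (c m')) * (if m - m' = 0 then 1 else 0))"
      by (intro has_bochner_integral_sum has_bochner_integral_mult_right has_bochner_integral_cis_cube lat)
    moreover have "(\<Sum>m\<in>F. \<Sum>m'\<in>F. (c m * cnj (c m')) * (if m - m' = 0 then 1 else 0)) = complex_of_real E"
      unfolding E_def of_real_sum complex_norm_square
      using F by (intro sum.cong refl) (simp add: if_distrib cong: if_cong)
    moreover have "(\<Sum>m\<in>F. \<Sum>m'\<in>F. (c m * cnj (c m')) * cis (2 * pi * (x \<bullet> (m - m')))) = P x * cnj (P x)" for x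
    proof -
      have ci: "cis (2 * pi * (x \<bullet> (m - m'))) = cis (2 * pi * (x \<bullet> m)) * cis (- (2 * pi * (x \<bullet> m')))" for m m'
        by (simp add: cis_mult inner_diff algebra_simps)
      show ?thesis unfolding cnjP unfolding P_def sum_product
        by (intro sum.cong refl) (simp only: ci, simp only: mult_ac)
    qed
    ultimately show ?thesis by simp
  qed
  have eq: "(cmod (S x - P x))\<^sup>2 = (cmod (S x))\<^sup>2 - 2 * Re (S x * cnj (P x)) + Re (P x * cnj (P x))" for x
    unfolding cmod_power2 by (simp add: power2_eq_square algebra_simps)
  have R1: "has_bochner_integral cube_measure (\<lambda>x. Re (S x * cnj (P x))) E"
    using has_bochner_integral_Re[OF SP] by simp
  have R2: "has_bochner_integral cube_measure (\<lambda>x. Re (P x * cnj (P x))) E"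
    using has_bochner_integral_Re[OF PP] by simp
  have "has_bochner_integral cube_measure (\<lambda>x. (cmod (S x - P x))\<^sup>2) ((\<integral>x. (cmod (S x))\<^sup>2 \<partial>cube_measure) - 2 * E + E)"
    unfolding eq by (intro has_bochner_integral_add has_bochner_integral_diff has_bochner_integral_mult_right R1 R2
        has_bochner_integral_integrable S2)
  from has_bochner_integral_integral_eq[OF this, symmetric]
  have "(\<integral>x. (cmod (S x))\<^sup>2 \<partial>cube_measure) - 2 * E + E \<ge> 0" by (simp only: integral_nonneg_AE AE_I2 zero_le_power2 zero_le_power norm_ge_zero)
  then have "E \<le> (\<integral>x. (cmod (S x))\<^sup>2 \<partial>cube_measure)" by simp
  then have "ennreal E \<le> (\<integral>\<^sup>+x. ennreal ((cmod (S x))\<^sup>2) \<partial>cube_measure)"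
    using S2 by (simp add: nn_integral_eq_integral ennreal_leI)
  then show ?thesis by (simp add: E_def c_def)
qed (auto simp: top_unique not_less)

text \<open>Characters with integer frequencies are constant along lattice translates, so unfolding
  turns a coefficient of the periodization into the transform of f composed with
  \<open>\<rho>\<close>; since \<open>\<rho>\<close> is an isometry, this is
  \<open>fourier f\<close> at the rotated lattice point.\<close>

lemma sum_fourier_le_periodization:
  fixes f :: "real^'n \<Rightarrow> complex"
  assumes f: "integrable lborel f" and \<rho>: "\<rho> \<in> SOd" and F: "finite F" "F \<subseteq> int_lattice"
  shows "ennreal (\<Sum>m\<in>F. (cmod (fourier f (\<rho> *v m)))\<^sup>2)
    \<le> (\<integral>\<^sup>+x\<in>unit_cube. ennreal ((cmod (periodization f \<rho> x))\<^sup>2) \<partial>lborel)"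
proof -
  define g where "g x = f (\<rho> *v x)" for x
  have g: "integrable lborel g" unfolding g_def using \<rho> f by (rule integral_SOd_rotate)
  define S where "S x = (\<Sum>n. g (x - lattice_enum n))" for x
  have S: "integrable cube_measure S" unfolding S_def[abs_def] by (rule unfolding_lattice_sum(2)[OF g])
  have coef: "(\<integral>x. S x * cis (- (2 * pi * (x \<bullet> m))) \<partial>cube_measure) = fourier f (\<rho> *v m)" if m: "m \<in> int_lattice" for m
  proof -
    let ?h = "\<lambda>x. g x * cis (- (2 * pi * (x \<bullet> m)))"
    have per: "cis (- (2 * pi * ((x - lattice_enum n) \<bullet> m))) = cis (- (2 * pi * (x \<bullet> m)))" for x n
    proof -
      have "lattice_enum n \<bullet> m \<in> \<int>"
        using m lattice_enum_mem[of n] unfolding inner_vec_def by (auto simp: int_lattice_def intro!: Ints_sum Ints_mult)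
      then have "cis (2 * pi * (lattice_enum n \<bullet> m)) = 1" by (rule cis_multiple_2pi)
      moreover have "cis (- (2 * pi * ((x - lattice_enum n) \<bullet> m))) = cis (- (2 * pi * (x \<bullet> m))) * cis (2 * pi * (lattice_enum n \<bullet> m))"
        by (simp add: cis_mult inner_diff algebra_simps)
      ultimately show ?thesis by simp
    qed
    have "AE x in cube_measure. S x * cis (- (2 * pi * (x \<bullet> m))) = (\<Sum>n. ?h (x - lattice_enum n))"
      using unfolding_lattice_sum(1)[OF g]
    proof eventually_elim
      case (elim x)
      from summable_norm_cancel[OF this] have "summable (\<lambda>n. g (x - lattice_enum n))" .
      then show ?case unfolding S_def per by (rule suminf_mult2)
    qed
    then have "(\<integral>x. S x * cis (- (2 * pi * (x \<bullet> m))) \<partial>cube_measure) = (\<integral>x. (\<Sum>n. ?h (x - lattice_enum n)) \<partial>cube_measure)"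
    proof (intro integral_cong_AE borel_measurable_integrable)
      show "integrable cube_measure (\<lambda>x. S x * cis (- (2 * pi * (x \<bullet> m))))"
        by (rule integrable_mult_cis[OF S]) (auto intro!: measurable_restrict_space1)
      show "integrable cube_measure (\<lambda>x. \<Sum>n. ?h (x - lattice_enum n))"
        by (rule unfolding_lattice_sum(2)[OF integrable_fourier[OF g]])
    qed
    also have "\<dots> = (\<integral>x. ?h x \<partial>lborel)" by (rule unfolding_lattice_sum(3)[OF integrable_fourier[OF g]])
    also have "\<dots> = (\<integral>x. f (\<rho> *v x) * cis (- (2 * pi * ((\<rho> *v x) \<bullet> (\<rho> *v m)))) \<partial>lborel)"
      using orthogonal_transformation_SOd[OF \<rho>] by (simp add: g_def orthogonal_transformation_def)
    also have "\<dots> = fourier f (\<rho> *v m)"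
      unfolding fourier_def by (rule integral_SOd_rotate(2)[OF \<rho> integrable_fourier[OF f]])
    finally show ?thesis .
  qed
  have "(\<Sum>m\<in>F. (cmod (fourier f (\<rho> *v m)))\<^sup>2) = (\<Sum>m\<in>F. (cmod (\<integral>x. S x * cis (- (2 * pi * (x \<bullet> m))) \<partial>cube_measure))\<^sup>2)"
    using coef F by (intro sum.cong) auto
  then have "ennreal (\<Sum>m\<in>F. (cmod (fourier f (\<rho> *v m)))\<^sup>2) \<le> (\<integral>\<^sup>+x. ennreal ((cmod (S x))\<^sup>2) \<partial>cube_measure)"
    using bessel_cube[OF S F] by simp
  also have "\<dots> = (\<integral>\<^sup>+x. ennreal ((cmod (S x))\<^sup>2) * indicator cube x \<partial>lborel)"
    by (subst nn_integral_restrict_space) auto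
  also have "\<dots> = (\<integral>\<^sup>+x. ennreal ((cmod (periodization f \<rho> x))\<^sup>2) * indicator unit_cube x \<partial>lborel)"
  proof (rule nn_integral_cong_AE)
    have "AE x in lborel. x \<in> cube \<longrightarrow> summable (\<lambda>n. norm (g (x - lattice_enum n)))"
      using unfolding_lattice_sum(1)[OF g] by (subst (asm) AE_restrict_space_iff) auto
    then show "AE x in lborel. ennreal ((cmod (S x))\<^sup>2) * indicator cube x = ennreal ((cmod (periodization f \<rho> x))\<^sup>2) * indicator unit_cube x"
      using AE_cube_iff
    proof eventually_elim
      case (elim x)
      \<comment> \<open>\<open>periodization\<close> is an unordered sum, identified with the series
        where the latter converges absolutely. That holds almost everywhere in the cube, so the
        default value of \<open>infsum\<close> elsewhere does not affect the integral.\<close>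
      have "S x = periodization f \<rho> x" if sm: "summable (\<lambda>n. norm (g (x - lattice_enum n)))"
      proof -
        have "periodization f \<rho> x = (\<Sum>\<^sub>\<infinity>n. g (x - lattice_enum n))"
          unfolding periodization_def g_def by (rule infsum_reindex_bij_betw[OF bij_lattice_enum, symmetric])
        also have "\<dots> = S x"
          unfolding S_def by (intro infsumI norm_summable_imp_has_sum sm summable_sums summable_norm_cancel[OF sm])
        finally show ?thesis by simp
      qed
      then show ?case using elim by (auto simp: indicator_def)
    qed
  qed
  finally show ?thesis .
qed

section \<open>Comparison of the sum with the integral\<close>

lemma sum_inverse_squares_le: "(\<Sum>m<n. 1 / (real m + 1)\<^sup>2) \<le> 2 - 1 / real n"
proof (induction n)
  case (Suc n)
  show ?case
  \<comment> \<open>With 1 / 0 = 0 the bound at 0 reads 2, too weak to yield the value 1 at the next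
    step; the telescoping starts from there.\<close>
  proof (cases "n = 0")
    case False
    then have n: "real n > 0" by simp
    have "1 / (real n + 1)\<^sup>2 \<le> 1 / (real n * (real n + 1))"
      using n by (intro divide_left_mono) (auto simp: power2_eq_square)
    also have "\<dots> = 1 / real n - 1 / real (Suc n)" using n by (simp add: field_simps)
    finally show ?thesis using Suc by simp
  qed simp
qed simp

text \<open>The terms below and above \<open>j\<close> form two one-sided sums of inverse squares,
  each at most 2.\<close>

lemma sum_inverse_squares_diff_le:
  assumes "j < N"
  shows "(\<Sum>k\<in>{..<N} - {j}. 1 / (real j - real k)\<^sup>2) \<le> 4"
proof -
  have le2: "(\<Sum>m<n. 1 / (real m + 1)\<^sup>2) \<le> 2" for n
    using sum_inverse_squares_le[of n] by (smt (verit) divide_nonneg_nonneg of_nat_0_le_iff)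
  have split: "{..<N} - {j} = {..<j} \<union> {Suc j..<N}" using assms by auto
  have "(\<Sum>k\<in>{..<N} - {j}. 1 / (real j - real k)\<^sup>2)
     = (\<Sum>k<j. 1 / (real j - real k)\<^sup>2) + (\<Sum>k\<in>{Suc j..<N}. 1 / (real j - real k)\<^sup>2)"
    unfolding split by (rule sum.union_disjoint) auto
  also have "(\<Sum>k<j. 1 / (real j - real k)\<^sup>2) = (\<Sum>m<j. 1 / (real m + 1)\<^sup>2)"
    by (rule sum.reindex_bij_witness[of _ "\<lambda>m. j - Suc m" "\<lambda>k. j - Suc k"]) (auto simp: of_nat_diff)
  also have "(\<Sum>k\<in>{Suc j..<N}. 1 / (real j - real k)\<^sup>2) = (\<Sum>m<N - Suc j. 1 / (real m + 1)\<^sup>2)"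
  proof -
    have "1 / (real j - real (Suc j + m))\<^sup>2 = 1 / (real m + 1)\<^sup>2" for m
    proof -
      have "real j - real (Suc j + m) = - (real m + 1)" by simp
      then show ?thesis by (simp only: power2_minus)
    qed
    then show ?thesis
      by (simp only: sum.atLeastLessThan_shift_0[of _ "Suc j"] comp_def lessThan_atLeast0)
  qed
  finally show ?thesis using le2[of j] le2[of "N - Suc j"] by linarith
qed

text \<open>The real part of the Fresnel estimate after multiplication by the unimodular constant
  \<open>cis p\<close>. The phase \<open>p\<close> accommodates the shift of the sampling points by
  4.\<close>

lemma cos_fourier_square_le:
  fixes f :: "'a::euclidean_space \<Rightarrow> complex"
  assumes f: "integrable lborel f" and a: "a > 0" and l: "l \<noteq> 0"
  shows "integrable lborel (\<lambda>\<xi>. (cmod (fourier f \<xi>))\<^sup>2 * exp (- a * (norm \<xi>)\<^sup>2) * cos (l * (norm \<xi>)\<^sup>2 + p))"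
    and "\<bar>\<integral>\<xi>. (cmod (fourier f \<xi>))\<^sup>2 * exp (- a * (norm \<xi>)\<^sup>2) * cos (l * (norm \<xi>)\<^sup>2 + p) \<partial>lborel\<bar>
      \<le> sqrt (pi / \<bar>l\<bar>) ^ DIM('a) * (\<integral>x. cmod (f x) \<partial>lborel)\<^sup>2"
proof -
  let ?F = "\<lambda>\<xi>. (cmod (fourier f \<xi>))\<^sup>2 * exp (- a * (norm \<xi>)\<^sup>2)"
  let ?G = "\<lambda>\<xi>. (cmod (fourier f \<xi>))\<^sup>2 * (exp (- a * (norm \<xi>)\<^sup>2) *\<^sub>R cis (l * (norm \<xi>)\<^sup>2))"
  note F = integrable_norm_fourier_square_gaussian[OF f a]
  have G: "integrable lborel ?G"
    by (rule Bochner_Integration.integrable_bound[OF F]) (use f in \<open>auto simp: norm_mult norm_power\<close>)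
  have eq: "Re (cis p * ?G \<xi>) = ?F \<xi> * cos (l * (norm \<xi>)\<^sup>2 + p)" for \<xi>
  proof -
    have "cis p * ?G \<xi> = complex_of_real (?F \<xi>) * cis (l * (norm \<xi>)\<^sup>2 + p)"
      unfolding cis_mult[symmetric] by (simp add: scaleR_conv_of_real mult_ac)
    then show ?thesis by simp
  qed
  have "has_bochner_integral lborel (\<lambda>\<xi>. Re (cis p * ?G \<xi>)) (Re (cis p * (\<integral>\<xi>. ?G \<xi> \<partial>lborel)))"
    by (intro has_bochner_integral_Re has_bochner_integral_mult_right has_bochner_integral_integrable G)
  then have h: "has_bochner_integral lborel (\<lambda>\<xi>. ?F \<xi> * cos (l * (norm \<xi>)\<^sup>2 + p)) (Re (cis p * (\<integral>\<xi>. ?G \<xi> \<partial>lborel)))"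
    unfolding eq .
  show "integrable lborel (\<lambda>\<xi>. ?F \<xi> * cos (l * (norm \<xi>)\<^sup>2 + p))" using h by (rule integrable.intros)
  have "\<bar>Re (cis p * (\<integral>\<xi>. ?G \<xi> \<partial>lborel))\<bar> \<le> cmod (cis p * (\<integral>\<xi>. ?G \<xi> \<partial>lborel))" by (rule abs_Re_le_cmod)
  also have "\<dots> \<le> sqrt (pi / \<bar>l\<bar>) ^ DIM('a) * (\<integral>x. cmod (f x) \<partial>lborel)\<^sup>2"
    using norm_fresnel_transform_le[OF f a l] by (simp only: norm_mult norm_cis mult_1)
  finally show "\<bar>\<integral>\<xi>. ?F \<xi> * cos (l * (norm \<xi>)\<^sup>2 + p) \<partial>lborel\<bar> \<le> sqrt (pi / \<bar>l\<bar>) ^ DIM('a) * (\<integral>x. cmod (f x) \<partial>lborel)\<^sup>2"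
    unfolding has_bochner_integral_integral_eq[OF h] .
qed

text \<open>The harmonic \<open>j - k \<noteq> 0\<close> of the kernel contributes at most a multiple of
  \<open>|j - k|\<^bsup>- d / 2\<^esup>\<close>.\<close>

lemma fourier_square_fejer_ge:
  fixes f :: "'a::euclidean_space \<Rightarrow> complex"
  assumes f: "integrable lborel f" and a: "a > 0" and N: "N > 0" and d: "DIM('a) \<ge> 4"
  shows "integrable lborel (\<lambda>\<xi>. (cmod (fourier f \<xi>))\<^sup>2 * exp (- a * (norm \<xi>)\<^sup>2) * fejer N (((norm \<xi>)\<^sup>2 - 4) / 8))"
    and "(\<integral>\<xi>. (cmod (fourier f \<xi>))\<^sup>2 * exp (- a * (norm \<xi>)\<^sup>2) \<partial>lborel)
      \<le> (\<integral>\<xi>. (cmod (fourier f \<xi>))\<^sup>2 * exp (- a * (norm \<xi>)\<^sup>2) * fejer N (((norm \<xi>)\<^sup>2 - 4) / 8) \<partial>lborel)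
        + 4 * 2 ^ DIM('a) * (\<integral>x. cmod (f x) \<partial>lborel)\<^sup>2"
proof -
  let ?L = "\<integral>x. cmod (f x) \<partial>lborel"
  define F where "F \<xi> = (cmod (fourier f \<xi>))\<^sup>2 * exp (- a * (norm \<xi>)\<^sup>2)" for \<xi>
  have F: "integrable lborel F" unfolding F_def[abs_def] by (rule integrable_norm_fourier_square_gaussian[OF f a])
  define C where "C j k \<xi> = F \<xi> * cos (2 * pi * (real j - real k) * (((norm \<xi>)\<^sup>2 - 4) / 8))" for j k \<xi>
  have Cjk: "integrable lborel (C j k)" "\<bar>\<integral>\<xi>. C j k \<xi> \<partial>lborel\<bar> \<le> 2 ^ DIM('a) * ?L\<^sup>2 * (1 / (real j - real k)\<^sup>2)"
    if jk: "j \<noteq> k" for j k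
  proof -
    define m where "m = real j - real k"
    have m1: "\<bar>m\<bar> \<ge> 1" using jk unfolding m_def by linarith
    let ?l = "2 * pi * m / 8"
    have l: "?l \<noteq> 0" using m1 by auto
    \<comment> \<open>Sampling with step 8 gives the frequency 2 pi m / 8, so that pi / |l| is 4 /
      |m|; the offset 4 becomes the phase - pi m.\<close>
    have "2 * pi * m * ((t - 4) / 8) = ?l * t + - (pi * m)" for t by (simp add: field_simps)
    then have eq: "C j k = (\<lambda>\<xi>. (cmod (fourier f \<xi>))\<^sup>2 * exp (- a * (norm \<xi>)\<^sup>2) * cos (?l * (norm \<xi>)\<^sup>2 + - (pi * m)))"
      unfolding C_def[abs_def] F_def m_def[symmetric] by (simp only:)
    show "integrable lborel (C j k)" unfolding eq by (rule cos_fourier_square_le(1)[OF f a l])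
    have "sqrt (pi / \<bar>?l\<bar>) ^ DIM('a) = 2 ^ DIM('a) * (1 / sqrt \<bar>m\<bar>) ^ DIM('a)"
    proof -
      have "sqrt (pi / \<bar>?l\<bar>) = sqrt (4 / \<bar>m\<bar>)" using m1 by (simp add: abs_mult field_simps)
      also have "\<dots> = 2 * (1 / sqrt \<bar>m\<bar>)" by (simp add: real_sqrt_divide)
      finally show ?thesis by (simp only: power_mult_distrib)
    qed
    \<comment> \<open>Here dimension at least 4 enters: since |m| is at least 1, the decay
      |m|^(-d/2) is at most |m|^(-2), which is summable.\<close>
    also have "\<dots> \<le> 2 ^ DIM('a) * (1 / sqrt \<bar>m\<bar>) ^ 4"
      using m1 d by (intro mult_left_mono power_decreasing) auto
    also have "(1 / sqrt \<bar>m\<bar>) ^ 4 = 1 / m\<^sup>2"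
    proof -
      have "sqrt \<bar>m\<bar> ^ 4 = (sqrt \<bar>m\<bar> * sqrt \<bar>m\<bar>) * (sqrt \<bar>m\<bar> * sqrt \<bar>m\<bar>)"
        by (simp only: power4_eq_xxxx mult.assoc)
      also have "\<dots> = m\<^sup>2" by (simp add: power2_eq_square)
      finally show ?thesis by (simp add: power_divide)
    qed
    finally have "sqrt (pi / \<bar>?l\<bar>) ^ DIM('a) * ?L\<^sup>2 \<le> 2 ^ DIM('a) * (1 / m\<^sup>2) * ?L\<^sup>2" by (rule mult_right_mono) simp
    then show "\<bar>\<integral>\<xi>. C j k \<xi> \<partial>lborel\<bar> \<le> 2 ^ DIM('a) * ?L\<^sup>2 * (1 / (real j - real k)\<^sup>2)"
      using cos_fourier_square_le(2)[OF f a l, of "- (pi * m)"] unfolding eq m_def[symmetric] by (simp add: mult_ac)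
  qed
  have fej: "F \<xi> * fejer N (((norm \<xi>)\<^sup>2 - 4) / 8) = F \<xi> + (\<Sum>j<N. \<Sum>k\<in>{..<N} - {j}. C j k \<xi>) / real N" for \<xi>
    unfolding fejer_eq_sum_cos[OF N] C_def by (simp add: distrib_left sum_distrib_left)
  have h: "has_bochner_integral lborel (\<lambda>\<xi>. F \<xi> * fejer N (((norm \<xi>)\<^sup>2 - 4) / 8))
     ((\<integral>\<xi>. F \<xi> \<partial>lborel) + (\<Sum>j<N. \<Sum>k\<in>{..<N} - {j}. \<integral>\<xi>. C j k \<xi> \<partial>lborel) / real N)"
    unfolding fej
    by (intro has_bochner_integral_add has_bochner_integral_divide has_bochner_integral_sum has_bochner_integral_integrable F Cjk) auto
  show "integrable lborel (\<lambda>\<xi>. (cmod (fourier f \<xi>))\<^sup>2 * exp (- a * (norm \<xi>)\<^sup>2) * fejer N (((norm \<xi>)\<^sup>2 - 4) / 8))"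
    using h unfolding F_def by (rule integrable.intros)
  \<comment> \<open>Every row \<open>j\<close> is bounded below by the same constant, so the
    division by \<open>N\<close> gives an error uniform in \<open>N\<close>.\<close>
  have "(\<Sum>j<N. \<Sum>k\<in>{..<N} - {j}. \<integral>\<xi>. C j k \<xi> \<partial>lborel) \<ge> (\<Sum>j<N. - (4 * 2 ^ DIM('a) * ?L\<^sup>2))"
  proof (rule sum_mono)
    fix j assume "j \<in> {..<N}"
    then have j: "j < N" by simp
    have "(\<Sum>k\<in>{..<N} - {j}. - (\<integral>\<xi>. C j k \<xi> \<partial>lborel)) \<le> (\<Sum>k\<in>{..<N} - {j}. 2 ^ DIM('a) * ?L\<^sup>2 * (1 / (real j - real k)\<^sup>2))"
    proof (rule sum_mono)
      fix k assume "k \<in> {..<N} - {j}"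
      then have "j \<noteq> k" by auto
      from Cjk(2)[OF this] show "- (\<integral>\<xi>. C j k \<xi> \<partial>lborel) \<le> 2 ^ DIM('a) * ?L\<^sup>2 * (1 / (real j - real k)\<^sup>2)" by linarith
    qed
    also have "\<dots> = 2 ^ DIM('a) * ?L\<^sup>2 * (\<Sum>k\<in>{..<N} - {j}. 1 / (real j - real k)\<^sup>2)" by (simp only: sum_distrib_left)
    also have "\<dots> \<le> 2 ^ DIM('a) * ?L\<^sup>2 * 4"
      by (intro mult_left_mono sum_inverse_squares_diff_le j) auto
    finally show "- (4 * 2 ^ DIM('a) * ?L\<^sup>2) \<le> (\<Sum>k\<in>{..<N} - {j}. \<integral>\<xi>. C j k \<xi> \<partial>lborel)"
      by (simp add: sum_negf)
  qed
  also have "(\<Sum>j<N. - (4 * 2 ^ DIM('a) * ?L\<^sup>2)) = real N * - (4 * 2 ^ DIM('a) * ?L\<^sup>2)" by simp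
  finally have "- (4 * 2 ^ DIM('a) * ?L\<^sup>2) \<le> (\<Sum>j<N. \<Sum>k\<in>{..<N} - {j}. \<integral>\<xi>. C j k \<xi> \<partial>lborel) / real N"
    using N by (simp add: pos_le_divide_eq mult.commute)
  then show "(\<integral>\<xi>. (cmod (fourier f \<xi>))\<^sup>2 * exp (- a * (norm \<xi>)\<^sup>2) \<partial>lborel)
      \<le> (\<integral>\<xi>. (cmod (fourier f \<xi>))\<^sup>2 * exp (- a * (norm \<xi>)\<^sup>2) * fejer N (((norm \<xi>)\<^sup>2 - 4) / 8) \<partial>lborel)
        + 4 * 2 ^ DIM('a) * ?L\<^sup>2"
    using has_bochner_integral_integral_eq[OF h] unfolding F_def by linarith
qed

text \<open>Raise y <= exp y, with y = b t / p, to the power p.\<close>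

lemma powr_le_exp:
  fixes p b t :: real
  assumes p: "p > 0" and b: "b > 0" and t: "t \<ge> 0"
  shows "t powr p \<le> (p / b) powr p * exp (b * t)"
proof -
  have "b * t / p \<le> exp (b * t / p)" using exp_ge_add_one_self[of "b * t / p"] by linarith
  then have "t \<le> p / b * exp (b * t / p)" using p b by (simp add: field_simps)
  then have "t powr p \<le> (p / b * exp (b * t / p)) powr p" using p t by (intro powr_mono2) auto
  also have "\<dots> = (p / b) powr p * exp (b * t)"
  proof -
    have "(p / b * exp (b * t / p)) powr p = (p / b) powr p * exp (b * t / p) powr p"
      by (rule powr_mult)
    then show ?thesis using p by (simp add: powr_def[of "exp _"])
  qed
  finally show ?thesis .
qed

section \<open>Spherical means of the squared transform\<close>

context
  fixes \<mu> :: "(real^'n^'n) measure" and f :: "real^'n \<Rightarrow> complex"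
  assumes haar: "haar_SO \<mu>" and f: "integrable lborel f" and card: "CARD('n) \<ge> 4"
begin

abbreviation energy :: "real^'n \<Rightarrow> real" where
  "energy \<xi> \<equiv> (cmod (fourier f \<xi>))\<^sup>2"

definition base_vector :: "real^'n" where
  "base_vector = axis (SOME i. True) 1"

text \<open>The mean over the sphere of squared radius \<open>t\<close>, realised as a Haar average
  along the orbit of one vector in place of a surface measure. The absolute value extends it
  continuously to all reals, as \<open>fejer_sampling\<close> requires.\<close>

definition spherical_mean :: "real \<Rightarrow> real" where
  "spherical_mean t = (\<integral>A. energy (A *v (sqrt \<bar>t\<bar> *\<^sub>R base_vector)) \<partial>\<mu>)"

lemma norm_base_vector: "norm base_vector = 1"
  by (simp add: base_vector_def)

lemma energy_le: "energy \<xi> \<le> (\<integral>x. cmod (f x) \<partial>lborel)\<^sup>2"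
  by (intro power_mono norm_fourier_le f) auto

lemma energy_measurable [measurable]: "energy \<in> borel_measurable borel"
  using f by measurable

lemma integrable_energy_rotate: "integrable \<mu> (\<lambda>A. energy (A *v \<xi>))"
proof -
  interpret prob_space \<mu> using haar by (rule haar_prob)
  note [measurable] = haar_borel[OF haar]
  show ?thesis
    by (rule integrable_const_bound[of _ "(\<integral>x. cmod (f x) \<partial>lborel)\<^sup>2"]) (auto simp: energy_le)
qed

lemma spherical_mean_nonneg: "spherical_mean t \<ge> 0"
  by (simp add: spherical_mean_def)

lemma spherical_mean_le: "spherical_mean t \<le> (\<integral>x. cmod (f x) \<partial>lborel)\<^sup>2"
proof -
  interpret prob_space \<mu> using haar by (rule haar_prob)
  have "spherical_mean t \<le> (\<integral>A. (\<integral>x. cmod (f x) \<partial>lborel)\<^sup>2 \<partial>\<mu>)"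
    unfolding spherical_mean_def by (intro integral_mono integrable_energy_rotate energy_le) simp
  then show ?thesis by (simp add: prob_space)
qed

lemma continuous_spherical_mean: "continuous_on UNIV spherical_mean"
  unfolding continuous_on_sequentially comp_def
proof safe
  interpret prob_space \<mu> using haar by (rule haar_prob)
  fix X and t :: real assume X: "X \<longlonglongrightarrow> t"
  show "(\<lambda>n. spherical_mean (X n)) \<longlonglongrightarrow> spherical_mean t"
    unfolding spherical_mean_def
  proof (rule integral_dominated_convergence[where w = "\<lambda>_. (\<integral>x. cmod (f x) \<partial>lborel)\<^sup>2"])
    show "AE A in \<mu>. (\<lambda>n. energy (A *v (sqrt \<bar>X n\<bar> *\<^sub>R base_vector))) \<longlonglongrightarrow> energy (A *v (sqrt \<bar>t\<bar> *\<^sub>R base_vector))"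
    proof (rule AE_I2)
      fix A :: "real^'n^'n"
      have "continuous_on UNIV (\<lambda>\<xi>. energy (A *v \<xi>))"
        by (intro continuous_intros continuous_on_compose2[OF continuous_fourier[OF f]] continuous_matrix_vector_mult) auto
      then have "isCont (\<lambda>\<xi>. energy (A *v \<xi>)) \<xi>" for \<xi> by (simp add: continuous_on_eq_continuous_at)
      then show "(\<lambda>n. energy (A *v (sqrt \<bar>X n\<bar> *\<^sub>R base_vector))) \<longlonglongrightarrow> energy (A *v (sqrt \<bar>t\<bar> *\<^sub>R base_vector))"
        by (rule isCont_tendsto_compose) (intro tendsto_intros X)
    qed
    show "AE A in \<mu>. norm (energy (A *v (sqrt \<bar>X n\<bar> *\<^sub>R base_vector))) \<le> (\<integral>x. cmod (f x) \<partial>lborel)\<^sup>2" for n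
      using energy_le by (intro AE_I2) simp
  qed (auto intro: borel_measurable_integrable integrable_energy_rotate)
qed

lemma nn_integral_energy_rotate:
  "(\<integral>\<^sup>+A. ennreal (energy (A *v \<xi>)) \<partial>\<mu>) = ennreal (spherical_mean ((norm \<xi>)\<^sup>2))"
proof -
  have "(\<integral>\<^sup>+A. ennreal (energy (A *v \<xi>)) \<partial>\<mu>) = (\<integral>\<^sup>+A. ennreal (energy (A *v (sqrt \<bar>(norm \<xi>)\<^sup>2\<bar> *\<^sub>R base_vector))) \<partial>\<mu>)"
    by (rule haar_average_radial[OF haar]) (use card in \<open>auto simp: norm_base_vector\<close>)
  also have "\<dots> = ennreal (spherical_mean ((norm \<xi>)\<^sup>2))"
    unfolding spherical_mean_def by (intro nn_integral_eq_integral integrable_energy_rotate) auto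
  finally show ?thesis .
qed

text \<open>Rotating the variable changes neither Lebesgue measure nor the radial weight, so one may
  average over rotations and exchange the integrals.\<close>

lemma nn_integral_energy_radial:
  assumes [measurable]: "w \<in> borel_measurable borel"
  shows "(\<integral>\<^sup>+\<xi>. ennreal (energy \<xi>) * w ((norm \<xi>)\<^sup>2) \<partial>lborel)
    = (\<integral>\<^sup>+\<xi>. ennreal (spherical_mean ((norm \<xi>)\<^sup>2)) * w ((norm \<xi>)\<^sup>2) \<partial>(lborel :: (real^'n) measure))"
proof -
  interpret prob_space \<mu> using haar by (rule haar_prob)
  interpret P: pair_sigma_finite \<mu> "lborel :: (real^'n) measure" ..
  note [measurable] = haar_borel[OF haar]
  let ?h = "\<lambda>\<xi>. ennreal (energy \<xi>) * w ((norm \<xi>)\<^sup>2)"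
  have "(\<integral>\<^sup>+\<xi>. ?h \<xi> \<partial>lborel) = (\<integral>\<^sup>+A. \<integral>\<^sup>+\<xi>. ?h \<xi> \<partial>lborel \<partial>\<mu>)" by (simp add: emeasure_space_1)
  also have "\<dots> = (\<integral>\<^sup>+A. \<integral>\<^sup>+\<xi>. ennreal (energy (A *v \<xi>)) * w ((norm \<xi>)\<^sup>2) \<partial>lborel \<partial>\<mu>)"
  proof (rule nn_integral_cong)
    fix A assume "A \<in> space \<mu>"
    then have A: "A \<in> SOd" by (simp add: haar_space[OF haar])
    have "norm (A *v \<xi>) = norm \<xi>" for \<xi>
      using orthogonal_transformation_norm[OF orthogonal_transformation_SOd[OF A]] .
    then show "(\<integral>\<^sup>+\<xi>. ?h \<xi> \<partial>lborel) = (\<integral>\<^sup>+\<xi>. ennreal (energy (A *v \<xi>)) * w ((norm \<xi>)\<^sup>2) \<partial>lborel)"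
      using nn_integral_SOd_rotate[OF A, of ?h] by simp
  qed
  also have "\<dots> = (\<integral>\<^sup>+\<xi>. \<integral>\<^sup>+A. ennreal (energy (A *v \<xi>)) * w ((norm \<xi>)\<^sup>2) \<partial>\<mu> \<partial>lborel)"
    by (rule P.Fubini'[symmetric]) measurable
  also have "\<dots> = (\<integral>\<^sup>+\<xi>. ennreal (spherical_mean ((norm \<xi>)\<^sup>2)) * w ((norm \<xi>)\<^sup>2) \<partial>(lborel :: (real^'n) measure))"
    by (intro nn_integral_cong) (simp add: nn_integral_multc nn_integral_energy_rotate)
  finally show ?thesis .
qed

text \<open>Grouping lattice points by squared norm gives, for each single rotation, a finite sum to
  which Bessel's inequality applies; the Haar average then turns each term into a spherical
  mean.\<close>

lemma sum_spherical_mean_le: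
  fixes G :: ennreal
  defines "G \<equiv> \<integral>\<^sup>+\<rho>. (\<integral>\<^sup>+x\<in>unit_cube. ennreal ((cmod (periodization f \<rho> x))\<^sup>2) \<partial>lborel) \<partial>\<mu>"
  assumes I: "finite I" and G: "G < \<infinity>"
  shows "(\<Sum>n\<in>I. real (card {v \<in> int_lattice :: (real^'n) set. (norm v)\<^sup>2 = real n}) * spherical_mean (real n)) \<le> enn2real G"
proof -
  let ?Z = "\<lambda>n::nat. {v \<in> int_lattice :: (real^'n) set. (norm v)\<^sup>2 = real n}"
  let ?U = "\<Union>n\<in>I. ?Z n"
  have "(\<Sum>n\<in>I. real (card (?Z n)) * spherical_mean (real n)) = (\<Sum>n\<in>I. \<Sum>v\<in>?Z n. spherical_mean ((norm v)\<^sup>2))"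
    by (intro sum.cong refl) simp
  also have "\<dots> = (\<Sum>v\<in>?U. spherical_mean ((norm v)\<^sup>2))"
    using I by (intro sum.UNION_disjoint[symmetric]) (auto simp: finite_lattice_sphere)
  finally have "ennreal (\<Sum>n\<in>I. real (card (?Z n)) * spherical_mean (real n)) = (\<Sum>v\<in>?U. ennreal (spherical_mean ((norm v)\<^sup>2)))"
    by (simp add: sum_ennreal spherical_mean_nonneg)
  also have "\<dots> = (\<Sum>v\<in>?U. \<integral>\<^sup>+A. ennreal (energy (A *v v)) \<partial>\<mu>)"
    by (simp only: nn_integral_energy_rotate)
  also have "\<dots> = (\<integral>\<^sup>+A. (\<Sum>v\<in>?U. ennreal (energy (A *v v))) \<partial>\<mu>)"
    by (intro nn_integral_sum[symmetric]) (auto intro!: measurable_compose[OF borel_measurable_integrable[OF integrable_energy_rotate]])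
  also have "\<dots> \<le> G"
    unfolding G_def
  proof (rule nn_integral_mono)
    fix A assume "A \<in> space \<mu>"
    then have A: "A \<in> SOd" by (simp add: haar_space[OF haar])
    have "ennreal (\<Sum>v\<in>?U. energy (A *v v)) \<le> (\<integral>\<^sup>+x\<in>unit_cube. ennreal ((cmod (periodization f A x))\<^sup>2) \<partial>lborel)"
      by (rule sum_fourier_le_periodization[OF f A]) (use I in \<open>auto simp: finite_lattice_sphere\<close>)
    then show "(\<Sum>v\<in>?U. ennreal (energy (A *v v))) \<le> (\<integral>\<^sup>+x\<in>unit_cube. ennreal ((cmod (periodization f A x))\<^sup>2) \<partial>lborel)"
      by (simp add: sum_ennreal)
  qed
  finally show ?thesis
    using G by (cases G) (auto simp: sum_nonneg spherical_mean_nonneg)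
qed

text \<open>\<open>\<psi>\<close> is the density of the weighted energy in t = |xi|^2. At the
  sampling points \<open>count\<close> replaces t^(d/2 - 1) by the number of lattice points over
  \<open>c0\<close>, which brings in G; the 8 is the sampling step, and the last term is the total
  contribution of the nonconstant harmonics.\<close>

lemma energy_gaussian_le:
  fixes G :: ennreal and c0 :: real
  defines "G \<equiv> \<integral>\<^sup>+\<rho>. (\<integral>\<^sup>+x\<in>unit_cube. ennreal ((cmod (periodization f \<rho> x))\<^sup>2) \<partial>lborel) \<partial>\<mu>"
  assumes G: "G < \<infinity>" and a: "a > 0" and c0: "c0 > 0"
    and count: "\<And>n::nat. n mod 8 = 4 \<Longrightarrow>
      c0 * real n powr (real CARD('n) / 2 - 1) \<le> real (card {v \<in> int_lattice :: (real^'n) set. (norm v)\<^sup>2 = real n})"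
  shows "(\<integral>\<xi>. energy \<xi> * exp (- a * (norm \<xi>)\<^sup>2) \<partial>lborel)
    \<le> 8 * (unit_ball_vol CARD('n) * (CARD('n) / 2)) / c0 * enn2real G + 4 * 2 ^ CARD('n) * (\<integral>x. cmod (f x) \<partial>lborel)\<^sup>2"
proof -
  let ?L = "\<integral>x. cmod (f x) \<partial>lborel"
  define p where "p = real CARD('n) / 2 - 1"
  define c where "c = unit_ball_vol CARD('n) * (CARD('n) / 2)"
  have p: "p > 0" using card by (simp add: p_def)
  have c: "c \<ge> 0" unfolding c_def by (intro mult_nonneg_nonneg) (auto simp: less_imp_le)
  define \<psi> where "\<psi> t = c * \<bar>t\<bar> powr p * exp (- a * t) * spherical_mean t" for t
  have \<psi>c: "continuous_on UNIV \<psi>"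
    unfolding \<psi>_def[abs_def] using p
    by (intro continuous_on_mult continuous_on_powr' continuous_intros continuous_spherical_mean) auto
  have \<psi>b: "\<bar>\<psi> t\<bar> \<le> c * (p / (a / 2)) powr p * ?L\<^sup>2 * exp (- (a / 2) * t)" if t: "t \<ge> 0" for t
  proof -
    have "\<bar>\<psi> t\<bar> = c * (t powr p * exp (- a * t)) * spherical_mean t"
      using c t spherical_mean_nonneg[of t] by (simp add: \<psi>_def abs_mult)
    \<comment> \<open>Half of the exponential decay is spent on absorbing the power of t.\<close>
    also have "\<dots> \<le> c * ((p / (a / 2)) powr p * exp (a / 2 * t) * exp (- a * t)) * ?L\<^sup>2"
      using powr_le_exp[OF p, of "a / 2" t] a t c
      by (intro mult_mono mult_left_mono mult_right_mono spherical_mean_le) (auto simp: spherical_mean_nonneg)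
    also have "exp (a / 2 * t) * exp (- a * t) = exp (- (a / 2) * t)"
      unfolding exp_add[symmetric] by (simp add: field_simps)
    then have "c * ((p / (a / 2)) powr p * exp (a / 2 * t) * exp (- a * t)) * ?L\<^sup>2 = c * (p / (a / 2)) powr p * ?L\<^sup>2 * exp (- (a / 2) * t)"
      by (simp add: mult_ac)
    finally show ?thesis .
  qed
  have a2: "a / 2 > 0" using a by simp
  note S = fejer_sampling[OF \<psi>c a2 \<psi>b]
  have \<psi>0: "\<psi> t \<ge> 0" for t using c by (simp add: \<psi>_def spherical_mean_nonneg)
  have radial: "(\<integral>\<xi>. energy \<xi> * exp (- a * (norm \<xi>)\<^sup>2) * fejer N (((norm \<xi>)\<^sup>2 - 4) / 8) \<partial>lborel)
      = (LBINT t:{0..}. fejer N ((t - 4) / 8) * \<psi> t)" if N: "N > 0" for N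
  proof -
    let ?w = "\<lambda>t. exp (- a * t) * fejer N ((t - 4) / 8)"
    have w0: "?w t \<ge> 0" for t by (simp add: fejer_nonneg)
    have [measurable]: "spherical_mean \<in> borel_measurable borel"
      by (intro borel_measurable_continuous_onI continuous_spherical_mean)
    have int: "integrable lborel (\<lambda>\<xi>. energy \<xi> * exp (- a * (norm \<xi>)\<^sup>2) * fejer N (((norm \<xi>)\<^sup>2 - 4) / 8))"
      using fourier_square_fejer_ge(1)[OF f a N] card by simp
    have "ennreal (\<integral>\<xi>. energy \<xi> * exp (- a * (norm \<xi>)\<^sup>2) * fejer N (((norm \<xi>)\<^sup>2 - 4) / 8) \<partial>lborel)
      = (\<integral>\<^sup>+\<xi>. ennreal (energy \<xi> * exp (- a * (norm \<xi>)\<^sup>2) * fejer N (((norm \<xi>)\<^sup>2 - 4) / 8)) \<partial>lborel)"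
      by (rule nn_integral_eq_integral[symmetric, OF int]) (simp add: fejer_nonneg)
    also have "\<dots> = (\<integral>\<^sup>+\<xi>. ennreal (energy \<xi>) * ennreal (?w ((norm \<xi>)\<^sup>2)) \<partial>lborel)"
      by (simp add: ennreal_mult' w0 mult.assoc flip: ennreal_mult)
    also have "\<dots> = (\<integral>\<^sup>+\<xi>. ennreal (spherical_mean ((norm \<xi>)\<^sup>2)) * ennreal (?w ((norm \<xi>)\<^sup>2)) \<partial>(lborel :: (real^'n) measure))"
      by (rule nn_integral_energy_radial) measurable
    also have "\<dots> = (\<integral>\<^sup>+t. ennreal (indicator {0..} t * (c * t powr p)) * (ennreal (spherical_mean t) * ennreal (?w t)) \<partial>lborel)"
      using nn_integral_norm_square[where 'a = "real^'n", of "\<lambda>t. ennreal (spherical_mean t) * ennreal (?w t)"] card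
      by (simp add: c_def p_def)
    also have "\<dots> = (\<integral>\<^sup>+t. ennreal (indicator {0..} t *\<^sub>R (fejer N ((t - 4) / 8) * \<psi> t)) \<partial>lborel)"
    proof (rule nn_integral_cong)
      fix t :: real
      have X0: "indicator {0..} t * (c * t powr p) \<ge> 0" using c by simp
      have "ennreal (indicator {0..} t * (c * t powr p)) * (ennreal (spherical_mean t) * ennreal (?w t))
        = ennreal (indicator {0..} t * (c * t powr p) * (spherical_mean t * ?w t))"
        by (simp only: ennreal_mult[OF X0 mult_nonneg_nonneg[OF spherical_mean_nonneg w0]] ennreal_mult[OF spherical_mean_nonneg w0])
      also have "indicator {0..} t * (c * t powr p) * (spherical_mean t * ?w t) = indicator {0..} t *\<^sub>R (fejer N ((t - 4) / 8) * \<psi> t)"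
        by (auto simp: indicator_def \<psi>_def)
      finally show "ennreal (indicator {0..} t * (c * t powr p)) * (ennreal (spherical_mean t) * ennreal (?w t))
        = ennreal (indicator {0..} t *\<^sub>R (fejer N ((t - 4) / 8) * \<psi> t))" .
    qed
    also have "\<dots> = ennreal (LBINT t:{0..}. fejer N ((t - 4) / 8) * \<psi> t)"
      unfolding set_lebesgue_integral_def
      by (rule nn_integral_eq_integral) (use S(3)[of N] in \<open>auto simp: set_integrable_def fejer_nonneg \<psi>0\<close>)
    finally show ?thesis
      by (subst (asm) ennreal_inj) (auto simp: set_lebesgue_integral_def fejer_nonneg \<psi>0 intro!: integral_nonneg_AE)
  qed
  have le: "(\<integral>\<xi>. energy \<xi> * exp (- a * (norm \<xi>)\<^sup>2) \<partial>lborel) \<le> (LBINT t:{0..}. fejer N ((t - 4) / 8) * \<psi> t) + 4 * 2 ^ CARD('n) * ?L\<^sup>2"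
    if "N > 0" for N
    using fourier_square_fejer_ge(2)[OF f a that] card unfolding radial[OF that] by simp
  have "(\<integral>\<xi>. energy \<xi> * exp (- a * (norm \<xi>)\<^sup>2) \<partial>lborel) \<le> 8 * (\<Sum>j. \<psi> (8 * real j + 4)) + 4 * 2 ^ CARD('n) * ?L\<^sup>2"
    by (rule LIMSEQ_le_const[OF tendsto_add[OF S(2) tendsto_const]]) (use le in \<open>auto intro!: exI[of _ 1]\<close>)
  moreover have "(\<Sum>j. \<psi> (8 * real j + 4)) \<le> c / c0 * enn2real G"
  proof (rule suminf_le_const[OF S(1)])
    fix J
    let ?n = "\<lambda>j::nat. 8 * j + 4"
    let ?r = "\<lambda>n::nat. real (card {v \<in> int_lattice :: (real^'n) set. (norm v)\<^sup>2 = real n})"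
    have "(\<Sum>j<J. \<psi> (8 * real j + 4)) \<le> (\<Sum>j<J. c / c0 * (?r (?n j) * spherical_mean (real (?n j))))"
    proof (rule sum_mono)
      fix j
      have "c0 * real (?n j) powr p \<le> ?r (?n j)" unfolding p_def by (rule count) presburger
      then have r: "real (?n j) powr p \<le> ?r (?n j) / c0" using c0 by (simp add: field_simps)
      have "\<psi> (8 * real j + 4) = c * (real (?n j) powr p * exp (- a * (8 * real j + 4))) * spherical_mean (real (?n j))"
        by (simp add: \<psi>_def)
      \<comment> \<open>The weight is bounded by 1 here, which makes the bound independent of
        \<open>a\<close>.\<close>
      also have "\<dots> \<le> c * (?r (?n j) / c0 * 1) * spherical_mean (real (?n j))"
        using c r a c0 by (intro mult_right_mono mult_left_mono mult_mono spherical_mean_nonneg) auto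
      also have "\<dots> = c / c0 * (?r (?n j) * spherical_mean (real (?n j)))" by simp
      finally show "\<psi> (8 * real j + 4) \<le> c / c0 * (?r (?n j) * spherical_mean (real (?n j)))" .
    qed
    also have "\<dots> = c / c0 * (\<Sum>n\<in>?n ` {..<J}. ?r n * spherical_mean (real n))"
      by (subst sum.reindex) (auto simp: inj_on_def sum_distrib_left)
    also have "\<dots> \<le> c / c0 * enn2real G"
      using c c0 G unfolding G_def by (intro mult_left_mono sum_spherical_mean_le) auto
    finally show "(\<Sum>j<J. \<psi> (8 * real j + 4)) \<le> c / c0 * enn2real G" .
  qed
  moreover have "8 * c / c0 * enn2real G = 8 * (c / c0 * enn2real G)" by simp
  ultimately show ?thesis unfolding c_def[symmetric] by linarith
qed

end

theorem theorem1:
  assumes "CARD('n) \<ge> 4"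
  shows "\<exists>C::real. \<forall>(f :: real^'n \<Rightarrow> complex) (\<mu> :: (real^'n^'n) measure).
    haar_SO \<mu>
    \<and> integrable lborel f
    \<and> (AE \<rho> in \<mu>. periodization f \<rho> \<in> borel_measurable (lebesgue_on unit_cube)
          \<and> (\<integral>\<^sup>+ x \<in> unit_cube. ennreal ((cmod (periodization f \<rho> x))\<^sup>2) \<partial>lborel) < \<infinity>)
    \<and> (\<integral>\<^sup>+ \<rho>. (\<integral>\<^sup>+ x \<in> unit_cube. ennreal ((cmod (periodization f \<rho> x))\<^sup>2) \<partial>lborel) \<partial>\<mu>) < \<infinity>
    \<longrightarrow> integrable lborel (\<lambda>x. (cmod (f x))\<^sup>2)
      \<and> sqrt (\<integral>x. (cmod (f x))\<^sup>2 \<partial>lborel)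
          \<le> C * (sqrt (enn2real (\<integral>\<^sup>+ \<rho>. (\<integral>\<^sup>+ x \<in> unit_cube. ennreal ((cmod (periodization f \<rho> x))\<^sup>2) \<partial>lborel) \<partial>\<mu>))
                 + (\<integral>x. cmod (f x) \<partial>lborel))"
proof -
  obtain c0 where c0: "c0 > 0" and count: "\<And>n::nat. n mod 8 = 4 \<Longrightarrow>
      c0 * real n powr (real CARD('n) / 2 - 1) \<le> real (card {v \<in> int_lattice :: (real^'n) set. (norm v)\<^sup>2 = real n})"
    using card_lattice_sphere_ge[OF assms] by blast
  define K1 where "K1 = 8 * (unit_ball_vol CARD('n) * (CARD('n) / 2)) / c0"
  define K2 where "K2 = (4 * 2 ^ CARD('n) :: real)"
  have K: "K1 \<ge> 0" "K2 \<ge> 0" using c0 unfolding K1_def K2_def by (auto simp: less_imp_le)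
  show ?thesis
  \<comment> \<open>\<open>c0\<close>, and with it the constant, is fixed by the dimension before
    \<open>f\<close> and \<open>\<mu>\<close> are introduced.\<close>
  proof (intro exI[of _ "sqrt K1 + sqrt K2"] allI impI, elim conjE)
    fix f :: "real^'n \<Rightarrow> complex" and \<mu> :: "(real^'n^'n) measure"
    let ?G = "\<integral>\<^sup>+ \<rho>. (\<integral>\<^sup>+ x \<in> unit_cube. ennreal ((cmod (periodization f \<rho> x))\<^sup>2) \<partial>lborel) \<partial>\<mu>"
    let ?L = "\<integral>x. cmod (f x) \<partial>lborel"
    assume haar: "haar_SO \<mu>" and f: "integrable lborel f" and G: "?G < \<infinity>"
    have bound: "(\<integral>\<xi>. (cmod (fourier f \<xi>))\<^sup>2 * exp (- a * (norm \<xi>)\<^sup>2) \<partial>lborel) \<le> K1 * enn2real ?G + K2 * ?L\<^sup>2"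
      if "a > 0" for a
      unfolding K1_def K2_def by (rule energy_gaussian_le[OF haar f assms G that c0 count])
    \<comment> \<open>The bound is the same for every \<open>a > 0\<close>, which is what the
      duality argument asks for.\<close>
    note sq = square_integrable_of_fourier[OF f bound]
    have "sqrt (\<integral>x. (cmod (f x))\<^sup>2 \<partial>lborel) \<le> sqrt (K1 * enn2real ?G + K2 * ?L\<^sup>2)"
      using sq(2) by (rule real_sqrt_le_mono)
    also have "\<dots> \<le> sqrt (K1 * enn2real ?G) + sqrt (K2 * ?L\<^sup>2)"
      using K by (intro sqrt_add_le_add_sqrt) auto
    also have "\<dots> = sqrt K1 * sqrt (enn2real ?G) + sqrt K2 * ?L"
      by (simp add: real_sqrt_mult)
    also have "\<dots> \<le> (sqrt K1 + sqrt K2) * (sqrt (enn2real ?G) + ?L)"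
      using K by (simp add: algebra_simps)
    finally show "integrable lborel (\<lambda>x. (cmod (f x))\<^sup>2) \<and>
        sqrt (\<integral>x. (cmod (f x))\<^sup>2 \<partial>lborel) \<le> (sqrt K1 + sqrt K2) * (sqrt (enn2real ?G) + ?L)"
      using sq(1) by blast
  qed
qed

end
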